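(* Let $G$ be a Lie group. Suppose (i) $G$ admits a bi-invariant Riemannian or semi-Riemannian metric and (ii) $G$ admits a left invariant contact structure. Then $G$ is locally isomorphic to $SL(2,\mathbb R)$ or to $SU(2)$.
   Context: A semi-Riemannian metric is a smooth field of symmetric nondegenerate real-valued bilinear forms. A metric on a Lie group is bi-invariant if it is invariant under both left and right translations. A left invariant contact structure on a Lie group $G$ of dimension $2n+1$ is given by a left invariant 1-form $\eta^+$ with $(d\eta^+)^n\wedge\eta^+\neq0$ pointwise. Two Lie groups are locally isomorphic if their Lie algebras are isomorphic.
   Formalization: The contact structure is required to have n ≥ 1 (dimension at least 3); for n = 0 the claim fails, since the additive group of real numbers with metric dx² and form dx satisfies (i) and (ii) but is one-dimensional. *)

theory Defs
  imports
    "HOL-Analysis.Analysis"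
    "HOL-Algebra.Group"
    "HOL-Combinatorics.Permutations"
begin

section \<open>Smooth maps between open sets\<close>

text \<open>The functions are total, but \<open>S\<close> is meant to be open throughout, so that
  \<^term>\<open>frechet_derivative f (at x)\<close> depends only on the values of \<open>f\<close> on \<open>S\<close>.\<close>

primrec Ck_on ::
  "nat \<Rightarrow> 'e::euclidean_space set \<Rightarrow> ('e \<Rightarrow> 'f::real_normed_vector) \<Rightarrow> bool"
where
  "Ck_on 0 S f \<longleftrightarrow> continuous_on S f"
| "Ck_on (Suc k) S f \<longleftrightarrow>
     f differentiable_on S \<and> (\<forall>v. Ck_on k S (\<lambda>x. frechet_derivative f (at x) v))"

definition smooth_on ::
  "'e::euclidean_space set \<Rightarrow> ('e \<Rightarrow> 'f::real_normed_vector) \<Rightarrow> bool"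
where
  "smooth_on S f \<longleftrightarrow> (\<forall>k. Ck_on k S f)"


section \<open>Smooth manifolds\<close>

type_synonym ('a, 'e) chart = "'a set \<times> ('a \<Rightarrow> 'e)"

abbreviation cdom :: "('a, 'e) chart \<Rightarrow> 'a set" where "cdom \<equiv> fst"
abbreviation cmap :: "('a, 'e) chart \<Rightarrow> 'a \<Rightarrow> 'e" where "cmap \<equiv> snd"

definition cimg :: "('a, 'e) chart \<Rightarrow> 'e set" where
  "cimg c = cmap c ` cdom c"

definition cinv :: "('a, 'e) chart \<Rightarrow> 'e \<Rightarrow> 'a" where
  "cinv c = inv_into (cdom c) (cmap c)"

definition chart_on :: "'a topology \<Rightarrow> ('a, 'e::euclidean_space) chart \<Rightarrow> bool" where
  "chart_on X c \<longleftrightarrow>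
     openin X (cdom c) \<and> open (cimg c) \<and>
     homeomorphic_map (subtopology X (cdom c)) (top_of_set (cimg c)) (cmap c)"

text \<open>The dimension is carried by the model space: it is \<open>DIM('e)\<close>.  The atlas need not
  be maximal.\<close>

record ('a, 'e) manifold =
  mtop :: "'a topology"
  atlas :: "('a, 'e) chart set"

locale smooth_manifold =
  fixes M :: "('a, 'e::euclidean_space) manifold"
  assumes Hausdorff: "Hausdorff_space (mtop M)"
    and second_countable: "second_countable (mtop M)"
    and charts: "c \<in> atlas M \<Longrightarrow> chart_on (mtop M) c"
    and charts_cover: "(\<Union>c\<in>atlas M. cdom c) = topspace (mtop M)"
    and charts_compatible:
      "c \<in> atlas M \<Longrightarrow> d \<in> atlas M \<Longrightarrow> smooth_on (cmap c ` (cdom c \<inter> cdom d)) (cmap d \<circ> cinv c)"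

definition smooth_map ::
  "('a, 'e::euclidean_space) manifold \<Rightarrow> ('b, 'f::euclidean_space) manifold \<Rightarrow> ('a \<Rightarrow> 'b) \<Rightarrow> bool"
where
  "smooth_map M N f \<longleftrightarrow>
     continuous_map (mtop M) (mtop N) f \<and>
     (\<forall>c\<in>atlas M. \<forall>d\<in>atlas N.
        smooth_on (cmap c ` {p \<in> cdom c. f p \<in> cdom d}) (cmap d \<circ> f \<circ> cinv c))"

definition prod_manifold ::
  "('a, 'e::euclidean_space) manifold \<Rightarrow> ('b, 'f::euclidean_space) manifold
     \<Rightarrow> ('a \<times> 'b, 'e \<times> 'f) manifold"
where
  "prod_manifold M N =
     \<lparr> mtop = prod_topology (mtop M) (mtop N),
       atlas = {(cdom c \<times> cdom d, map_prod (cmap c) (cmap d)) | c d. c \<in> atlas M \<and> d \<in> atlas N} \<rparr>"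

text \<open>The standard smooth structure of an embedded submanifold of a Euclidean space: its
  charts are the inverses of the smooth immersive parametrizations that are homeomorphisms
  onto relatively open subsets.  They cover \<open>S\<close> exactly if \<open>S\<close> is an embedded submanifold
  of dimension \<open>DIM('e)\<close>.\<close>

definition submanifold ::
  "'v::euclidean_space set \<Rightarrow> ('v, 'e::euclidean_space) manifold"
where
  "submanifold S =
     \<lparr> mtop = top_of_set S,
       atlas = {c. chart_on (top_of_set S) c \<and> smooth_on (cimg c) (cinv c) \<and>
                   (\<forall>x\<in>cimg c. inj (frechet_derivative (cinv c) (at x)))} \<rparr>"


section \<open>Tangent vectors\<close>

text \<open>A tangent vector at \<open>p\<close> assigns to each chart around \<open>p\<close> a vector of components, and
  these transform by the Jacobians of the coordinate changes.  Components with respect to all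
  other charts are set to \<open>0\<close>, so that equality of tangent vectors is equality of functions.
  The vector space operations are pointwise.\<close>

type_synonym ('a, 'e) tvec = "('a, 'e) chart \<Rightarrow> 'e"

definition charts_at :: "('a, 'e) manifold \<Rightarrow> 'a \<Rightarrow> ('a, 'e) chart set" where
  "charts_at M p = {c \<in> atlas M. p \<in> cdom c}"

definition tangent_space ::
  "('a, 'e::euclidean_space) manifold \<Rightarrow> 'a \<Rightarrow> ('a, 'e) tvec set"
where
  "tangent_space M p =
     {v. (\<forall>c\<in>charts_at M p. \<forall>d\<in>charts_at M p.
            v d = frechet_derivative (cmap d \<circ> cinv c) (at (cmap c p)) (v c)) \<and>
         (\<forall>c. c \<notin> charts_at M p \<longrightarrow> v c = 0)}"

definition tv_add :: "('a, 'e::euclidean_space) tvec \<Rightarrow> ('a, 'e) tvec \<Rightarrow> ('a, 'e) tvec" where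
  "tv_add v w = (\<lambda>c. v c + w c)"

definition tv_scale :: "real \<Rightarrow> ('a, 'e::euclidean_space) tvec \<Rightarrow> ('a, 'e) tvec" where
  "tv_scale r v = (\<lambda>c. r *\<^sub>R v c)"

definition tv_zero :: "('a, 'e::euclidean_space) tvec" where
  "tv_zero = (\<lambda>c. 0)"

text \<open>The tangent vector at \<open>p\<close> whose component vector in the chart \<open>c\<close> is \<open>u\<close>.  For fixed
  \<open>u\<close> and varying \<open>p\<close> this is the constant-coefficient vector field of the chart \<open>c\<close>.\<close>

definition coord_vec ::
  "('a, 'e::euclidean_space) manifold \<Rightarrow> ('a, 'e) chart \<Rightarrow> 'e \<Rightarrow> 'a \<Rightarrow> ('a, 'e) tvec"
where
  "coord_vec M c u p =
     (\<lambda>d. if d \<in> charts_at M p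
          then frechet_derivative (cmap d \<circ> cinv c) (at (cmap c p)) u else 0)"

text \<open>By the chain rule the choice of \<open>c\<close> is immaterial for smooth \<open>f\<close> and
  \<open>v\<close> in the tangent space at \<open>p\<close>.\<close>

definition tangent_map ::
  "('a, 'e::euclidean_space) manifold \<Rightarrow> ('b, 'f::euclidean_space) manifold
     \<Rightarrow> ('a \<Rightarrow> 'b) \<Rightarrow> 'a \<Rightarrow> ('a, 'e) tvec \<Rightarrow> ('b, 'f) tvec"
where
  "tangent_map M N f p v =
     (let c = (SOME c. c \<in> charts_at M p) in
      (\<lambda>d. if d \<in> charts_at N (f p)
           then frechet_derivative (cmap d \<circ> f \<circ> cinv c) (at (cmap c p)) (v c) else 0))"

text \<open>In coordinates, \<open>[X, Y] = D Y (X) - D X (Y)\<close>.\<close>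

definition vf_bracket ::
  "('a, 'e::euclidean_space) manifold \<Rightarrow> ('a \<Rightarrow> ('a, 'e) tvec) \<Rightarrow> ('a \<Rightarrow> ('a, 'e) tvec)
     \<Rightarrow> 'a \<Rightarrow> ('a, 'e) tvec"
where
  "vf_bracket M X Y p =
     (\<lambda>c. if c \<in> charts_at M p
          then frechet_derivative (\<lambda>x. Y (cinv c x) c) (at (cmap c p)) (X p c)
             - frechet_derivative (\<lambda>x. X (cinv c x) c) (at (cmap c p)) (Y p c)
          else 0)"


section \<open>Metrics and differential forms\<close>

definition semi_riemannian_metric ::
  "('a, 'e::euclidean_space) manifold \<Rightarrow> ('a \<Rightarrow> ('a, 'e) tvec \<Rightarrow> ('a, 'e) tvec \<Rightarrow> real) \<Rightarrow> bool"
where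
  "semi_riemannian_metric M g \<longleftrightarrow>
     (\<forall>p\<in>topspace (mtop M).
        (\<forall>u\<in>tangent_space M p. \<forall>v\<in>tangent_space M p. \<forall>w\<in>tangent_space M p. \<forall>r.
           g p (tv_add u v) w = g p u w + g p v w \<and>
           g p (tv_scale r u) w = r * g p u w \<and>
           g p u w = g p w u) \<and>
        (\<forall>v\<in>tangent_space M p. (\<forall>w\<in>tangent_space M p. g p v w = 0) \<longrightarrow> v = tv_zero)) \<and>
     (\<forall>c\<in>atlas M. \<forall>u w.
        smooth_on (cimg c) (\<lambda>x. g (cinv c x) (coord_vec M c u (cinv c x)) (coord_vec M c w (cinv c x))))"

definition riemannian_metric ::
  "('a, 'e::euclidean_space) manifold \<Rightarrow> ('a \<Rightarrow> ('a, 'e) tvec \<Rightarrow> ('a, 'e) tvec \<Rightarrow> real) \<Rightarrow> bool"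
where
  "riemannian_metric M g \<longleftrightarrow>
     semi_riemannian_metric M g \<and>
     (\<forall>p\<in>topspace (mtop M). \<forall>v\<in>tangent_space M p. v \<noteq> tv_zero \<longrightarrow> g p v v > 0)"

definition smooth_one_form ::
  "('a, 'e::euclidean_space) manifold \<Rightarrow> ('a \<Rightarrow> ('a, 'e) tvec \<Rightarrow> real) \<Rightarrow> bool"
where
  "smooth_one_form M \<eta> \<longleftrightarrow>
     (\<forall>p\<in>topspace (mtop M). \<forall>u\<in>tangent_space M p. \<forall>v\<in>tangent_space M p. \<forall>r.
        \<eta> p (tv_add u v) = \<eta> p u + \<eta> p v \<and> \<eta> p (tv_scale r u) = r * \<eta> p u) \<and>
     (\<forall>c\<in>atlas M. \<forall>u. smooth_on (cimg c) (\<lambda>x. \<eta> (cinv c x) (coord_vec M c u (cinv c x))))"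

text \<open>In a chart, \<open>d\<eta>(v, w) = v(\<eta>(W)) - w(\<eta>(V))\<close>, where \<open>V\<close>, \<open>W\<close> are the
  constant-coefficient (hence commuting) fields extending \<open>v\<close>, \<open>w\<close>.  The value does not
  depend on the chart.\<close>

definition ext_deriv ::
  "('a, 'e::euclidean_space) manifold \<Rightarrow> ('a \<Rightarrow> ('a, 'e) tvec \<Rightarrow> real)
     \<Rightarrow> 'a \<Rightarrow> ('a, 'e) tvec \<Rightarrow> ('a, 'e) tvec \<Rightarrow> real"
where
  "ext_deriv M \<eta> p v w =
     (let c = (SOME c. c \<in> charts_at M p) in
        frechet_derivative (\<lambda>x. \<eta> (cinv c x) (coord_vec M c (w c) (cinv c x))) (at (cmap c p)) (v c)
      - frechet_derivative (\<lambda>x. \<eta> (cinv c x) (coord_vec M c (v c) (cinv c x))) (at (cmap c p)) (w c))"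

text \<open>A \<open>k\<close>-form is a function of a sequence of vectors of which only the entries with
  index below \<open>k\<close> matter; \<open>wedge k l\<close> is the exterior product of a \<open>k\<close>-form and an
  \<open>l\<close>-form.\<close>

definition wedge ::
  "nat \<Rightarrow> nat \<Rightarrow> ((nat \<Rightarrow> 'v) \<Rightarrow> real) \<Rightarrow> ((nat \<Rightarrow> 'v) \<Rightarrow> real) \<Rightarrow> (nat \<Rightarrow> 'v) \<Rightarrow> real"
where
  "wedge k l \<alpha> \<beta> v =
     (\<Sum>\<sigma> | \<sigma> permutes {..<k + l}.
        of_int (sign \<sigma>) * \<alpha> (\<lambda>i. v (\<sigma> i)) * \<beta> (\<lambda>i. v (\<sigma> (k + i)))) / (fact k * fact l)"

text \<open>The \<open>n\<close>-th exterior power of a \<open>k\<close>-form, a \<open>k * n\<close>-form.\<close>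

primrec wedge_power ::
  "nat \<Rightarrow> ((nat \<Rightarrow> 'v) \<Rightarrow> real) \<Rightarrow> nat \<Rightarrow> (nat \<Rightarrow> 'v) \<Rightarrow> real"
where
  "wedge_power k \<alpha> 0 = (\<lambda>v. 1)"
| "wedge_power k \<alpha> (Suc n) = wedge k (k * n) \<alpha> (wedge_power k \<alpha> n)"


section \<open>Lie groups\<close>

locale lie_group = group G + smooth_manifold M
  for G :: "'a monoid" (structure) and M :: "('a, 'e::euclidean_space) manifold" +
  assumes carrier_eq: "carrier G = topspace (mtop M)"
    and smooth_mult: "smooth_map (prod_manifold M M) M (\<lambda>(a, b). a \<otimes> b)"
    and smooth_inv: "smooth_map M M (m_inv G)"

definition left_translation :: "'a monoid \<Rightarrow> 'a \<Rightarrow> 'a \<Rightarrow> 'a" where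
  "left_translation G a = (\<lambda>x. a \<otimes>\<^bsub>G\<^esub> x)"

definition right_translation :: "'a monoid \<Rightarrow> 'a \<Rightarrow> 'a \<Rightarrow> 'a" where
  "right_translation G a = (\<lambda>x. x \<otimes>\<^bsub>G\<^esub> a)"

definition metric_invariant_under ::
  "('a, 'e::euclidean_space) manifold \<Rightarrow> ('a \<Rightarrow> 'a)
     \<Rightarrow> ('a \<Rightarrow> ('a, 'e) tvec \<Rightarrow> ('a, 'e) tvec \<Rightarrow> real) \<Rightarrow> bool"
where
  "metric_invariant_under M f g \<longleftrightarrow>
     (\<forall>p\<in>topspace (mtop M). \<forall>v\<in>tangent_space M p. \<forall>w\<in>tangent_space M p.
        g (f p) (tangent_map M M f p v) (tangent_map M M f p w) = g p v w)"

definition bi_invariant_metric ::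
  "'a monoid \<Rightarrow> ('a, 'e::euclidean_space) manifold
     \<Rightarrow> ('a \<Rightarrow> ('a, 'e) tvec \<Rightarrow> ('a, 'e) tvec \<Rightarrow> real) \<Rightarrow> bool"
where
  "bi_invariant_metric G M g \<longleftrightarrow>
     (\<forall>a\<in>carrier G. metric_invariant_under M (left_translation G a) g \<and>
                    metric_invariant_under M (right_translation G a) g)"

definition left_invariant_form ::
  "'a monoid \<Rightarrow> ('a, 'e::euclidean_space) manifold \<Rightarrow> ('a \<Rightarrow> ('a, 'e) tvec \<Rightarrow> real) \<Rightarrow> bool"
where
  "left_invariant_form G M \<eta> \<longleftrightarrow>
     (\<forall>a\<in>carrier G. \<forall>p\<in>topspace (mtop M). \<forall>v\<in>tangent_space M p.
        \<eta> (a \<otimes>\<^bsub>G\<^esub> p) (tangent_map M M (left_translation G a) p v) = \<eta> p v)"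

text \<open>The condition \<open>n \<ge> 1\<close> excludes the degenerate one-dimensional case, in which any
  nowhere vanishing 1-form would count as a contact form.\<close>

definition left_invariant_contact_form ::
  "'a monoid \<Rightarrow> ('a, 'e::euclidean_space) manifold \<Rightarrow> nat \<Rightarrow> ('a \<Rightarrow> ('a, 'e) tvec \<Rightarrow> real) \<Rightarrow> bool"
where
  "left_invariant_contact_form G M n \<eta> \<longleftrightarrow>
     n \<ge> 1 \<and> DIM('e) = 2 * n + 1 \<and>
     smooth_one_form M \<eta> \<and> left_invariant_form G M \<eta> \<and>
     (\<forall>p\<in>topspace (mtop M). \<exists>v. (\<forall>i. v i \<in> tangent_space M p) \<and>
        wedge (2 * n) 1 (wedge_power 2 (\<lambda>u. ext_deriv M \<eta> p (u 0) (u 1)) n) (\<lambda>u. \<eta> p (u 0)) v \<noteq> 0)"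


section \<open>The Lie algebra of a Lie group\<close>

text \<open>The Lie algebra is the tangent space at the identity, with the bracket inherited from
  the left invariant vector fields.\<close>

definition lie_algebra ::
  "'a monoid \<Rightarrow> ('a, 'e::euclidean_space) manifold \<Rightarrow> ('a, 'e) tvec set"
where
  "lie_algebra G M = tangent_space M \<one>\<^bsub>G\<^esub>"

definition left_invariant_field ::
  "'a monoid \<Rightarrow> ('a, 'e::euclidean_space) manifold \<Rightarrow> ('a, 'e) tvec \<Rightarrow> 'a \<Rightarrow> ('a, 'e) tvec"
where
  "left_invariant_field G M v = (\<lambda>a. tangent_map M M (left_translation G a) \<one>\<^bsub>G\<^esub> v)"

definition lie_bracket ::
  "'a monoid \<Rightarrow> ('a, 'e::euclidean_space) manifold
     \<Rightarrow> ('a, 'e) tvec \<Rightarrow> ('a, 'e) tvec \<Rightarrow> ('a, 'e) tvec"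
where
  "lie_bracket G M v w =
     vf_bracket M (left_invariant_field G M v) (left_invariant_field G M w) \<one>\<^bsub>G\<^esub>"

definition locally_isomorphic ::
  "'a monoid \<Rightarrow> ('a, 'e::euclidean_space) manifold
     \<Rightarrow> 'b monoid \<Rightarrow> ('b, 'f::euclidean_space) manifold \<Rightarrow> bool"
where
  "locally_isomorphic G M H N \<longleftrightarrow>
     (\<exists>\<phi>. bij_betw \<phi> (lie_algebra G M) (lie_algebra H N) \<and>
        (\<forall>v\<in>lie_algebra G M. \<forall>w\<in>lie_algebra G M. \<forall>r.
           \<phi> (tv_add v w) = tv_add (\<phi> v) (\<phi> w) \<and>
           \<phi> (tv_scale r v) = tv_scale r (\<phi> v) \<and>
           \<phi> (lie_bracket G M v w) = lie_bracket H N (\<phi> v) (\<phi> w)))"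


section \<open>The groups SL(2,R) and SU(2)\<close>

definition SL2R :: "(real^2^2) monoid" where
  "SL2R = \<lparr> carrier = {A. det A = 1}, mult = (**), one = mat 1 \<rparr>"

definition SL2R_manifold :: "(real^2^2, real^3) manifold" where
  "SL2R_manifold = submanifold (carrier SL2R)"

definition SU2 :: "(complex^2^2) monoid" where
  "SU2 = \<lparr> carrier = {A. A ** transpose (map_matrix cnj A) = mat 1 \<and> det A = 1},
           mult = (**), one = mat 1 \<rparr>"

definition SU2_manifold :: "(complex^2^2, real^3) manifold" where
  "SU2_manifold = submanifold (carrier SU2)"

end

theory Submission
  imports Defs "HOL-Computational_Algebra.Fundamental_Theorem_Algebra"
begin

text \<open>On the Lie algebra, write the contact form as \<open>\<eta> = b(\<xi>, \<sqdot>)\<close>, where \<open>b\<close> is the invariant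
  metric. Left invariance gives \<open>d\<eta>(u, v) = - \<eta> [u, v]\<close>, and invariance of \<open>b\<close> turns this into
  \<open>- b([\<xi>, u], v)\<close>. Hence the kernel of \<open>d\<eta>\<close> is the centralizer of \<open>\<xi>\<close>. The contact condition says
  that \<open>d\<eta>\<close> and \<open>\<eta>\<close> have no common kernel vector (\<open>contact_form_nondegenerate\<close>), so the
  centralizer of \<open>\<xi>\<close> is the line through \<open>\<xi>\<close>, and \<open>b(\<xi>, \<xi>) \<noteq> 0\<close>. What is left is algebra: a Lie
  algebra of dimension at least three with an invariant nondegenerate symmetric form and a
  nonisotropic vector whose centralizer is the line through it is \<open>sl(2, \<real>)\<close> or \<open>su(2)\<close>.

  This is the rank one case of the root space analysis, done here with vectors only.
  Complexify and put \<open>D = ad \<xi>\<close>. For an eigenvector \<open>e\<close> of \<open>D\<close> with eigenvalue \<open>l \<noteq> 0\<close>, duality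
  puts \<open>\<xi>\<close> into the image of \<open>ad e\<close> (\<open>\<xi>_in_range\<close>), and the argument of Morozov improves a
  preimage to an \<open>f\<close> with \<open>[e, f] = \<xi>\<close> and \<open>[\<xi>, f] = - l f\<close> (\<open>lowering_eigenvector\<close>), a rescaled
  \<open>sl(2)\<close>-triple. All eigenvalues of \<open>D\<close> are multiples of \<open>l / 2\<close>, so \<open>l\<close> can be chosen such that
  \<open>l / 2\<close> is not one of them. A string descending from a vector killed by \<open>ad e\<close> then has to pass
  through the eigenvalue 0, that is through the line of \<open>\<xi>\<close>, one step below the line of \<open>e\<close>;
  therefore \<open>ad e\<close> has the one-dimensional kernel spanned by \<open>e\<close> (\<open>ker_one_dimensional\<close>). So the
  nilpotent map \<open>ad e\<close> is a single Jordan block, and it cannot be longer than \<open>f, \<xi>, e\<close>, because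
  \<open>f\<close> is not orthogonal to the kernel of \<open>ad e\<close> (\<open>spanned_by_three\<close>). In dimension three there is
  a basis \<open>\<xi>, u, w\<close> with \<open>[\<xi>, u] = w\<close>, \<open>[\<xi>, w] = p u\<close>, \<open>[u, w] = q \<xi>\<close> (\<open>adapted_basis\<close>); the signs
  of \<open>p\<close> and \<open>q\<close> tell the algebras apart, and only \<open>p < 0 < q\<close> gives \<open>su(2)\<close>.

  The link between group and algebra is made in one chart around the identity. There the
  bracket is the antisymmetrization of the mixed second derivative of the multiplication, and it
  is also the derivative of \<open>Ad\<close>. The Jacobi identity is the derivative of
  \<open>Ad a [v, w] = [Ad a v, Ad a w]\<close>, the invariance of \<open>b\<close> is the derivative of the equality of the
  metric on left and on right translates, and the formula for \<open>d\<eta>\<close> is the derivative of the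
  constancy of \<open>\<eta>\<close> on left translates. For the two matrix groups the bracket is computed through
  the inverse charts, which are parametrizations by matrices (\<open>lie_bracket_N\<close>), and turns out to
  be the commutator.\<close>

section \<open>Complex linear algebra by complex scaling\<close>

text \<open>Complex scalars act on a real Euclidean space.  In this form the dimension theory and the
  operator norm of the real space stay available for complex linear maps.\<close>

locale complex_scaling =
  fixes cs :: "complex \<Rightarrow> 'v::euclidean_space \<Rightarrow> 'v"
  assumes cs_add: "cs a (x + y) = cs a x + cs a y"
    and cs_add_left: "cs (a + b) x = cs a x + cs b x"
    and cs_cs: "cs a (cs b x) = cs (a * b) x"
    and cs_of_real: "cs (of_real r) x = r *\<^sub>R x"
    and norm_cs: "norm (cs a x) = cmod a * norm x"
begin

sublocale c: vector_space cs
  using cs_of_real[of 1] by unfold_locales (simp_all add: cs_add cs_add_left cs_cs)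

abbreviation clinear :: "('v \<Rightarrow> 'v) \<Rightarrow> bool" where
  "clinear \<equiv> module_hom cs cs"

lemma clinearI:
  assumes "\<And>x y. T (x + y) = T x + T y" and "\<And>a x. T (cs a x) = cs a (T x)"
  shows "clinear T"
  using assms by (simp add: module_hom_iff c.module_axioms)

lemma clinear_imp_linear:
  assumes "clinear T" shows "linear T"
proof
  show "T (x + y) = T x + T y" for x y
    using assms by (simp add: module_hom.add)
  show "T (r *\<^sub>R x) = r *\<^sub>R T x" for r x
    using module_hom.scale[OF assms, of "of_real r" x] by (simp add: cs_of_real)
qed

lemma csubspace_imp_subspace: "c.subspace S \<Longrightarrow> subspace S"
  unfolding subspace_def c.subspace_def by (metis cs_of_real)

lemma clinear_inj_imp_surj_on:
  assumes T: "clinear T" and S: "c.subspace S" and inv: "T ` S \<subseteq> S"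
    and inj: "\<And>x. x \<in> S \<Longrightarrow> T x = 0 \<Longrightarrow> x = 0"
  shows "T ` S = S"
proof -
  have lT: "linear T" and sS: "subspace S"
    using T S by (auto intro: clinear_imp_linear csubspace_imp_subspace)
  have "inj_on T S"
    using inj by (subst linear_inj_on_iff_eq_0[OF lT sS]) auto
  then have "dim (T ` S) = dim S"
    by (metis dim_image_eq lT sS span_eq_iff)
  then show ?thesis
    using subspace_dim_equal[OF linear_subspace_image[OF lT sS] sS inv] by simp
qed

lemma clinear_funpow_scale: "clinear T \<Longrightarrow> (T ^^ n) (cs a x) = cs a ((T ^^ n) x)"
  by (induction n) (simp_all add: module_hom.scale)

lemma funpow_in: "T ` S \<subseteq> S \<Longrightarrow> x \<in> S \<Longrightarrow> (T ^^ n) x \<in> S"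
  by (induction n) auto

text \<open>The operator obtained by substituting \<open>T\<close> into the polynomial \<open>p\<close>.\<close>

definition poly_act :: "('v \<Rightarrow> 'v) \<Rightarrow> complex poly \<Rightarrow> 'v \<Rightarrow> 'v" where
  "poly_act T p x = (\<Sum>i\<le>degree p. cs (coeff p i) ((T ^^ i) x))"

lemma poly_act_bound:
  assumes "degree p \<le> N"
  shows "poly_act T p x = (\<Sum>i\<le>N. cs (coeff p i) ((T ^^ i) x))"
  unfolding poly_act_def
  by (rule sum.mono_neutral_left) (use assms in \<open>auto simp: coeff_eq_0\<close>)

lemma poly_act_const: "poly_act T [:a:] x = cs a x"
  by (simp add: poly_act_def)

lemma poly_act_in:
  assumes "c.subspace S" "T ` S \<subseteq> S" "x \<in> S"
  shows "poly_act T p x \<in> S"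
  unfolding poly_act_def
  using assms by (intro c.subspace_sum c.subspace_scale funpow_in) auto

lemma poly_act_pCons:
  assumes "clinear T"
  shows "poly_act T (pCons a q) x = cs a x + T (poly_act T q x)"
proof -
  have "poly_act T (pCons a q) x = (\<Sum>i\<le>Suc (degree q). cs (coeff (pCons a q) i) ((T ^^ i) x))"
    by (rule poly_act_bound) (simp add: degree_pCons_le)
  also have "\<dots> = cs a x + (\<Sum>i\<le>degree q. T (cs (coeff q i) ((T ^^ i) x)))"
    by (subst sum.atMost_Suc_shift) (simp add: module_hom.scale[OF assms])
  finally show ?thesis
    by (simp add: poly_act_def module_hom.sum[OF assms])
qed

lemma poly_act_add:
  "poly_act T (p + q) x = poly_act T p x + poly_act T q x"
proof -
  let ?N = "max (degree p) (degree q)"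
  have "poly_act T (p + q) x = (\<Sum>i\<le>?N. cs (coeff (p + q) i) ((T ^^ i) x))"
    by (rule poly_act_bound) (simp add: degree_add_le_max)
  also have "\<dots> = (\<Sum>i\<le>?N. cs (coeff p i) ((T ^^ i) x)) + (\<Sum>i\<le>?N. cs (coeff q i) ((T ^^ i) x))"
    by (simp add: cs_add_left sum.distrib)
  finally show ?thesis
    by (simp add: poly_act_bound[of p ?N] poly_act_bound[of q ?N])
qed

lemma poly_act_smult: "poly_act T (smult a p) x = cs a (poly_act T p x)"
  using poly_act_bound[of "smult a p" "degree p"]
  by (simp add: poly_act_def c.scale_sum_right cs_cs)

lemma poly_act_linear_factor:
  assumes "clinear T"
  shows "poly_act T ([:-r, 1:] * q) x = T (poly_act T q x) - cs r (poly_act T q x)"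
proof -
  have "[:-r, 1:] * q = smult (-r) q + pCons 0 q"
    by simp
  then show ?thesis
    by (simp only: poly_act_add poly_act_smult poly_act_pCons[OF assms] c.scale_zero_left
        c.scale_minus_left) simp
qed

text \<open>Among the \<open>DIM('v) + 1\<close> iterates of \<open>x\<close> there is a real linear relation.  If two iterates
  coincide, the relation is a difference of monomials; otherwise it comes from the linear
  dependence of too many distinct vectors.\<close>

lemma annihilating_poly:
  "\<exists>p. p \<noteq> 0 \<and> poly_act T p x = 0"
proof (cases "inj_on (\<lambda>i. (T ^^ i) x) {..DIM('v)}")
  case False
  then obtain i j where ij: "i \<noteq> j" "(T ^^ i) x = (T ^^ j) x"
    by (auto simp: inj_on_def)
  let ?p = "monom (1::complex) i - monom 1 j"
  have "coeff ?p i = 1"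
    using ij by simp
  then have "?p \<noteq> 0"
    by (metis coeff_0 zero_neq_one)
  have "poly_act T (monom a k) x = cs a ((T ^^ k) x)" for a k
  proof -
    have "poly_act T (monom a k) x = (\<Sum>n\<le>k. cs (coeff (monom a k) n) ((T ^^ n) x))"
      by (rule poly_act_bound) (simp add: degree_monom_le)
    also have "\<dots> = (\<Sum>n\<in>{k}. cs (coeff (monom a k) n) ((T ^^ n) x))"
      by (rule sum.mono_neutral_right) auto
    finally show ?thesis by simp
  qed
  moreover have "?p = monom 1 i + smult (-1) (monom 1 j)"
    by simp
  ultimately have "poly_act T ?p x = 0"
    using ij by (simp only: poly_act_add poly_act_smult c.scale_minus_left) simp
  with \<open>?p \<noteq> 0\<close> show ?thesis by blast
next
  case True
  let ?f = "\<lambda>i. (T ^^ i) x" and ?I = "{..DIM('v)}"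
  have "dependent (?f ` ?I)"
    by (rule dependent_biggerset) (simp add: card_image[OF True])
  then obtain u v where u: "(\<Sum>v\<in>?f ` ?I. u v *\<^sub>R v) = 0" and v: "v \<in> ?f ` ?I" "u v \<noteq> 0"
    by (auto simp: dependent_finite)
  define p where "p = (\<Sum>i\<in>?I. monom (complex_of_real (u (?f i))) i)"
  have cp: "coeff p n = (if n \<in> ?I then complex_of_real (u (?f n)) else 0)" for n
    by (simp add: p_def coeff_sum)
  have "degree p \<le> DIM('v)"
    unfolding p_def by (intro degree_sum_le) (auto intro: order_trans[OF degree_monom_le])
  then have "poly_act T p x = (\<Sum>i\<in>?I. cs (coeff p i) (?f i))"
    by (rule poly_act_bound)
  also have "\<dots> = (\<Sum>i\<in>?I. u (?f i) *\<^sub>R ?f i)"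
    by (intro sum.cong) (simp_all add: cp cs_of_real)
  also have "\<dots> = 0"
    using u by (simp add: sum.reindex[OF True] o_def)
  finally have "poly_act T p x = 0" .
  moreover have "p \<noteq> 0"
  proof
    assume "p = 0"
    obtain i where "i \<in> ?I" "v = ?f i" using v by auto
    then show False
      using cp[of i] v \<open>p = 0\<close> by simp
  qed
  ultimately show ?thesis by blast
qed

text \<open>Split off a linear factor \<open>X - r\<close> of the annihilating polynomial.  Either the cofactor
  already annihilates \<open>x\<close>, or its value at \<open>x\<close> is an eigenvector for \<open>r\<close>.\<close>

lemma eigenvector_from_poly:
  assumes T: "clinear T" and S: "c.subspace S" and inv: "T ` S \<subseteq> S"
  shows "p \<noteq> 0 \<Longrightarrow> x \<in> S \<Longrightarrow> x \<noteq> 0 \<Longrightarrow> poly_act T p x = 0 \<Longrightarrow> \<exists>e\<in>S. \<exists>l. e \<noteq> 0 \<and> T e = cs l e"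
proof (induction "degree p" arbitrary: p rule: less_induct)
  case less
  show ?case
  proof (cases "degree p = 0")
    case True
    then obtain a where "p = [:a:]" by (rule degree_eq_zeroE)
    then have False using less.prems by (simp add: poly_act_const)
    then show ?thesis ..
  next
    case False
    then obtain r where "poly p r = 0"
      using fundamental_theorem_of_algebra[of p] constant_degree[of p] by auto
    then obtain q where q: "p = [:-r, 1:] * q"
      by (metis poly_eq_0_iff_dvd dvdE)
    then have q0: "q \<noteq> 0" using less.prems by auto
    have deg: "degree q < degree p"
      using q0 unfolding q by (subst degree_mult_eq) auto
    have eq: "T (poly_act T q x) = cs r (poly_act T q x)"
      using less.prems(4) poly_act_linear_factor[OF T, of r q x] by (simp add: q)
    show ?thesis
    proof (cases "poly_act T q x = 0")
      case True
      then show ?thesis using less.hyps[OF deg q0] less.prems by blast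
    next
      case False
      then show ?thesis
        using eq poly_act_in[OF S inv less.prems(2)] by blast
    qed
  qed
qed

lemma eigenvector_exists:
  assumes "clinear T" "c.subspace S" "T ` S \<subseteq> S" "x \<in> S" "x \<noteq> 0"
  obtains e l where "e \<in> S" "e \<noteq> 0" "T e = cs l e"
  using eigenvector_from_poly[OF assms(1-3) _ assms(4,5)] annihilating_poly by metis

end

section \<open>Complex Lie algebras with an invariant form and a one-dimensional centralizer\<close>

text \<open>A nondegenerate form is an injective, hence surjective, map into the dual space; the dual is
  identified with the space by the Euclidean inner product.\<close>

lemma nondegenerate_form_represents:
  fixes b :: "'v::euclidean_space \<Rightarrow> 'v \<Rightarrow> real"
  assumes b: "bilinear b" and nondeg: "\<And>x. (\<And>y. b x y = 0) \<Longrightarrow> x = 0" and k: "linear k"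
  obtains x where "\<And>y. b x y = k y"
proof -
  define g where "g x = (\<Sum>e\<in>Basis. b x e *\<^sub>R e)" for x
  have expand: "h w = (\<Sum>e\<in>Basis. (w \<bullet> e) * h e)" if "linear h" for h :: "'v \<Rightarrow> real" and w
  proof -
    have "h w = h (\<Sum>e\<in>Basis. (w \<bullet> e) *\<^sub>R e)" by (simp add: euclidean_representation)
    then show ?thesis by (simp add: linear_sum[OF that] linear_cmul[OF that])
  qed
  have lb: "linear (b x)" for x using b by (simp add: bilinear_def)
  have g: "g x \<bullet> w = b x w" for x w
    by (simp add: expand[OF lb, of x w] g_def inner_sum_left inner_commute[of w] mult.commute)
  have lg: "linear g"
    by (rule linearI)
      (simp_all add: g_def bilinear_ladd[OF b] bilinear_lmul[OF b] scaleR_add_left sum.distrib scaleR_sum_right)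
  have "inj g"
    unfolding linear_injective_0[OF lg] using g nondeg by (metis inner_zero_left)
  then obtain x where x: "g x = (\<Sum>e\<in>Basis. k e *\<^sub>R e)"
    using linear_injective_imp_surjective[OF lg] by (metis surjD)
  have "b x y = k y" for y
    by (simp add: expand[OF k, of y] x inner_sum_left inner_commute[of y] mult.commute flip: g)
  then show ?thesis by (rule that)
qed

text \<open>The form \<open>\<beta>\<close> is the real part of the complex bilinear form.  Being balanced under complex
  scalars, it records the complex form completely, and the duality arguments need only real-valued
  functionals.\<close>

locale complex_lie_rank_one = complex_scaling cs
  for cs :: "complex \<Rightarrow> 'v::euclidean_space \<Rightarrow> 'v" +
  fixes br :: "'v \<Rightarrow> 'v \<Rightarrow> 'v" and \<beta> :: "'v \<Rightarrow> 'v \<Rightarrow> real" and \<xi> :: 'v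
  assumes br_add_left: "br (x + y) z = br x z + br y z"
    and br_cs_left: "br (cs a x) y = cs a (br x y)"
    and br_anti: "br x y = - br y x"
    and br_jacobi: "br x (br y z) = br (br x y) z + br y (br x z)"
    and \<beta>_add: "\<beta> (x + y) z = \<beta> x z + \<beta> y z"
    and \<beta>_cs: "\<beta> (cs a x) y = \<beta> x (cs a y)"
    and \<beta>_scale: "\<beta> (r *\<^sub>R x) y = r * \<beta> x y"
    and \<beta>_sym: "\<beta> x y = \<beta> y x"
    and \<beta>_nondeg: "(\<And>y. \<beta> x y = 0) \<Longrightarrow> x = 0"
    and \<beta>_inv: "\<beta> (br x y) z = \<beta> x (br y z)"
    and \<xi>_aniso: "\<beta> \<xi> \<xi> \<noteq> 0"
    and centralizer_\<xi>: "br \<xi> x = 0 \<Longrightarrow> \<exists>a. x = cs a \<xi>"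
begin

lemma br_add_right: "br z (x + y) = br z x + br z y"
proof -
  have "br z (x + y) = - (br x z + br y z)"
    by (subst br_anti) (simp only: br_add_left)
  then show ?thesis using br_anti[of z x] br_anti[of z y] by simp
qed

lemma br_cs_right: "br y (cs a x) = cs a (br y x)"
proof -
  have "br y (cs a x) = - cs a (br x y)"
    by (subst br_anti) (simp only: br_cs_left)
  then show ?thesis using br_anti[of y x] by simp
qed

lemma clinear_br: "clinear (br x)"
  by (rule clinearI) (simp_all add: br_add_right br_cs_right)

lemma br_self [simp]: "br x x = 0"
  using br_anti[of x x] by (simp add: eq_neg_iff_add_eq_0 flip: scaleR_2)

lemma br_zero_right [simp]: "br x 0 = 0"
  using module_hom.zero[OF clinear_br] .

lemma br_zero_left [simp]: "br 0 x = 0"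
  using br_anti[of 0 x] by simp

lemma br_diff_right: "br z (x - y) = br z x - br z y"
  using module_hom.diff[OF clinear_br] .

lemma br_minus_right [simp]: "br x (- y) = - br x y"
  using module_hom.neg[OF clinear_br] .

lemma br_minus_left [simp]: "br (- x) y = - br x y"
  using br_anti[of "- x" y] br_anti[of x y] by simp

lemma linear_br: "linear (br x)"
  by (rule clinear_imp_linear[OF clinear_br])

lemma linear_\<beta>: "linear (\<beta> x)"
  by (rule linearI) (simp_all only: \<beta>_add \<beta>_scale \<beta>_sym[of x] real_scaleR_def)

lemma \<beta>_zero [simp]: "\<beta> x 0 = 0" "\<beta> 0 x = 0"
  using linear_0[OF linear_\<beta>, of x] \<beta>_sym[of 0 x] by simp_all

abbreviation D :: "'v \<Rightarrow> 'v" where "D \<equiv> br \<xi>"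

lemma csubspace_range_D: "c.subspace (range D)"
proof -
  have "0 \<in> range D" by (rule range_eqI[of _ _ 0]) simp
  then show ?thesis
    unfolding c.subspace_def
    by (auto simp flip: br_add_right br_cs_right)
qed

lemma csubspace_ker: "c.subspace {x. br e x = 0}"
  by (auto simp: c.subspace_def br_add_right br_cs_right)

text \<open>The image of \<open>D\<close> is orthogonal to the whole complex line of \<open>\<xi>\<close>, on which \<open>\<beta>\<close> does not
  vanish.  So the line meets the image only in 0, and \<open>D\<close> is injective on its own image.\<close>

lemma \<xi>_multiple_in_range_D:
  assumes "cs a \<xi> = br \<xi> y" shows "cs a \<xi> = 0"
proof (cases "a = 0")
  case False
  have "\<beta> \<xi> \<xi> = \<beta> (cs (1 / a) \<xi>) (cs a \<xi>)"
    using False by (simp add: \<beta>_cs cs_cs)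
  also have "\<dots> = \<beta> (cs (1 / a) (br \<xi> \<xi>)) y"
    unfolding assms by (simp add: \<beta>_inv[symmetric] br_cs_left)
  also have "\<dots> = 0" by simp
  finally show ?thesis using \<xi>_aniso by simp
qed simp

lemma D_inj_on_range:
  assumes "x \<in> range D" "D x = 0" shows "x = 0"
  using assms centralizer_\<xi> \<xi>_multiple_in_range_D by (metis imageE)

lemma ker_D_invariant:
  assumes e: "D e = cs l e" and z: "br e z = 0" shows "br e (D z) = 0"
  using br_jacobi[of \<xi> e z] e z by (simp add: br_cs_left)

text \<open>Let \<open>K\<close> be the kernel of \<open>ad e\<close>.  It is invariant under \<open>D\<close>, and \<open>D\<close> is bijective on the
  part of \<open>K\<close> inside the image of \<open>D\<close>.  So if \<open>z \<in> K\<close>, then \<open>z\<close> differs from some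
  \<open>y \<in> K \<inter> range D\<close> by a multiple of \<open>\<xi>\<close>.  This multiple lies in \<open>K\<close>, but \<open>\<xi>\<close> does not, as
  \<open>[e, \<xi>] = - l e \<noteq> 0\<close>.  Thus \<open>z\<close> is in the image of \<open>D\<close>.\<close>

lemma ker_orthogonal_\<xi>:
  assumes e: "D e = cs l e" "l \<noteq> 0" "e \<noteq> 0" and z: "br e z = 0"
  shows "\<beta> \<xi> z = 0"
proof -
  let ?K = "{x. br e x = 0} \<inter> range D"
  have "c.subspace ?K"
    by (intro c.subspace_inter csubspace_ker csubspace_range_D)
  then have "D ` ?K = ?K"
    by (rule clinear_inj_imp_surj_on[OF clinear_br])
      (auto intro: ker_D_invariant[OF e(1)] D_inj_on_range)
  moreover have "D z \<in> ?K"
    using ker_D_invariant[OF e(1) z] by simp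
  ultimately obtain y where y: "y \<in> ?K" "D z = D y" by (metis imageE)
  then obtain a where a: "z - y = cs a \<xi>"
    using centralizer_\<xi>[of "z - y"] by (auto simp: br_diff_right)
  have "br e (cs a \<xi>) = 0"
    using y z by (simp flip: a add: br_diff_right)
  then have "cs a (cs l e) = 0"
    using br_anti[of e \<xi>] e(1) by (simp add: br_cs_right)
  then have "a = 0" using e by simp
  then have "z \<in> range D" using a y by simp
  then show ?thesis by (auto simp flip: \<beta>_inv)
qed

text \<open>By skewness of \<open>ad e\<close>, a functional that kills the image of \<open>ad e\<close> is given by a vector in
  the kernel, and the kernel is orthogonal to \<open>\<xi>\<close>.\<close>

lemma \<xi>_in_range:
  assumes e: "D e = cs l e" "l \<noteq> 0" "e \<noteq> 0"
  obtains f where "br e f = \<xi>"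
proof -
  have sub: "subspace (range (br e))"
    by (rule linear_subspace_image[OF linear_br subspace_UNIV])
  have "\<xi> \<in> range (br e)"
  proof (rule ccontr)
    assume "\<xi> \<notin> range (br e)"
    obtain y z where yz: "y \<in> span (range (br e))" "\<And>w. w \<in> span (range (br e)) \<Longrightarrow> orthogonal z w" "\<xi> = y + z"
      using orthogonal_subspace_decomp_exists[of "range (br e)" \<xi>] by metis
    have z0: "z \<noteq> 0"
      using \<open>\<xi> \<notin> range (br e)\<close> yz(1,3) sub by (metis add.right_neutral span_eq_iff)
    have "bilinear \<beta>"
      by (simp add: bilinear_def linear_\<beta>) (simp add: linear_iff \<beta>_add \<beta>_scale)
    moreover have "linear (\<lambda>w. z \<bullet> w)"
      by (simp add: linear_iff inner_add_right)
    ultimately obtain x where x: "\<And>w. \<beta> x w = z \<bullet> w"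
      using nondegenerate_form_represents[of \<beta> "\<lambda>w. z \<bullet> w"] \<beta>_nondeg by metis
    have "\<beta> (br x e) w = 0" for w
    proof -
      have "z \<bullet> br e w = 0"
        using yz(2)[of "br e w"] by (simp add: span_base orthogonal_def)
      then show ?thesis by (simp only: \<beta>_inv x)
    qed
    then have "br e x = 0"
      using \<beta>_nondeg[of "br x e"] br_anti[of e x] by simp
    then have "\<beta> \<xi> x = 0" by (rule ker_orthogonal_\<xi>[OF e])
    then have "z \<bullet> \<xi> = 0" using x[of \<xi>] \<beta>_sym[of x \<xi>] by simp
    moreover have "z \<bullet> y = 0" using yz(1,2) by (simp add: orthogonal_def)
    ultimately show False using z0 yz(3) by (simp add: inner_add_right)
  qed
  then show ?thesis using that by auto
qed

lemma D_funpow: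
  assumes e: "D e = cs l e"
  shows "D ((br e ^^ k) x) = (br e ^^ k) (D x) + cs (of_nat k * l) ((br e ^^ k) x)"
proof (induction k)
  case (Suc k)
  have "D (br e ((br e ^^ k) x)) = cs l (br e ((br e ^^ k) x)) + br e (D ((br e ^^ k) x))"
    using br_jacobi[of \<xi> e] e by (simp add: br_cs_left)
  then show ?case
    unfolding Suc.IH by (simp add: br_add_right br_cs_right cs_add_left ring_distribs)
qed simp

lemma linear_br_funpow: "linear (br e ^^ k)"
proof (induction k)
  case (Suc k)
  then show ?case using linear_compose[OF Suc linear_br] by (simp add: o_def)
qed (simp add: linear_iff)

text \<open>With \<open>A = ad e\<close>, the relation \<open>[D, A\<^sup>k] = k l A\<^sup>k\<close> and the operator norm give
  \<open>k |l| \<le> 2 \<Parallel>D\<Parallel>\<close> as long as \<open>A\<^sup>k \<noteq> 0\<close>.\<close>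

lemma ad_nilpotent:
  assumes e: "D e = cs l e" "l \<noteq> 0"
  shows "\<exists>N. \<forall>x. (br e ^^ N) x = 0"
proof -
  have bl: "bounded_linear (br e ^^ k)" for k
    using linear_br_funpow by (simp add: linear_conv_bounded_linear)
  have bD: "bounded_linear D"
    using linear_br by (simp add: linear_conv_bounded_linear)
  \<comment> \<open>Already this power of \<open>ad e\<close> vanishes.\<close>
  obtain N :: nat where N: "of_nat N * cmod l > 2 * onorm D"
    using e(2) reals_Archimedean3[of "cmod l"] by auto
  let ?A = "br e ^^ N"
  have "norm (?A x) \<le> (2 * onorm D / (of_nat N * cmod l)) * onorm ?A * norm x" for x
  proof -
    have "of_nat N * cmod l * norm (?A x) = norm (cs (of_nat N * l) (?A x))"
      by (simp add: norm_cs norm_mult)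
    also have "\<dots> = norm (D (?A x) - ?A (D x))"
      by (simp add: D_funpow[OF e(1)])
    also have "\<dots> \<le> norm (D (?A x)) + norm (?A (D x))"
      by (rule norm_triangle_ineq4)
    also have "\<dots> \<le> onorm D * (onorm ?A * norm x) + onorm ?A * (onorm D * norm x)"
      by (intro add_mono order_trans[OF onorm[OF bD]] order_trans[OF onorm[OF bl]]
          mult_left_mono onorm[OF bl] onorm[OF bD] onorm_pos_le bl bD)
    finally have le: "of_nat N * cmod l * norm (?A x) \<le> 2 * onorm D * onorm ?A * norm x"
      by (simp add: algebra_simps)
    have "of_nat N * cmod l > 0"
      using N onorm_pos_le[OF bD] by linarith
    with le show ?thesis by (simp add: field_simps)
  qed
  then have "onorm ?A \<le> (2 * onorm D / (of_nat N * cmod l)) * onorm ?A"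
    using onorm_le[of ?A] by blast
  moreover have "2 * onorm D / (of_nat N * cmod l) < 1"
    using N onorm_pos_le[OF bD] by (simp add: divide_less_eq)
  ultimately have "onorm ?A = 0"
    using onorm_pos_le[OF bl[of N]] mult_strict_right_mono[of _ 1 "onorm ?A"] by fastforce
  then have "?A x = 0" for x
    using onorm[OF bl[of N], of x] by simp
  then show ?thesis by blast
qed

lemma highest_vector:
  assumes "D e = cs l e" "l \<noteq> 0" "x \<noteq> 0"
  obtains k where "(br e ^^ k) x \<noteq> 0" "br e ((br e ^^ k) x) = 0"
proof -
  obtain N where N: "(br e ^^ N) x = 0"
    using ad_nilpotent[OF assms(1,2)] by metis
  define k where "k = (LEAST k. (br e ^^ k) x = 0)"
  have k: "(br e ^^ k) x = 0" unfolding k_def by (rule LeastI[of _ N]) (rule N)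
  then have "k \<noteq> 0" using assms(3) by (metis funpow_0)
  then obtain j where j: "k = Suc j" by (cases k) auto
  have "(br e ^^ j) x \<noteq> 0"
    using not_less_Least[of j "\<lambda>k. (br e ^^ k) x = 0"] j unfolding k_def by simp
  with k j show ?thesis using that[of j] by simp
qed

lemma A_B_commutator:
  assumes "br e f = \<xi>"
  shows "br e (br f x) = D x + br f (br e x)"
  using br_jacobi[of e f x] assms by simp

text \<open>Here \<open>A = ad e\<close> and \<open>B = ad f\<close> satisfy \<open>[A, B] = D\<close>, but \<open>f\<close> need not be an eigenvector of
  \<open>D\<close>.  The formula is the usual one for \<open>[A\<^sup>n\<^sup>+\<^sup>1, B]\<close>, with \<open>D\<close> moved to the left of the powers
  of \<open>A\<close>.\<close>

lemma A_power_B: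
  assumes e: "D e = cs l e" and f: "br e f = \<xi>"
  shows "(br e ^^ Suc n) (br f z) = br f ((br e ^^ Suc n) z) +
    cs (of_nat (Suc n)) (D ((br e ^^ n) z) - cs (of_nat n * l / 2) ((br e ^^ n) z))"
proof (induction n)
  case 0
  then show ?case by (simp add: A_B_commutator[OF f])
next
  case (Suc n)
  let ?w = "(br e ^^ n) z"
  have De: "br e (D ?w) = D (br e ?w) - cs l (br e ?w)"
    using br_jacobi[of \<xi> e ?w] e by (simp add: br_cs_left)
  have "(br e ^^ Suc (Suc n)) (br f z) = br e ((br e ^^ Suc n) (br f z))"
    by simp
  also have "\<dots> = D (br e ?w) + br f (br e (br e ?w))
     + cs (of_nat (Suc n)) (br e (D ?w) - cs (of_nat n * l / 2) (br e ?w))"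
    by (simp only: Suc.IH br_add_right br_cs_right br_diff_right A_B_commutator[OF f])
       (simp add: A_B_commutator[OF f])
  also have "\<dots> = br f (br e (br e ?w)) +
      (cs (1 + of_nat (Suc n)) (D (br e ?w))
        - cs (of_nat (Suc n) * (l + of_nat n * l / 2)) (br e ?w))"
    by (simp only: De c.scale_right_diff_distrib cs_cs cs_add_left c.scale_one ring_distribs)
       (simp add: algebra_simps)
  also have "1 + of_nat (Suc n) = (of_nat (Suc (Suc n)) :: complex)"
    by simp
  also have "of_nat (Suc n) * (l + of_nat n * l / 2) = of_nat (Suc (Suc n)) * (of_nat (Suc n) * l / 2)"
    by (simp add: field_simps)
  finally show ?case
    by (simp add: c.scale_right_diff_distrib cs_cs)
qed

text \<open>If \<open>x = A\<^sup>n z\<close> is killed by \<open>A\<close>, then the commutator formula shows that \<open>(m - n l / 2) x\<close>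
  lies in the image of \<open>A\<^sup>n\<^sup>+\<^sup>1\<close>.  Unless some factor \<open>m - n l / 2\<close> vanishes, \<open>x\<close> lies in the
  image of every power of the nilpotent map \<open>A\<close>.\<close>

lemma kernel_weight:
  assumes e: "D e = cs l e" "l \<noteq> 0" "e \<noteq> 0"
    and x: "x \<noteq> 0" "br e x = 0" "D x = cs m x"
  obtains n :: nat where "m = of_nat n * l / 2"
proof -
  obtain f where f: "br e f = \<xi>" using \<xi>_in_range[OF e] .
  obtain N where N: "\<And>x. (br e ^^ N) x = 0" using ad_nilpotent[OF e(1,2)] by blast
  have "\<exists>n. m = of_nat n * l / 2"
  proof (rule ccontr)
    assume neg: "\<nexists>n. m = of_nat n * l / 2"
    have "x \<in> range (br e ^^ n)" for n
    proof (induction n)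
      case (Suc n)
      then obtain z where z: "x = (br e ^^ n) z" by auto
      let ?a = "of_nat (Suc n) * (m - of_nat n * l / 2)"
      have "m \<noteq> of_nat n * l / 2" using neg by blast
      then have a: "?a \<noteq> 0" by (simp del: of_nat_Suc)
      have "(br e ^^ Suc n) (br f z) = cs (of_nat (Suc n)) (D x - cs (of_nat n * l / 2) x)"
        using A_power_B[OF e(1) f, of n z] x(2) by (simp flip: z)
      also have "\<dots> = cs ?a x"
        by (simp add: x(3) cs_cs c.scale_right_diff_distrib c.scale_left_diff_distrib right_diff_distrib)
      finally have "x = (br e ^^ Suc n) (cs (1 / ?a) (br f z))"
        using a by (simp add: clinear_funpow_scale[OF clinear_br] cs_cs del: of_nat_Suc funpow.simps)
      then show ?case by blast
    qed simp
    then show False using N x(1) by (metis imageE)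
  qed
  then show ?thesis using that by blast
qed

lemma weight_half_integral:
  assumes e: "D e = cs l e" "l \<noteq> 0" "e \<noteq> 0"
    and x: "x \<noteq> 0" "D x = cs m x"
  obtains n :: int where "m = of_int n * l / 2"
proof -
  obtain k where k: "(br e ^^ k) x \<noteq> 0" "br e ((br e ^^ k) x) = 0"
    using highest_vector[OF e(1,2) x(1)] .
  have "D ((br e ^^ k) x) = cs (m + of_nat k * l) ((br e ^^ k) x)"
    by (simp add: D_funpow[OF e(1)] x(2) clinear_funpow_scale[OF clinear_br] cs_add_left)
  then obtain n where "m + of_nat k * l = of_nat n * l / 2"
    using kernel_weight[OF e k] by metis
  then have "m = of_int (int n - 2 * int k) * l / 2"
    by (simp add: field_simps)
  then show ?thesis by (rule that)
qed

text \<open>Morozov's argument.  The vector \<open>(D + l) f\<close> lies in the kernel of \<open>ad e\<close>, where the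
  eigenvalues of \<open>D\<close> are nonnegative multiples of \<open>l / 2\<close>; so \<open>D + l\<close> is bijective on the kernel,
  and \<open>f\<close> can be corrected by a kernel vector.\<close>

lemma lowering_eigenvector:
  assumes e: "D e = cs l e" "l \<noteq> 0" "e \<noteq> 0"
  obtains f where "br e f = \<xi>" "D f = cs (- l) f"
proof -
  obtain f where f: "br e f = \<xi>" using \<xi>_in_range[OF e] .
  let ?K = "{x. br e x = 0}"
  define T where "T x = D x + cs l x" for x
  have "clinear T"
    by (rule clinearI) (simp_all add: T_def br_add_right br_cs_right cs_add cs_cs mult.commute)
  moreover have "T ` ?K \<subseteq> ?K"
    using ker_D_invariant[OF e(1)] by (auto simp: T_def br_add_right br_cs_right)
  moreover have "x = 0" if "x \<in> ?K" "T x = 0" for x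
  proof (rule ccontr)
    assume "x \<noteq> 0"
    have Dx: "D x = cs (- l) x"
      using that(2) by (simp add: T_def add_eq_0_iff)
    have "br e x = 0" using that(1) by simp
    then obtain n :: nat where n: "- l = of_nat n * l / 2"
      using kernel_weight[OF e \<open>x \<noteq> 0\<close> _ Dx] by metis
    have "of_nat n * l = - (2 * l)" using n by (simp add: field_simps)
    then have "of_nat (Suc (Suc n)) * l = 0" by (simp add: ring_distribs)
    then show False using e(2) by (simp del: of_nat_Suc)
  qed
  ultimately have "T ` ?K = ?K"
    by (intro clinear_inj_imp_surj_on csubspace_ker)
  moreover have "T f \<in> ?K"
    using br_jacobi[of \<xi> e f] e(1) f by (simp add: T_def br_add_right br_cs_left br_cs_right add_eq_0_iff)
  ultimately obtain z where z: "br e z = 0" "T f = T z" by auto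
  have "T (f - z) = 0"
    using z(2) module_hom.diff[OF \<open>clinear T\<close>] by simp
  then have "D (f - z) = cs (- l) (f - z)"
    by (simp add: T_def add_eq_0_iff)
  moreover have "br e (f - z) = \<xi>" using f z by (simp add: br_diff_right)
  ultimately show ?thesis using that by blast
qed


text \<open>All eigenvalues are of the form \<open>j l0 / 2\<close> with an integer \<open>j\<close>; one with the smallest
  nonzero \<open>|j|\<close> has the required property.\<close>

lemma minimal_weight:
  assumes e: "D e0 = cs l0 e0" "l0 \<noteq> 0" "e0 \<noteq> 0"
  obtains e l where "D e = cs l e" "l \<noteq> 0" "e \<noteq> 0" "\<And>x. D x = cs (l / 2) x \<Longrightarrow> x = 0"
proof -
  define P where "P n \<longleftrightarrow> n \<noteq> 0 \<and> (\<exists>j::int. nat \<bar>j\<bar> = n \<and> (\<exists>e. e \<noteq> 0 \<and> D e = cs (of_int j * l0 / 2) e))" for n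
  have "P 2"
    unfolding P_def using e by (intro conjI exI[of _ 2] exI[of _ e0]) auto
  then have least: "P (LEAST n. P n)" by (rule LeastI)
  then obtain j :: int and e where j: "nat \<bar>j\<bar> = (LEAST n. P n)" "e \<noteq> 0" "D e = cs (of_int j * l0 / 2) e"
    unfolding P_def by blast
  have j0: "j \<noteq> 0" using least j(1) unfolding P_def by auto
  show ?thesis
  proof (rule that[OF j(3) _ j(2)])
    show "of_int j * l0 / 2 \<noteq> 0" using j0 e(2) by simp
    fix x assume x: "D x = cs (of_int j * l0 / 2 / 2) x"
    show "x = 0"
    proof (rule ccontr)
      assume "x \<noteq> 0"
      obtain i :: int where i: "of_int j * l0 / 2 / 2 = of_int i * l0 / 2"
        using weight_half_integral[OF e \<open>x \<noteq> 0\<close> x] .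
      then have "(of_int j :: complex) = of_int (2 * i)"
        using e(2) by (simp add: field_simps)
      then have ji: "j = 2 * i" by (simp only: of_int_eq_iff)
      have "P (nat \<bar>i\<bar>)"
        unfolding P_def using x i ji j0 \<open>x \<noteq> 0\<close>
        by (intro conjI exI[of _ i] exI[of _ x]) auto
      then have "nat \<bar>j\<bar> \<le> nat \<bar>i\<bar>" unfolding j(1) by (rule Least_le)
      then show False using ji j0 by auto
    qed
  qed
qed

lemma lowering_string:
  assumes f: "br e f = \<xi>" "D f = cs (- l) f" and x: "br e x = 0" "D x = cs m x"
  shows "D ((br f ^^ k) x) = cs (m - of_nat k * l) ((br f ^^ k) x)"
    and "br e ((br f ^^ Suc k) x) = cs (of_nat (Suc k) * (m - of_nat k * l / 2)) ((br f ^^ k) x)"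
proof -
  have D: "D ((br f ^^ k) x) = cs (m - of_nat k * l) ((br f ^^ k) x)" for k
    using D_funpow[OF f(2), of k x]
    by (simp add: x(2) clinear_funpow_scale[OF clinear_br] c.scale_left_diff_distrib)
  then show "D ((br f ^^ k) x) = cs (m - of_nat k * l) ((br f ^^ k) x)" .
  show "br e ((br f ^^ Suc k) x) = cs (of_nat (Suc k) * (m - of_nat k * l / 2)) ((br f ^^ k) x)"
  proof (induction k)
    case 0
    then show ?case using x by (simp add: A_B_commutator[OF f(1)])
  next
    case (Suc k)
    let ?y = "(br f ^^ Suc k) x"
    have "br e ((br f ^^ Suc (Suc k)) x) = D ?y + br f (br e ?y)"
      using A_B_commutator[OF f(1), of ?y] by simp
    also have "\<dots> = cs (m - of_nat (Suc k) * l) ?y + cs (of_nat (Suc k) * (m - of_nat k * l / 2)) ?y"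
      unfolding D Suc.IH by (simp add: br_cs_right)
    also have "\<dots> = cs ((m - of_nat (Suc k) * l) + of_nat (Suc k) * (m - of_nat k * l / 2)) ?y"
      by (simp only: cs_add_left)
    also have "(m - of_nat (Suc k) * l) + of_nat (Suc k) * (m - of_nat k * l / 2)
        = of_nat (Suc (Suc k)) * (m - of_nat (Suc k) * l / 2)"
      by (simp add: field_simps)
    finally show ?case .
  qed
qed

text \<open>Let \<open>m = n l / 2\<close> and descend from \<open>x\<close> by \<open>B = ad f\<close>; the vectors \<open>B\<^sup>k x\<close> with \<open>k \<le> n\<close> are
  not 0.  If \<open>n\<close> is odd, one of them has eigenvalue \<open>l / 2\<close>.  If \<open>n = 2 k\<close>, then \<open>B\<^sup>k x\<close> is a
  multiple of \<open>\<xi>\<close>; here \<open>k \<ge> 1\<close>, as \<open>\<xi>\<close> is not killed by \<open>A\<close>, and applying \<open>A\<close> shows that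
  \<open>B\<^sup>k\<^sup>-\<^sup>1 x\<close> is a multiple of \<open>e\<close>.  As \<open>A e = 0\<close>, the string has already reached its top there,
  that is \<open>k = 1\<close>.\<close>

lemma kernel_weight_vector:
  assumes e: "D e = cs l e" "l \<noteq> 0" "e \<noteq> 0" and half: "\<And>x. D x = cs (l / 2) x \<Longrightarrow> x = 0"
    and f: "br e f = \<xi>" "D f = cs (- l) f" and x: "br e x = 0" "D x = cs m x"
  shows "\<exists>a. x = cs a e"
proof (cases "x = 0")
  case True
  then show ?thesis by (intro exI[of _ 0]) simp
next
  case False
  obtain n :: nat where n: "m = of_nat n * l / 2"
    using kernel_weight[OF e False x] .
  let ?y = "\<lambda>k. (br f ^^ k) x"
  have step: "br e (?y (Suc k)) = cs (of_nat (Suc k) * (of_nat n - of_nat k) * l / 2) (?y k)" for k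
    unfolding lowering_string(2)[OF f x] n by (simp add: field_simps)
  have nz: "k \<le> n \<Longrightarrow> ?y k \<noteq> 0" for k
  proof (induction k)
    case (Suc k)
    have "of_nat n - of_nat k \<noteq> (0::complex)"
      using Suc.prems by (simp del: of_nat_diff)
    then have "br e (?y (Suc k)) \<noteq> 0"
      unfolding step using Suc e(2) by (simp del: of_nat_Suc funpow.simps)
    then show ?case by (metis br_zero_right)
  qed (use False in simp)
  have \<xi>e: "br e (cs a \<xi>) = cs (- a * l) e" for a
    using br_anti[of e \<xi>] e(1) by (simp add: br_cs_right cs_cs)
  show ?thesis
  proof (cases "even n")
    case False
    then obtain k where k: "n = 2 * k + 1" by (elim oddE)
    have "D (?y k) = cs (l / 2) (?y k)"
      unfolding lowering_string(1)[OF f x] n k by (simp add: field_simps)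
    then have False using half nz[of k] k by simp
    then show ?thesis ..
  next
    case True
    then obtain k where k: "n = 2 * k" by (elim evenE)
    have "D (?y k) = 0"
      unfolding lowering_string(1)[OF f x] n k by (simp add: field_simps)
    then obtain a where a: "?y k = cs a \<xi>" using centralizer_\<xi> by blast
    then have a0: "a \<noteq> 0" using nz[of k] k by auto
    show ?thesis
    proof (cases k)
      case 0
      then have "br e (cs a \<xi>) = 0" using a x by simp
      then have False using \<xi>e[of a] a0 e by simp
      then show ?thesis ..
    next
      case (Suc j)
      let ?b = "of_nat (Suc j) * (of_nat n - of_nat j) * l / 2"
      have b0: "?b \<noteq> 0"
        using e(2) k Suc by (simp del: of_nat_Suc of_nat_diff)
      have "cs ?b (?y j) = cs (- a * l) e"
        using step[of j] a \<xi>e[of a] Suc by simp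
      then have yj: "?y j = cs (- a * l / ?b) e"
        using b0 by (metis c.scale_left_imp_eq cs_cs mult.commute nonzero_mult_div_cancel_left times_divide_eq_right)
      show ?thesis
      proof (cases j)
        case 0
        then show ?thesis using yj by (metis funpow_0)
      next
        case (Suc i)
        have "br e (?y j) = 0"
          unfolding yj by (simp only: br_cs_right br_self c.scale_zero_right)
        moreover have "of_nat n - of_nat i \<noteq> (0::complex)"
        proof -
          have "n \<noteq> i" using k \<open>k = Suc j\<close> Suc by simp
          then show ?thesis by (simp only: right_minus_eq of_nat_eq_iff not_False_eq_True)
        qed
        moreover have "?y i \<noteq> 0"
          using nz k \<open>k = Suc j\<close> Suc by simp
        ultimately have False
          using step[of i] e(2) Suc by (simp del: of_nat_Suc funpow.simps)
        then show ?thesis ..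
      qed
    qed
  qed
qed

text \<open>It remains to exclude generalized eigenvectors.  If \<open>z\<close> is in the kernel and
  \<open>D z = l z + a e\<close>, then \<open>D [f, z] = - a \<xi>\<close>, and \<open>\<xi>\<close> is not in the image of \<open>D\<close>, so \<open>a = 0\<close>.\<close>

lemma ker_one_dimensional:
  assumes e: "D e = cs l e" "l \<noteq> 0" "e \<noteq> 0" and half: "\<And>x. D x = cs (l / 2) x \<Longrightarrow> x = 0"
    and f: "br e f = \<xi>" "D f = cs (- l) f" and x: "br e x = 0"
  shows "\<exists>a. x = cs a e"
proof -
  let ?K = "{x. br e x = 0}"
  define T where "T x = D x - cs l x" for x
  have T: "clinear T"
    by (rule clinearI) (simp_all add: T_def br_add_right br_cs_right cs_add cs_cs
        c.scale_right_diff_distrib mult.commute)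
  have TK: "T ` ?K \<subseteq> ?K"
    using ker_D_invariant[OF e(1)] by (auto simp: T_def br_diff_right br_cs_right)
  have sub: "c.subspace (T ` ?K)"
    by (rule module_hom.subspace_image[OF T csubspace_ker])
  have "T x = 0"
  proof (rule ccontr)
    assume "T x \<noteq> 0"
    have "D ` T ` ?K \<subseteq> T ` ?K"
    proof clarify
      fix y assume "br e y = 0"
      then have "D (T y) = T (D y)" "D y \<in> ?K"
        using ker_D_invariant[OF e(1)] by (simp_all add: T_def br_diff_right br_cs_right)
      then show "D (T y) \<in> T ` ?K" by blast
    qed
    moreover have "T x \<in> T ` ?K" using x by blast
    ultimately obtain y m where y: "y \<in> T ` ?K" "y \<noteq> 0" "D y = cs m y"
      using eigenvector_exists[OF clinear_br sub] \<open>T x \<noteq> 0\<close> by metis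
    obtain z where z: "br e z = 0" "y = T z" using y(1) by auto
    have "br e y = 0" using y(1) TK by blast
    then obtain a where a: "y = cs a e"
      using kernel_weight_vector[OF e half f _ y(3)] by blast
    have Dz: "D z = cs l z + cs a e"
      using z a by (simp add: T_def algebra_simps)
    have "D (br f z) = br (D f) z + br f (D z)"
      by (rule br_jacobi)
    also have "\<dots> = cs a (br f e)"
      unfolding f(2) Dz br_cs_left br_add_right br_cs_right by simp
    also have "\<dots> = cs (- a) \<xi>"
      using br_anti[of f e] f(1) by simp
    finally have "cs (- a) \<xi> = 0"
      using \<xi>_multiple_in_range_D[of "- a" "br f z"] by simp
    then have "a = 0" using \<xi>_aniso by auto
    then show False using a y(2) by simp
  qed
  then have "D x = cs l x" by (simp add: T_def)
  then show ?thesis using kernel_weight_vector[OF e half f x] by blast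
qed

text \<open>The nilpotent map \<open>A = ad e\<close> acts by \<open>f \<mapsto> \<xi> \<mapsto> - l e \<mapsto> 0\<close> and has kernel spanned by \<open>e\<close>.  If
  \<open>A\<^sup>3 \<noteq> 0\<close>, then \<open>f\<close> would be in the image of \<open>A\<close>, hence orthogonal to \<open>e\<close>; but
  \<open>\<beta>(l e, f) = \<beta>(\<xi>, \<xi>) \<noteq> 0\<close>.\<close>

theorem spanned_by_three:
  obtains e f where "\<And>x. \<exists>a b c. x = cs a \<xi> + cs b e + cs c f"
proof (cases "\<exists>x. D x \<noteq> 0")
  case False
  then have "\<exists>a b c. x = cs a \<xi> + cs b 0 + cs c 0" for x
    using centralizer_\<xi>[of x] by auto
  then show ?thesis using that by blast
next
  case True
  then obtain x0 where x0: "D x0 \<noteq> 0" by blast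
  obtain e0 l0 where e0: "e0 \<in> range D" "e0 \<noteq> 0" "D e0 = cs l0 e0"
  proof -
    have "D ` range D \<subseteq> range D" by blast
    then show ?thesis
      using eigenvector_exists[OF clinear_br[of \<xi>] csubspace_range_D _ _ x0] that by blast
  qed
  have "l0 \<noteq> 0"
  proof
    assume "l0 = 0"
    then have "D e0 = 0" by (simp add: e0(3))
    then show False using D_inj_on_range e0(1,2) by blast
  qed
  then obtain e l where e: "D e = cs l e" "l \<noteq> 0" "e \<noteq> 0"
    and half: "\<And>x. D x = cs (l / 2) x \<Longrightarrow> x = 0"
    using minimal_weight[OF e0(3) _ e0(2)] by metis
  obtain f where f: "br e f = \<xi>" "D f = cs (- l) f"
    using lowering_eigenvector[OF e] .
  note ker = ker_one_dimensional[OF e half f]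
  have A\<xi>: "br e \<xi> = cs (- l) e" using br_anti[of e \<xi>] e(1) by simp
  define E where "E = cs (- 1 / l) \<xi>"
  have AE: "br e E = e" using A\<xi> e(2) by (simp add: E_def br_cs_right cs_cs)
  have ker2: "\<exists>a b. y = cs a \<xi> + cs b e" if y: "br e (br e y) = 0" for y
  proof -
    obtain a where "br e y = cs a e" using ker y by blast
    then have "br e (y - cs a E) = 0" by (simp add: br_diff_right br_cs_right AE)
    then obtain b where "y - cs a E = cs b e" using ker by blast
    then have "y = cs (a * (- 1 / l)) \<xi> + cs b e" by (simp add: E_def cs_cs algebra_simps)
    then show ?thesis by blast
  qed
  have f_range: "br e y \<noteq> f" for y
  proof
    assume y: "br e y = f"
    have "\<beta> (cs a e) f = 0" for a
      using \<beta>_inv[of "cs a e" e y] y by (simp add: br_cs_left)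
    moreover have "\<beta> (cs l e) f = \<beta> \<xi> \<xi>"
    proof -
      have "\<beta> \<xi> \<xi> = \<beta> (br e f) \<xi>" using f by simp
      also have "\<dots> = \<beta> e (br f \<xi>)" by (rule \<beta>_inv)
      also have "br f \<xi> = cs l f" using br_anti[of f \<xi>] f by simp
      finally show ?thesis by (simp only: \<beta>_cs)
    qed
    ultimately show False using \<xi>_aniso by simp
  qed
  have cube: "br e (br e (br e y)) = 0" for y
  proof (rule ccontr)
    assume nz: "br e (br e (br e y)) \<noteq> 0"
    obtain k where k: "(br e ^^ k) (br e (br e (br e y))) \<noteq> 0"
        "br e ((br e ^^ k) (br e (br e (br e y)))) = 0"
      using highest_vector[OF e(1,2) nz] .
    define z where "z = (br e ^^ k) y"
    have z: "(br e ^^ k) (br e (br e (br e y))) = br e (br e (br e z))"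
      by (simp add: z_def funpow_swap1)
    obtain a where a: "br e (br e (br e z)) = cs a e"
      using ker k(2) z by metis
    then have a0: "a \<noteq> 0" using k(1) z by auto
    \<comment> \<open>This multiple of \<open>f\<close> has \<open>A\<^sup>2 g = e\<close>, so a suitable multiple can be subtracted from \<open>A z\<close>.\<close>
    define g where "g = cs (- 1 / l) f"
    have "br e (br e g) = e" using AE f by (simp add: g_def E_def br_cs_right)
    then have "br e (br e (br e z - cs a g)) = 0"
      using a by (simp add: br_diff_right br_cs_right)
    then obtain b c where "br e z - cs a g = cs b \<xi> + cs c e"
      using ker2 by blast
    then have "br e z - cs b (br e f) - cs c (br e E) = cs a g"
      by (simp add: f AE algebra_simps)
    then have "br e (z - cs b f - cs c E) = cs (- a / l) f"
      by (simp add: br_diff_right br_cs_right g_def cs_cs)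
    then have "br e (cs (- l / a) (z - cs b f - cs c E)) = f"
      using a0 e(2) by (simp add: br_cs_right cs_cs)
    then show False using f_range by blast
  qed
  have "\<exists>a b c. y = cs a \<xi> + cs b e + cs c f" for y
  proof -
    obtain a where a: "br e (br e y) = cs a e" using ker cube by blast
    have "br e (br e (y - cs (a * (- 1 / l)) f)) = 0"
      using a e(2) by (simp add: br_diff_right br_add_right br_cs_right f A\<xi> cs_cs)
    then obtain b c where "y - cs (a * (- 1 / l)) f = cs b \<xi> + cs c e"
      using ker2 by blast
    then have "y = cs b \<xi> + cs c e + cs (a * (- 1 / l)) f" by (simp add: algebra_simps)
    then show ?thesis by blast
  qed
  then show ?thesis using that by blast
qed

theorem DIM_le_6: "DIM('v) \<le> 6"
proof -
  obtain e f where sp: "\<And>x. \<exists>a b c. x = cs a \<xi> + cs b e + cs c f"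
    using spanned_by_three by blast
  let ?S = "{\<xi>, cs \<i> \<xi>, e, cs \<i> e, f, cs \<i> f}"
  have cs_split: "cs a x = Re a *\<^sub>R x + Im a *\<^sub>R cs \<i> x" for a x
  proof -
    have "cs a x = cs (of_real (Re a) + of_real (Im a) * \<i>) x"
      by (simp add: complex_eq mult.commute)
    then show ?thesis by (simp only: cs_add_left cs_of_real flip: cs_cs)
  qed
  have "x \<in> span ?S" for x
  proof -
    obtain a b c where "x = cs a \<xi> + cs b e + cs c f" using sp by blast
    then show ?thesis
      unfolding cs_split[of a] cs_split[of b] cs_split[of c]
      by (auto intro!: span_add span_scale intro: span_base)
  qed
  then have "dim (UNIV :: 'v set) \<le> card ?S"
    by (intro dim_le_card) auto
  also have "card ?S \<le> 6"
    by (simp add: card_insert_if)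
  finally show ?thesis by simp
qed

end

section \<open>Real Lie algebras with an invariant form and a one-dimensional centralizer\<close>

text \<open>Multiplication by complex numbers on \<open>'e \<times> 'e\<close>, where \<open>(x, y)\<close> stands for \<open>x + i y\<close>.\<close>

definition cscale :: "complex \<Rightarrow> 'e \<times> 'e \<Rightarrow> ('e::euclidean_space) \<times> 'e" where
  "cscale z x = (Re z *\<^sub>R fst x - Im z *\<^sub>R snd x, Re z *\<^sub>R snd x + Im z *\<^sub>R fst x)"

lemma complex_scaling_cscale: "complex_scaling (cscale :: complex \<Rightarrow> 'e \<times> 'e \<Rightarrow> ('e::euclidean_space) \<times> 'e)"
proof
  fix a b :: complex and x y :: "'e \<times> 'e" and r :: real
  show "cscale a (x + y) = cscale a x + cscale a y" "cscale (a + b) x = cscale a x + cscale b x"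
    "cscale a (cscale b x) = cscale (a * b) x" "cscale (of_real r) x = r *\<^sub>R x"
    by (simp_all add: cscale_def prod_eq_iff algebra_simps)
  have "(norm (cscale a x))\<^sup>2 = (cmod a * norm x)\<^sup>2"
    unfolding power_mult_distrib cmod_power2 power2_norm_eq_inner
    by (simp add: cscale_def inner_prod_def inner_add_left inner_add_right
        inner_diff_left inner_diff_right inner_commute[of "snd x" "fst x"] power2_eq_square algebra_simps)
  then show "norm (cscale a x) = cmod a * norm x"
    by (simp add: power2_eq_iff_nonneg)
qed

locale quadratic_lie_algebra =
  fixes B :: "'e \<Rightarrow> 'e \<Rightarrow> 'e::euclidean_space" and g :: "'e \<Rightarrow> 'e \<Rightarrow> real" and \<xi> :: 'e
  assumes B_bilinear: "bilinear B"
    and B_anti: "B x y = - B y x"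
    and B_jacobi: "B x (B y z) = B (B x y) z + B y (B x z)"
    and g_bilinear: "bilinear g"
    and g_sym: "g x y = g y x"
    and g_nondeg: "(\<And>y. g x y = 0) \<Longrightarrow> x = 0"
    and g_inv: "g (B x y) z = g x (B y z)"
    and \<xi>_aniso: "g \<xi> \<xi> \<noteq> 0"
    and centralizer_\<xi>: "B \<xi> x = 0 \<Longrightarrow> \<exists>a. x = a *\<^sub>R \<xi>"
begin

lemmas B_simps = bilinear_ladd[OF B_bilinear] bilinear_radd[OF B_bilinear]
  bilinear_lmul[OF B_bilinear] bilinear_rmul[OF B_bilinear]
  bilinear_lsub[OF B_bilinear] bilinear_rsub[OF B_bilinear]
  bilinear_lzero[OF B_bilinear] bilinear_rzero[OF B_bilinear]
  bilinear_lneg[OF B_bilinear] bilinear_rneg[OF B_bilinear]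

lemmas g_simps = bilinear_ladd[OF g_bilinear] bilinear_radd[OF g_bilinear]
  bilinear_lmul[OF g_bilinear] bilinear_rmul[OF g_bilinear]
  bilinear_lsub[OF g_bilinear] bilinear_rsub[OF g_bilinear]
  bilinear_lzero[OF g_bilinear] bilinear_rzero[OF g_bilinear]
  bilinear_lneg[OF g_bilinear] bilinear_rneg[OF g_bilinear]

lemma B_self [simp]: "B x x = 0"
  using B_anti[of x x] by (simp add: eq_neg_iff_add_eq_0 flip: scaleR_2)

text \<open>The complexification satisfies the assumptions of the complex theory with the real part of
  the complexified form, and it has twice the real dimension.\<close>

lemma DIM_le_3: "DIM('e) \<le> 3"
proof -
  define br where "br x y = (B (fst x) (fst y) - B (snd x) (snd y), B (fst x) (snd y) + B (snd x) (fst y))"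
    for x y :: "'e \<times> 'e"
  define \<beta> where "\<beta> x y = g (fst x) (fst y) - g (snd x) (snd y)" for x y :: "'e \<times> 'e"
  interpret complex_scaling "cscale :: complex \<Rightarrow> 'e \<times> 'e \<Rightarrow> 'e \<times> 'e"
    by (rule complex_scaling_cscale)
  have "complex_lie_rank_one (cscale :: complex \<Rightarrow> 'e \<times> 'e \<Rightarrow> 'e \<times> 'e) br \<beta> (\<xi>, 0)"
  proof
    fix x y z :: "'e \<times> 'e" and a :: complex and r :: real
    show "br (x + y) z = br x z + br y z"
      by (simp add: br_def B_simps algebra_simps)
    show "br (cscale a x) y = cscale a (br x y)"
      by (simp add: br_def cscale_def B_simps algebra_simps)
    show "br x y = - br y x"
      using B_anti[of "fst x" "fst y"] B_anti[of "snd x" "snd y"]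
        B_anti[of "fst x" "snd y"] B_anti[of "snd x" "fst y"]
      by (simp add: br_def)
    show "br x (br y z) = br (br x y) z + br y (br x z)"
      unfolding br_def
      using B_jacobi[of "fst x" "fst y" "fst z"] B_jacobi[of "fst x" "fst y" "snd z"]
        B_jacobi[of "fst x" "snd y" "fst z"] B_jacobi[of "fst x" "snd y" "snd z"]
        B_jacobi[of "snd x" "fst y" "fst z"] B_jacobi[of "snd x" "fst y" "snd z"]
        B_jacobi[of "snd x" "snd y" "fst z"] B_jacobi[of "snd x" "snd y" "snd z"]
      by (simp add: B_simps)
    show "\<beta> (x + y) z = \<beta> x z + \<beta> y z" "\<beta> (r *\<^sub>R x) y = r * \<beta> x y"
      "\<beta> (cscale a x) y = \<beta> x (cscale a y)"
      by (simp_all add: \<beta>_def cscale_def g_simps algebra_simps)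
    show "\<beta> x y = \<beta> y x"
      by (simp add: \<beta>_def g_sym[of "fst x"] g_sym[of "snd x"])
    show "\<beta> (br x y) z = \<beta> x (br y z)"
      by (simp add: \<beta>_def br_def g_simps g_inv)
    show "\<beta> (\<xi>, 0) (\<xi>, 0) \<noteq> 0"
      using \<xi>_aniso by (simp add: \<beta>_def g_simps)
  next
    fix x :: "'e \<times> 'e"
    assume *: "\<And>y. \<beta> x y = 0"
    have "fst x = 0" by (rule g_nondeg) (use *[of "(_, 0)"] in \<open>simp add: \<beta>_def g_simps\<close>)
    moreover have "snd x = 0" by (rule g_nondeg) (use *[of "(0, _)"] in \<open>simp add: \<beta>_def g_simps\<close>)
    ultimately show "x = 0" by (simp add: prod_eq_iff)
  next
    fix x :: "'e \<times> 'e"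
    assume "br (\<xi>, 0) x = 0"
    then have "B \<xi> (fst x) = 0" "B \<xi> (snd x) = 0"
      by (simp_all add: br_def B_simps prod_eq_iff)
    then obtain a b where "fst x = a *\<^sub>R \<xi>" "snd x = b *\<^sub>R \<xi>"
      using centralizer_\<xi> by metis
    then have "x = cscale (Complex a b) (\<xi>, 0)"
      by (simp add: cscale_def prod_eq_iff)
    then show "\<exists>a. x = cscale a (\<xi>, 0)" ..
  qed
  then have "DIM('e \<times> 'e) \<le> 6"
    by (rule complex_lie_rank_one.DIM_le_6)
  then show ?thesis by simp
qed

text \<open>Choose \<open>u\<close> orthogonal to \<open>\<xi>\<close> with \<open>g u u \<noteq> 0\<close> and let \<open>w = [\<xi>, u]\<close>.  By invariance \<open>\<xi>, u, w\<close>
  are pairwise orthogonal and nonisotropic, and the same computations determine the remaining two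
  brackets.\<close>

theorem adapted_basis:
  assumes dim: "DIM('e) \<ge> 3"
  obtains u w d k where "d \<noteq> 0" "k \<noteq> 0" "B \<xi> u = w" "B \<xi> w = d *\<^sub>R u" "B u w = k *\<^sub>R \<xi>"
    "\<And>x. \<exists>a b c. x = a *\<^sub>R \<xi> + b *\<^sub>R u + c *\<^sub>R w"
    "independent {\<xi>, u, w}" "\<xi> \<noteq> u" "\<xi> \<noteq> w" "u \<noteq> w" "DIM('e) = 3"
proof -
  have proj: "g \<xi> (x - (g \<xi> x / g \<xi> \<xi>) *\<^sub>R \<xi>) = 0" for x
    using \<xi>_aniso by (simp add: g_simps)
  have "\<exists>u. g \<xi> u = 0 \<and> g u u \<noteq> 0"
  proof (rule ccontr)
    assume neg: "\<nexists>u. g \<xi> u = 0 \<and> g u u \<noteq> 0"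
    have orth: "g u v = 0" if "g \<xi> u = 0" "g \<xi> v = 0" for u v
    proof -
      have "g \<xi> (u + v) = 0" using that by (simp add: g_simps)
      then have "g (u + v) (u + v) = 0" "g u u = 0" "g v v = 0"
        using neg that by blast+
      then show ?thesis by (simp add: g_simps g_sym[of v u])
    qed
    have zero: "u = 0" if u: "g \<xi> u = 0" for u
    proof (rule g_nondeg)
      fix y
      have "g u (y - (g \<xi> y / g \<xi> \<xi>) *\<^sub>R \<xi>) = 0"
        by (rule orth[OF u proj])
      then show "g u y = 0" using u g_sym[of u \<xi>] by (simp add: g_simps)
    qed
    have "x \<in> span {\<xi>}" for x
      using zero[OF proj[of x]] by (auto simp: span_breakdown_eq)
    then have "dim (UNIV :: 'e set) \<le> card {\<xi>}"
      by (intro dim_le_card) auto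
    then show False using dim by simp
  qed
  then obtain u where u: "g \<xi> u = 0" "g u u \<noteq> 0" by blast
  define w where "w = B \<xi> u"
  have \<xi>w: "g \<xi> w = 0" using g_inv[of \<xi> \<xi> u] by (simp add: w_def g_simps)
  have "g u w = - g u w"
    using g_inv[of u \<xi> u] B_anti[of u \<xi>] g_sym[of w u] by (simp add: w_def[symmetric] g_simps)
  then have uw: "g u w = 0" by simp
  have w0: "w \<noteq> 0"
  proof
    assume "w = 0"
    then obtain a where a: "u = a *\<^sub>R \<xi>" using centralizer_\<xi>[of u] by (auto simp: w_def)
    then have "a = 0" using u(1) \<xi>_aniso by (simp add: g_simps)
    then show False using u(2) a by (simp add: g_simps)
  qed
  have indep: "a = 0 \<and> b = 0 \<and> c = 0" if *: "a *\<^sub>R \<xi> + b *\<^sub>R u + c *\<^sub>R w = 0" for a b c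
  proof -
    have "g \<xi> (a *\<^sub>R \<xi> + b *\<^sub>R u + c *\<^sub>R w) = 0" "g u (a *\<^sub>R \<xi> + b *\<^sub>R u + c *\<^sub>R w) = 0"
      unfolding * by (simp_all add: g_simps)
    then have "a = 0" "b = 0"
      using u \<xi>w uw g_sym[of u \<xi>] \<xi>_aniso by (simp_all add: g_simps)
    then show ?thesis using * w0 by simp
  qed
  have ne: "\<xi> \<noteq> u" "\<xi> \<noteq> w" "u \<noteq> w"
    using indep[of 1 "-1" 0] indep[of 1 0 "-1"] indep[of 0 1 "-1"] by auto
  have ind: "independent {\<xi>, u, w}"
  proof
    assume "dependent {\<xi>, u, w}"
    then obtain p v where p: "v \<in> {\<xi>, u, w}" "p v \<noteq> 0" "(\<Sum>v\<in>{\<xi>, u, w}. p v *\<^sub>R v) = 0"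
      by (auto simp: dependent_finite)
    then show False
      using indep[of "p \<xi>" "p u" "p w"] ne by (auto simp: add.assoc)
  qed
  have DIM3: "DIM('e) = 3" using dim DIM_le_3 by simp
  then have "dim (UNIV :: 'e set) = card {\<xi>, u, w}" using ne by simp
  then have "span {\<xi>, u, w} = UNIV"
    using card_ge_dim_independent[OF _ ind, of UNIV] by auto
  then have span: "\<exists>a b c. x = a *\<^sub>R \<xi> + b *\<^sub>R u + c *\<^sub>R w" for x
  proof -
    have "x \<in> span {\<xi>, u, w}" using \<open>span {\<xi>, u, w} = UNIV\<close> by simp
    then obtain a b c where "x - a *\<^sub>R \<xi> - b *\<^sub>R u - c *\<^sub>R w = 0"
      by (auto simp: span_breakdown_eq)
    then have "x = a *\<^sub>R \<xi> + b *\<^sub>R u + c *\<^sub>R w" by (simp add: algebra_simps)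
    then show ?thesis by blast
  qed
  have ww: "g w w \<noteq> 0"
  proof
    assume 0: "g w w = 0"
    have "w = 0"
    proof (rule g_nondeg)
      fix y obtain a b c where "y = a *\<^sub>R \<xi> + b *\<^sub>R u + c *\<^sub>R w" using span by blast
      then show "g w y = 0" using 0 \<xi>w uw g_sym[of w \<xi>] g_sym[of w u] by (simp add: g_simps)
    qed
    then show False using w0 by simp
  qed
  obtain a d c where Bw: "B \<xi> w = a *\<^sub>R \<xi> + d *\<^sub>R u + c *\<^sub>R w" using span by blast
  have "g \<xi> (B \<xi> w) = 0" using g_inv[of \<xi> \<xi> w] by (simp add: g_simps)
  then have "a = 0" using \<xi>_aniso u \<xi>w by (simp add: Bw g_simps)
  have "g w (B \<xi> w) = 0"
    using g_inv[of w \<xi> w] B_anti[of w \<xi>] g_sym[of "B \<xi> w" w] by (simp add: g_simps)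
  then have "c = 0" using ww \<open>a = 0\<close> uw g_sym[of w u] by (simp add: Bw g_simps)
  have Bw: "B \<xi> w = d *\<^sub>R u" using Bw \<open>a = 0\<close> \<open>c = 0\<close> by simp
  have d0: "d \<noteq> 0"
  proof
    assume "d = 0"
    then obtain b where b: "w = b *\<^sub>R \<xi>" using centralizer_\<xi>[of w] Bw by auto
    then have "b = 0" using \<xi>w \<xi>_aniso by (simp add: g_simps)
    then show False using w0 b by simp
  qed
  obtain k b c where Buw: "B u w = k *\<^sub>R \<xi> + b *\<^sub>R u + c *\<^sub>R w" using span by blast
  have "g u (B u w) = 0" using g_inv[of u u w] by (simp add: g_simps)
  then have "b = 0" using u uw g_sym[of u \<xi>] by (simp add: Buw g_simps)
  have "g (B u w) w = 0" using g_inv[of u w w] by (simp add: g_simps)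
  then have "c = 0" using ww \<xi>w uw \<open>b = 0\<close> by (simp add: Buw g_simps)
  have Buw: "B u w = k *\<^sub>R \<xi>" using Buw \<open>b = 0\<close> \<open>c = 0\<close> by simp
  have "g (B u w) \<xi> = - d * g u u"
    using g_inv[of u w \<xi>] B_anti[of w \<xi>] Bw by (simp add: g_simps)
  then have "k \<noteq> 0" using d0 u(2) Buw by (auto simp: g_simps)
  then show ?thesis
    using that[OF d0 _ w_def[symmetric] Bw Buw span ind ne DIM3] by blast
qed

end

section \<open>Exterior products and contact forms\<close>

definition alternating_on :: "nat \<Rightarrow> ((nat \<Rightarrow> 'v) \<Rightarrow> real) \<Rightarrow> bool" where
  "alternating_on k \<alpha> \<longleftrightarrow> (\<forall>v i j. i < k \<longrightarrow> j < k \<longrightarrow> i \<noteq> j \<longrightarrow> v i = v j \<longrightarrow> \<alpha> v = 0)"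

definition multilinear_on :: "nat \<Rightarrow> ((nat \<Rightarrow> 'v::real_vector) \<Rightarrow> real) \<Rightarrow> bool" where
  "multilinear_on k \<alpha> \<longleftrightarrow> (\<forall>v. \<forall>i<k. linear (\<lambda>x. \<alpha> (v(i := x)))) \<and>
     (\<forall>v w. (\<forall>i<k. v i = w i) \<longrightarrow> \<alpha> v = \<alpha> w)"

lemma multilinear_onD:
  assumes "multilinear_on k \<alpha>"
  shows "i < k \<Longrightarrow> linear (\<lambda>x. \<alpha> (v(i := x)))" and "(\<And>i. i < k \<Longrightarrow> v i = w i) \<Longrightarrow> \<alpha> v = \<alpha> w"
  using assms unfolding multilinear_on_def by blast+

definition vanishes_at :: "nat \<Rightarrow> 'v \<Rightarrow> ((nat \<Rightarrow> 'v) \<Rightarrow> real) \<Rightarrow> bool" where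
  "vanishes_at k x \<alpha> \<longleftrightarrow> (\<forall>v i. i < k \<longrightarrow> v i = x \<longrightarrow> \<alpha> v = 0)"

text \<open>For arbitrary \<open>\<alpha>\<close> and \<open>\<beta>\<close> the sum over all permutations is alternating, since composition
  with a transposition permutes the summands and changes the signs.\<close>

lemma wedge_swap:
  assumes "i < k + l" "j < k + l" "i \<noteq> j"
  shows "wedge k l \<alpha> \<beta> (v \<circ> Transposition.transpose i j) = - wedge k l \<alpha> \<beta> v"
proof -
  let ?t = "Transposition.transpose i j" and ?P = "{\<sigma>. \<sigma> permutes {..<k + l}}"
  let ?F = "\<lambda>\<sigma>. of_int (sign \<sigma>) * \<alpha> (\<lambda>i. v (\<sigma> i)) * \<beta> (\<lambda>i. v (\<sigma> (k + i)))"
  have t: "?t permutes {..<k + l}"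
    using assms by (intro permutes_swap_id) auto
  have tt: "?t \<circ> (?t \<circ> \<sigma>) = \<sigma>" for \<sigma> :: "nat \<Rightarrow> nat"
    by (simp add: fun_eq_iff)
  have perm: "permutation \<sigma>" if "\<sigma> \<in> ?P" for \<sigma>
    using that permutation_permutes[of \<sigma>] by (metis finite_lessThan mem_Collect_eq)
  have "(\<Sum>\<sigma>\<in>?P. ?F \<sigma>) = (\<Sum>\<sigma>\<in>?P. ?F (?t \<circ> \<sigma>))"
    by (rule sum.reindex_bij_witness[of _ "(\<circ>) ?t" "(\<circ>) ?t"])
      (auto simp: tt permutes_compose[OF _ t])
  also have "\<dots> = (\<Sum>\<sigma>\<in>?P. - (of_int (sign \<sigma>) * \<alpha> (\<lambda>i. (v \<circ> ?t) (\<sigma> i)) * \<beta> (\<lambda>i. (v \<circ> ?t) (\<sigma> (k + i)))))"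
    using assms perm
    by (intro sum.cong refl) (simp add: sign_compose permutation_swap_id sign_swap_id)
  finally show ?thesis
    by (simp add: wedge_def sum_negf)
qed

lemma alternating_wedge: "alternating_on (k + l) (wedge k l \<alpha> \<beta>)"
  unfolding alternating_on_def
proof (intro allI impI)
  fix v :: "nat \<Rightarrow> 'a" and i j assume ij: "i < k + l" "j < k + l" "i \<noteq> j" and eq: "v i = v j"
  have "v \<circ> Transposition.transpose i j = v"
    using eq by (auto simp: fun_eq_iff Transposition.transpose_def)
  then show "wedge k l \<alpha> \<beta> v = 0"
    using wedge_swap[OF ij, of \<alpha> \<beta> v] by simp
qed

lemma permutes_preimage:
  assumes "\<sigma> permutes S" "i \<in> S" obtains j where "j \<in> S" "\<sigma> j = i"
proof -
  have "i \<in> \<sigma> ` S" using permutes_image[OF assms(1)] assms(2) by simp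
  then show ?thesis using that by auto
qed

lemma vanishes_at_wedge:
  assumes "vanishes_at k x \<alpha>" "vanishes_at l x \<beta>"
  shows "vanishes_at (k + l) x (wedge k l \<alpha> \<beta>)"
  unfolding vanishes_at_def
proof (intro allI impI)
  fix v :: "nat \<Rightarrow> 'a" and i assume i: "i < k + l" and vi: "v i = x"
  have "\<alpha> (\<lambda>i. v (\<sigma> i)) * \<beta> (\<lambda>i. v (\<sigma> (k + i))) = 0" if \<sigma>: "\<sigma> permutes {..<k + l}" for \<sigma>
  proof -
    obtain j where j: "j < k + l" "\<sigma> j = i"
      using permutes_preimage[OF \<sigma>, of i] i by auto
    show ?thesis
    proof (cases "j < k")
      case True
      then show ?thesis using assms(1) j vi by (auto simp: vanishes_at_def)
    next
      case False
      then have "j - k < l" "v (\<sigma> (k + (j - k))) = x" using j vi by auto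
      then show ?thesis using assms(2) by (auto simp: vanishes_at_def)
    qed
  qed
  then show "wedge k l \<alpha> \<beta> v = 0"
    by (auto simp: wedge_def mult.assoc intro!: sum.neutral)
qed

lemma linear_mult_const:
  fixes f :: "'v::real_vector \<Rightarrow> real"
  assumes "linear f" shows "linear (\<lambda>x. c * f x)" "linear (\<lambda>x. f x * c)"
  by (auto intro!: linearI simp: linear_add[OF assms] linear_cmul[OF assms] distrib_left distrib_right)

lemma multilinear_wedge:
  assumes "multilinear_on k \<alpha>" "multilinear_on l \<beta>"
  shows "multilinear_on (k + l) (wedge k l \<alpha> \<beta>)"
proof -
  have lin: "linear (\<lambda>x. \<alpha> (\<lambda>n. (v(i := x)) (\<sigma> n)) * \<beta> (\<lambda>n. (v(i := x)) (\<sigma> (k + n))))"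
    if \<sigma>: "\<sigma> permutes {..<k + l}" and i: "i < k + l" for v i \<sigma>
  proof -
    obtain j where j: "j < k + l" "\<sigma> j = i"
      using permutes_preimage[OF \<sigma>, of i] i by auto
    have inj: "\<sigma> n = i \<longleftrightarrow> n = j" for n
      using j permutes_inj[OF \<sigma>] by (auto simp: inj_def)
    show ?thesis
    proof (cases "j < k")
      case True
      have "(\<lambda>n. (v(i := x)) (\<sigma> n)) = (\<lambda>n. v (\<sigma> n))(j := x)" for x
        by (auto simp: fun_eq_iff inj)
      moreover have "(\<lambda>n. (v(i := x)) (\<sigma> (k + n))) = (\<lambda>n. v (\<sigma> (k + n)))" for x
        using True by (auto simp: fun_eq_iff inj)
      moreover have "linear (\<lambda>x. \<alpha> ((\<lambda>n. v (\<sigma> n))(j := x)))"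
        using multilinear_onD(1)[OF assms(1) True] .
      ultimately show ?thesis by (simp add: linear_mult_const)
    next
      case False
      then have jk: "j - k < l" using j by auto
      have "(\<lambda>n. (v(i := x)) (\<sigma> (k + n))) = (\<lambda>n. v (\<sigma> (k + n)))(j - k := x)" for x
        using False by (auto simp: fun_eq_iff inj)
      moreover have "\<alpha> (\<lambda>n. (v(i := x)) (\<sigma> n)) = \<alpha> (\<lambda>n. v (\<sigma> n))" for x
        using False by (intro multilinear_onD(2)[OF assms(1)]) (auto simp: inj)
      moreover have "linear (\<lambda>x. \<beta> ((\<lambda>n. v (\<sigma> (k + n)))(j - k := x)))"
        using multilinear_onD(1)[OF assms(2) jk] .
      ultimately show ?thesis by (simp add: linear_mult_const)
    qed
  qed
  have "linear (\<lambda>x. wedge k l \<alpha> \<beta> (v(i := x)))" if "i < k + l" for v i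
    unfolding wedge_def divide_inverse mult.assoc
    by (intro linear_mult_const linear_compose_sum ballI lin that) simp
  moreover have "wedge k l \<alpha> \<beta> v = wedge k l \<alpha> \<beta> w" if "\<forall>i<k + l. v i = w i" for v w
  proof -
    have "\<alpha> (\<lambda>n. v (\<sigma> n)) = \<alpha> (\<lambda>n. w (\<sigma> n)) \<and> \<beta> (\<lambda>n. v (\<sigma> (k + n))) = \<beta> (\<lambda>n. w (\<sigma> (k + n)))"
      if \<sigma>: "\<sigma> permutes {..<k + l}" for \<sigma>
    proof -
      have "v (\<sigma> n) = w (\<sigma> n)" if "n < k + l" for n
        using that \<sigma> \<open>\<forall>i<k + l. v i = w i\<close> permutes_in_image[OF \<sigma>, of n] by auto
      then show ?thesis
        by (intro conjI multilinear_onD(2)[OF assms(1)] multilinear_onD(2)[OF assms(2)]) auto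
    qed
    then show ?thesis by (simp add: wedge_def)
  qed
  ultimately show ?thesis unfolding multilinear_on_def by blast
qed

lemma multilinear_wedge_power:
  "multilinear_on k \<alpha> \<Longrightarrow> multilinear_on (k * n) (wedge_power k \<alpha> n)"
proof (induction n)
  case 0
  then show ?case by (simp add: multilinear_on_def module_hom_zero linear_zero)
next
  case (Suc n)
  then show ?case using multilinear_wedge[of k \<alpha> "k * n"] by simp
qed

lemma vanishes_at_wedge_power:
  "vanishes_at k x \<alpha> \<Longrightarrow> vanishes_at (k * n) x (wedge_power k \<alpha> n)"
proof (induction n)
  case 0
  then show ?case by (simp add: vanishes_at_def)
next
  case (Suc n)
  then show ?case using vanishes_at_wedge[of k x \<alpha> "k * n"] by simp
qed

text \<open>Vectors on which an alternating form of top degree does not vanish form a basis.  Expand \<open>x\<close>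
  in it and substitute \<open>x\<close> for the \<open>j\<close>-th basis vector: the result is the \<open>j\<close>-th coefficient times
  a nonzero number, and it is 0.\<close>

lemma top_form_vanishes_at:
  fixes x :: "'v::euclidean_space"
  assumes alt: "alternating_on DIM('v) \<alpha>" and lin: "multilinear_on DIM('v) \<alpha>"
    and van: "vanishes_at DIM('v) x \<alpha>" and nz: "\<alpha> v \<noteq> 0"
  shows "x = 0"
proof -
  let ?I = "{..<DIM('v)}"
  have expand: "\<alpha> (v(j := (\<Sum>i\<in>?I. c i *\<^sub>R v i))) = c j * \<alpha> v" if j: "j < DIM('v)" for c j
  proof -
    have L: "linear (\<lambda>x. \<alpha> (v(j := x)))" using multilinear_onD(1)[OF lin j] .
    have "\<alpha> (v(j := (\<Sum>i\<in>?I. c i *\<^sub>R v i))) = (\<Sum>i\<in>?I. c i * \<alpha> (v(j := v i)))"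
      using linear_sum[OF L, of "\<lambda>i. c i *\<^sub>R v i" ?I] by (simp add: linear_cmul[OF L])
    also have "\<dots> = (\<Sum>i\<in>{j}. c i * \<alpha> (v(j := v i)))"
    proof (rule sum.mono_neutral_right)
      show "\<forall>i\<in>?I - {j}. c i * \<alpha> (v(j := v i)) = 0"
      proof
        fix i assume i: "i \<in> ?I - {j}"
        then have "\<alpha> (v(j := v i)) = 0"
          using alt j unfolding alternating_on_def by auto
        then show "c i * \<alpha> (v(j := v i)) = 0" by simp
      qed
    qed (use j in auto)
    finally show ?thesis by simp
  qed
  have zero: "c j = 0" if "(\<Sum>i\<in>?I. c i *\<^sub>R v i) = 0" "j < DIM('v)" for c j
  proof -
    have L: "linear (\<lambda>x. \<alpha> (v(j := x)))" using multilinear_onD(1)[OF lin that(2)] .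
    show ?thesis using expand[OF that(2), of c] nz linear_0[OF L] by (simp add: that(1))
  qed
  have inj: "inj_on v ?I"
    using alt nz by (auto simp: inj_on_def alternating_on_def)
  have ind: "independent (v ` ?I)"
  proof
    assume "dependent (v ` ?I)"
    then obtain u y where u: "y \<in> v ` ?I" "u y \<noteq> 0" "(\<Sum>y\<in>v ` ?I. u y *\<^sub>R y) = 0"
      by (auto simp: dependent_finite)
    then obtain j where j: "j < DIM('v)" "y = v j" by auto
    have "(\<Sum>i\<in>?I. u (v i) *\<^sub>R v i) = 0"
      using u(3) by (simp add: sum.reindex[OF inj] o_def)
    then show False using zero[of "\<lambda>i. u (v i)" j] u(2) j by simp
  qed
  have "x \<in> span (v ` ?I)"
    using card_ge_dim_independent[OF _ ind, of UNIV] by (auto simp: card_image[OF inj])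
  then obtain c where c: "x = (\<Sum>y\<in>v ` ?I. c y *\<^sub>R y)"
    by (auto simp: span_finite)
  then have x: "x = (\<Sum>i\<in>?I. c (v i) *\<^sub>R v i)"
    by (simp add: sum.reindex[OF inj] o_def)
  have "c (v j) = 0" if j: "j < DIM('v)" for j
  proof -
    have "\<alpha> (v(j := x)) = 0" using van j by (auto simp: vanishes_at_def)
    then show ?thesis using expand[OF j, of "\<lambda>i. c (v i)"] nz x by simp
  qed
  then show ?thesis unfolding x by (intro sum.neutral) auto
qed

text \<open>A common kernel vector of \<open>\<omega>\<close> and \<open>\<eta>\<close> annihilates every factor of the top-degree form, hence
  the form.\<close>

theorem contact_form_nondegenerate:
  fixes \<omega> :: "'v::euclidean_space \<Rightarrow> 'v \<Rightarrow> real" and \<eta> :: "'v \<Rightarrow> real"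
  assumes dim: "DIM('v) = 2 * n + 1" and "bilinear \<omega>" "linear \<eta>"
    and skew: "\<And>x y. \<omega> x y = - \<omega> y x"
    and contact: "wedge (2 * n) 1 (wedge_power 2 (\<lambda>u. \<omega> (u 0) (u 1)) n) (\<lambda>u. \<eta> (u 0)) v \<noteq> 0"
    and x: "\<And>y. \<omega> x y = 0" "\<eta> x = 0"
  shows "x = 0"
proof (rule top_form_vanishes_at)
  let ?\<alpha> = "wedge_power 2 (\<lambda>u. \<omega> (u 0) (u 1)) n" and ?\<beta> = "\<lambda>u::nat \<Rightarrow> 'v. \<eta> (u 0)"
  show "alternating_on DIM('v) (wedge (2 * n) 1 ?\<alpha> ?\<beta>)"
    unfolding dim by (rule alternating_wedge)
  have "multilinear_on 2 (\<lambda>u. \<omega> (u 0) (u 1))"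
    using \<open>bilinear \<omega>\<close> by (auto simp: multilinear_on_def bilinear_def less_2_cases_iff)
  moreover have "multilinear_on 1 ?\<beta>"
    using \<open>linear \<eta>\<close> by (auto simp: multilinear_on_def)
  ultimately show "multilinear_on DIM('v) (wedge (2 * n) 1 ?\<alpha> ?\<beta>)"
    unfolding dim by (intro multilinear_wedge multilinear_wedge_power)
  have "vanishes_at 2 x (\<lambda>u. \<omega> (u 0) (u 1))"
    unfolding vanishes_at_def using x(1) skew[of _ x] by (metis One_nat_def less_2_cases minus_zero)
  moreover have "vanishes_at 1 x ?\<beta>"
    using x(2) by (auto simp: vanishes_at_def)
  ultimately show "vanishes_at DIM('v) x (wedge (2 * n) 1 ?\<alpha> ?\<beta>)"
    unfolding dim by (intro vanishes_at_wedge vanishes_at_wedge_power)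
  show "wedge (2 * n) 1 ?\<alpha> ?\<beta> v \<noteq> 0" by (rule contact)
qed

section \<open>Derivatives\<close>

lemma smooth_on_has_derivative:
  assumes "smooth_on S f" "open S" "x \<in> S"
  shows "(f has_derivative frechet_derivative f (at x)) (at x)"
proof -
  have "Ck_on (Suc 0) S f" using assms(1) unfolding smooth_on_def by blast
  then have "f differentiable_on S" by simp
  then show ?thesis
    using assms(2,3) by (metis differentiable_on_eq_differentiable_at frechet_derivative_works)
qed

lemma smooth_on_derivative_differentiable:
  assumes "smooth_on S f" "open S" "x \<in> S"
  shows "(\<lambda>x. frechet_derivative f (at x) v) differentiable (at x)"
proof -
  have "Ck_on (Suc (Suc 0)) S f" using assms(1) unfolding smooth_on_def by blast
  then have "(\<lambda>x. frechet_derivative f (at x) v) differentiable_on S" by simp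
  then show ?thesis
    using assms(2,3) by (metis differentiable_on_eq_differentiable_at)
qed

text \<open>The second difference of \<open>F\<close> over the parallelogram with sides \<open>t h\<close> and \<open>t k\<close> is a
  difference of values of \<open>s \<mapsto> F (z + s h + t k) - F (z + s h)\<close>.  The mean value theorem expresses
  it by \<open>F' \<sqdot> h\<close> at two points close to \<open>z\<close>, and differentiability of \<open>F' \<sqdot> h\<close> at the single point
  \<open>z\<close> suffices to evaluate it up to \<open>e t\<^sup>2\<close>.\<close>

lemma second_difference:
  fixes F :: "'a::real_normed_vector \<Rightarrow> real"
  assumes S: "open S" "z \<in> S" and F: "\<And>x. x \<in> S \<Longrightarrow> (F has_derivative F' x) (at x)"
    and G: "((\<lambda>x. F' x h) has_derivative G) (at z)" and e: "e > 0"
  shows "\<exists>d>0. \<forall>t. 0 < t \<and> t < d \<longrightarrow>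
    \<bar>F (z + t *\<^sub>R h + t *\<^sub>R k) - F (z + t *\<^sub>R h) - F (z + t *\<^sub>R k) + F z - t * t * G k\<bar> \<le> e * (t * t)"
proof -
  \<comment> \<open>The total length of the increments is at most \<open>N t\<close>.\<close>
  define N where "N = 2 * norm h + norm k + 1"
  have N: "N > 0" using norm_ge_zero[of h] norm_ge_zero[of k] unfolding N_def by linarith
  define e' where "e' = e / N"
  have e': "e' > 0" using e N by (simp add: e'_def)
  have lG: "linear G" using G by (simp add: has_derivative_bounded_linear bounded_linear.linear)
  obtain d1 where d1: "d1 > 0" "\<And>y. norm (y - z) < d1 \<Longrightarrow> norm (F' y h - F' z h - G (y - z)) \<le> e' * norm (y - z)"
    using G e' unfolding has_derivative_at_alt by meson
  obtain d2 where d2: "d2 > 0" "ball z d2 \<subseteq> S"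
    using S open_contains_ball by blast
  define d where "d = min d1 d2 / N"
  have "d > 0" using d1 d2 N by (simp add: d_def)
  moreover have "\<bar>F (z + t *\<^sub>R h + t *\<^sub>R k) - F (z + t *\<^sub>R h) - F (z + t *\<^sub>R k) + F z - t * t * G k\<bar> \<le> e * (t * t)"
    if t: "0 < t" "t < d" for t
  proof -
    have tN: "t * N < d1" "t * N < d2"
      using t N by (auto simp: d_def field_simps)
    have small: "norm (s *\<^sub>R h + t *\<^sub>R k) \<le> t * (norm h + norm k)" "norm (s *\<^sub>R h) \<le> t * norm h"
      if "0 \<le> s" "s \<le> t" for s
    proof -
      show "norm (s *\<^sub>R h) \<le> t * norm h" using that by (simp add: mult_right_mono)
      then show "norm (s *\<^sub>R h + t *\<^sub>R k) \<le> t * (norm h + norm k)"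
        using norm_triangle_ineq[of "s *\<^sub>R h" "t *\<^sub>R k"] t by (simp add: distrib_left)
    qed
    have lt: "t * (norm h + norm k) < t * N" "t * norm h < t * N"
    proof -
      have "norm h + norm k < N" "norm h < N"
        using norm_ge_zero[of h] norm_ge_zero[of k] unfolding N_def by linarith+
      then show "t * (norm h + norm k) < t * N" "t * norm h < t * N"
        using t by (simp_all add: mult_strict_left_mono)
    qed
    have inS: "z + w \<in> S" if "norm w < d2" for w
      by (rule subsetD[OF d2(2)]) (simp add: dist_norm that)
    let ?\<phi> = "\<lambda>s. F (z + s *\<^sub>R h + t *\<^sub>R k) - F (z + s *\<^sub>R h)"
    have der: "((\<lambda>s. ?\<phi> s) has_derivative (\<lambda>r. r * (F' (z + s *\<^sub>R h + t *\<^sub>R k) h - F' (z + s *\<^sub>R h) h))) (at s)"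
      if s: "0 \<le> s" "s \<le> t" for s
    proof -
      have in1: "z + s *\<^sub>R h + t *\<^sub>R k \<in> S" and in2: "z + s *\<^sub>R h \<in> S"
        using inS[OF order.strict_trans1[OF small(1)[OF s] less_trans[OF lt(1) tN(2)]]]
          inS[OF order.strict_trans1[OF small(2)[OF s] less_trans[OF lt(2) tN(2)]]]
        by (simp_all only: add.assoc)
      have a: "((\<lambda>s. F (z + s *\<^sub>R h + t *\<^sub>R k)) has_derivative (\<lambda>r. F' (z + s *\<^sub>R h + t *\<^sub>R k) (r *\<^sub>R h))) (at s)"
      proof -
        have "((\<lambda>s. z + s *\<^sub>R h + t *\<^sub>R k) has_derivative (\<lambda>r. r *\<^sub>R h)) (at s)"
          by (auto intro!: derivative_eq_intros)
        from has_derivative_compose[OF this F[OF in1]] show ?thesis .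
      qed
      have b: "((\<lambda>s. F (z + s *\<^sub>R h)) has_derivative (\<lambda>r. F' (z + s *\<^sub>R h) (r *\<^sub>R h))) (at s)"
      proof -
        have "((\<lambda>s. z + s *\<^sub>R h) has_derivative (\<lambda>r. r *\<^sub>R h)) (at s)"
          by (auto intro!: derivative_eq_intros)
        from has_derivative_compose[OF this F[OF in2]] show ?thesis .
      qed
      have l: "linear (F' (z + s *\<^sub>R h + t *\<^sub>R k))" "linear (F' (z + s *\<^sub>R h))"
        using F[OF in1] F[OF in2] by (simp_all add: has_derivative_bounded_linear bounded_linear.linear)
      show ?thesis
        using has_derivative_diff[OF a b] by (simp add: linear_cmul[OF l(1)] linear_cmul[OF l(2)] right_diff_distrib)
    qed
    define \<phi> where "\<phi> s = F (z + s *\<^sub>R h + t *\<^sub>R k) - F (z + s *\<^sub>R h)" for s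
    define \<psi> where "\<psi> s = F' (z + s *\<^sub>R h + t *\<^sub>R k) h - F' (z + s *\<^sub>R h) h" for s
    have "\<exists>s\<in>{0<..<t}. \<phi> t - \<phi> 0 = (\<lambda>r. r * \<psi> s) (t - 0)"
    proof (rule mvt_simple[OF t(1)])
      fix s assume "0 \<le> s" "s \<le> t"
      then show "(\<phi> has_derivative (\<lambda>r. r * \<psi> s)) (at s within {0..t})"
        unfolding \<phi>_def \<psi>_def by (rule has_derivative_at_withinI[OF der])
    qed
    then obtain s where s: "0 < s" "s < t" "\<phi> t - \<phi> 0 = t * \<psi> s"
      by auto
    have sm: "norm (s *\<^sub>R h + t *\<^sub>R k) \<le> t * (norm h + norm k)" "norm (s *\<^sub>R h) \<le> t * norm h"
      using small s by auto
    have b1: "\<bar>F' (z + s *\<^sub>R h + t *\<^sub>R k) h - F' z h - G (s *\<^sub>R h + t *\<^sub>R k)\<bar> \<le> e' * (t * (norm h + norm k))"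
      by (rule order_trans[OF _ mult_left_mono[OF sm(1), of e']])
        (use d1(2)[of "z + s *\<^sub>R h + t *\<^sub>R k"] sm lt tN e' in \<open>simp_all add: add.assoc\<close>)
    have b2: "\<bar>F' (z + s *\<^sub>R h) h - F' z h - G (s *\<^sub>R h)\<bar> \<le> e' * (t * norm h)"
      by (rule order_trans[OF _ mult_left_mono[OF sm(2), of e']])
        (use d1(2)[of "z + s *\<^sub>R h"] sm lt tN e' in simp_all)
    have Gs: "G (s *\<^sub>R h + t *\<^sub>R k) - G (s *\<^sub>R h) = t * G k"
      by (simp add: linear_add[OF lG] linear_cmul[OF lG])
    have "\<bar>F' (z + s *\<^sub>R h + t *\<^sub>R k) h - F' (z + s *\<^sub>R h) h - t * G k\<bar> \<le> e' * (t * (norm h + norm k)) + e' * (t * norm h)"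
      using b1 b2 unfolding Gs[symmetric] by linarith
    also have "\<dots> = e' * t * (2 * norm h + norm k)" by (simp add: algebra_simps)
    also have "\<dots> \<le> e' * t * N" using e' t by (intro mult_left_mono) (auto simp: N_def)
    also have "\<dots> = e * t" using N by (simp add: e'_def)
    finally have m: "\<bar>F' (z + s *\<^sub>R h + t *\<^sub>R k) h - F' (z + s *\<^sub>R h) h - t * G k\<bar> \<le> e * t" .
    have "F (z + t *\<^sub>R h + t *\<^sub>R k) - F (z + t *\<^sub>R h) - F (z + t *\<^sub>R k) + F z - t * t * G k
        = t * (F' (z + s *\<^sub>R h + t *\<^sub>R k) h - F' (z + s *\<^sub>R h) h - t * G k)"
      using s(3) by (simp add: \<phi>_def \<psi>_def algebra_simps)
    then have "\<bar>F (z + t *\<^sub>R h + t *\<^sub>R k) - F (z + t *\<^sub>R h) - F (z + t *\<^sub>R k) + F z - t * t * G k\<bar>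
        = t * \<bar>F' (z + s *\<^sub>R h + t *\<^sub>R k) h - F' (z + s *\<^sub>R h) h - t * G k\<bar>"
      using t by (simp only: abs_mult abs_of_pos)
    also have "\<dots> \<le> t * (e * t)" using m t by (intro mult_left_mono) auto
    finally show ?thesis by (simp only: mult.left_commute)
  qed
  ultimately show ?thesis by blast
qed

text \<open>The second difference is symmetric in \<open>h\<close> and \<open>k\<close>.\<close>

lemma mixed_derivatives_eq_real:
  fixes F :: "'a::real_normed_vector \<Rightarrow> real"
  assumes S: "open S" "z \<in> S" and F: "\<And>x. x \<in> S \<Longrightarrow> (F has_derivative F' x) (at x)"
    and G: "((\<lambda>x. F' x h) has_derivative G) (at z)" and H: "((\<lambda>x. F' x k) has_derivative H) (at z)"
  shows "G k = H h"
proof (rule ccontr)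
  assume "G k \<noteq> H h"
  define e where "e = \<bar>G k - H h\<bar> / 3"
  have e: "e > 0" using \<open>G k \<noteq> H h\<close> by (simp add: e_def)
  obtain d1 where d1: "d1 > 0" "\<And>t. 0 < t \<Longrightarrow> t < d1 \<Longrightarrow>
     \<bar>F (z + t *\<^sub>R h + t *\<^sub>R k) - F (z + t *\<^sub>R h) - F (z + t *\<^sub>R k) + F z - t * t * G k\<bar> \<le> e * (t * t)"
    using second_difference[OF S F G e, of k] by blast
  obtain d2 where d2: "d2 > 0" "\<And>t. 0 < t \<Longrightarrow> t < d2 \<Longrightarrow>
     \<bar>F (z + t *\<^sub>R k + t *\<^sub>R h) - F (z + t *\<^sub>R k) - F (z + t *\<^sub>R h) + F z - t * t * H h\<bar> \<le> e * (t * t)"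
    using second_difference[OF S F H e, of h] by blast
  define t where "t = min d1 d2 / 2"
  have t: "0 < t" "t < d1" "t < d2" using d1(1) d2(1) by (auto simp: t_def)
  have "z + t *\<^sub>R k + t *\<^sub>R h = z + t *\<^sub>R h + t *\<^sub>R k" by (simp add: algebra_simps)
  then have "\<bar>t * t * G k - t * t * H h\<bar> \<le> 2 * (e * (t * t))"
    using d1(2)[OF t(1,2)] d2(2)[OF t(1,3)] by (simp only:)
  then have "(t * t) * \<bar>G k - H h\<bar> \<le> (t * t) * (2 * e)"
    by (simp add: abs_mult flip: right_diff_distrib) (simp add: algebra_simps)
  then have "\<bar>G k - H h\<bar> \<le> 2 * e" using t by simp
  then show False using e by (simp add: e_def)
qed

lemma mixed_derivatives_eq:
  fixes F :: "'a::real_normed_vector \<Rightarrow> 'b::euclidean_space"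
  assumes S: "open S" "z \<in> S" and F: "\<And>x. x \<in> S \<Longrightarrow> (F has_derivative F' x) (at x)"
    and G: "((\<lambda>x. F' x h) has_derivative G) (at z)" and H: "((\<lambda>x. F' x k) has_derivative H) (at z)"
  shows "G k = H h"
proof (rule euclidean_eqI)
  fix b :: 'b
  show "G k \<bullet> b = H h \<bullet> b"
    by (rule mixed_derivatives_eq_real[OF S, of "\<lambda>x. F x \<bullet> b" "\<lambda>x v. F' x v \<bullet> b" h _ k])
      (auto intro: has_derivative_inner_left F G H)
qed

text \<open>The product rule for applying a varying linear map to a varying vector.  Differentiability
  of the family is only known for each fixed argument, so the family is expanded in the standard
  basis.\<close>

lemma has_derivative_linear_family:
  fixes H :: "'p::real_normed_vector \<Rightarrow> 'e::euclidean_space \<Rightarrow> 'f::real_normed_vector"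
  assumes lin: "\<forall>\<^sub>F x in nhds x0. linear (H x)"
    and H: "\<And>w. ((\<lambda>x. H x w) has_derivative H' w) (at x0)"
    and f: "(f has_derivative f') (at x0)"
  shows "((\<lambda>x. H x (f x)) has_derivative (\<lambda>u. H' (f x0) u + H x0 (f' u))) (at x0)"
proof -
  have expand: "H x w = (\<Sum>b\<in>Basis. (w \<bullet> b) *\<^sub>R H x b)" if "linear (H x)" for x w
  proof -
    have "H x w = H x (\<Sum>b\<in>Basis. (w \<bullet> b) *\<^sub>R b)" by (simp add: euclidean_representation)
    then show ?thesis by (simp add: linear_sum[OF that] linear_cmul[OF that])
  qed
  have lin0: "linear (H x0)" using lin by (rule eventually_nhds_x_imp_x)
  have "((\<lambda>x. \<Sum>b\<in>Basis. (f x \<bullet> b) *\<^sub>R H x b) has_derivative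
      (\<lambda>u. \<Sum>b\<in>Basis. (f x0 \<bullet> b) *\<^sub>R H' b u + (f' u \<bullet> b) *\<^sub>R H x0 b)) (at x0)"
    by (intro has_derivative_sum has_derivative_scaleR has_derivative_inner_left f H)
  then have main: "((\<lambda>x. H x (f x)) has_derivative
      (\<lambda>u. \<Sum>b\<in>Basis. (f x0 \<bullet> b) *\<^sub>R H' b u + (f' u \<bullet> b) *\<^sub>R H x0 b)) (at x0)"
    by (rule has_derivative_transform_eventually)
      (use lin in \<open>auto elim!: eventually_mono simp: expand[symmetric] lin0 eventually_nhds_conv_at\<close>)
  have "((\<lambda>x. \<Sum>b\<in>Basis. (w \<bullet> b) *\<^sub>R H x b) has_derivative (\<lambda>u. \<Sum>b\<in>Basis. (w \<bullet> b) *\<^sub>R H' b u)) (at x0)" for w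
    by (intro has_derivative_sum has_derivative_scaleR_right H)
  then have "((\<lambda>x. H x w) has_derivative (\<lambda>u. \<Sum>b\<in>Basis. (w \<bullet> b) *\<^sub>R H' b u)) (at x0)" for w
    by (rule has_derivative_transform_eventually)
      (use lin in \<open>auto elim!: eventually_mono simp: expand[symmetric] lin0 eventually_nhds_conv_at\<close>)
  then have H': "H' w = (\<lambda>u. \<Sum>b\<in>Basis. (w \<bullet> b) *\<^sub>R H' b u)" for w
    using has_derivative_unique[OF H] by blast
  show ?thesis
    using main by (subst H') (simp add: sum.distrib expand[OF lin0, of "f' _"])
qed

text \<open>A factor that merely tends to 0 is enough when the other factor vanishes to first order.\<close>

lemma has_derivative_null_product:
  fixes f :: "'a::real_normed_vector \<Rightarrow> real" and h :: "'a \<Rightarrow> 'b::real_normed_vector"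
  assumes f: "(f \<longlongrightarrow> 0) (at x0)" and h: "(h has_derivative h') (at x0)" and "h x0 = 0"
  shows "((\<lambda>x. f x *\<^sub>R h x) has_derivative (\<lambda>u. 0)) (at x0)"
proof -
  obtain K where K: "\<And>u. norm (h' u) \<le> norm u * K"
    using has_derivative_bounded_linear[OF h] bounded_linear.bounded by blast
  have lim: "((\<lambda>x. norm (h x - h x0 - h' (x - x0)) / norm (x - x0)) \<longlongrightarrow> 0) (at x0)"
    using h unfolding has_derivative_iff_norm by simp
  have "((\<lambda>x. norm (f x *\<^sub>R h x - f x0 *\<^sub>R h x0 - 0) / norm (x - x0)) \<longlongrightarrow> 0) (at x0)"
  proof (rule Lim_null_comparison)
    show "((\<lambda>x. \<bar>f x\<bar> * (norm (h x - h x0 - h' (x - x0)) / norm (x - x0) + K)) \<longlongrightarrow> 0) (at x0)"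
      using tendsto_mult[OF tendsto_rabs_zero[OF f] tendsto_add[OF lim tendsto_const[of K]]] by simp
    have "norm (norm (f x *\<^sub>R h x - f x0 *\<^sub>R h x0 - 0) / norm (x - x0))
        \<le> \<bar>f x\<bar> * (norm (h x - h x0 - h' (x - x0)) / norm (x - x0) + K)" if "x \<noteq> x0" for x
    proof -
      have p: "norm (x - x0) > 0" using that by simp
      have "norm (h x) \<le> norm (h x - h x0 - h' (x - x0)) + norm (h' (x - x0))"
        using norm_triangle_ineq[of "h x - h' (x - x0)" "h' (x - x0)"] assms(3) by simp
      then have "norm (h x) \<le> norm (h x - h x0 - h' (x - x0)) + norm (x - x0) * K"
        using K[of "x - x0"] by linarith
      then have le: "norm (h x) / norm (x - x0) \<le> norm (h x - h x0 - h' (x - x0)) / norm (x - x0) + K"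
        using p by (simp add: field_simps)
      have "norm (norm (f x *\<^sub>R h x - f x0 *\<^sub>R h x0 - 0) / norm (x - x0)) = \<bar>f x\<bar> * (norm (h x) / norm (x - x0))"
        using assms(3) by simp
      also have "\<dots> \<le> \<bar>f x\<bar> * (norm (h x - h x0 - h' (x - x0)) / norm (x - x0) + K)"
        by (rule mult_left_mono[OF le]) simp
      finally show ?thesis .
    qed
    then show "\<forall>\<^sub>F x in at x0. norm (norm (f x *\<^sub>R h x - f x0 *\<^sub>R h x0 - 0) / norm (x - x0))
        \<le> \<bar>f x\<bar> * (norm (h x - h x0 - h' (x - x0)) / norm (x - x0) + K)"
      unfolding eventually_at by (intro exI[of _ 1]) simp
  qed
  then have "((\<lambda>x. norm (f x *\<^sub>R h x - f x0 *\<^sub>R h x0 - 0) / norm (x - x0)) \<longlongrightarrow> 0) (at x0)"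
    by simp
  then show ?thesis unfolding has_derivative_iff_norm by simp
qed


text \<open>Let \<open>L\<close> be a left inverse of \<open>\<sigma>'\<close>.  Then \<open>f y - f y0\<close> differs from the differentiable
  function \<open>L (\<sigma> (f y)) - L (\<sigma> (f y0))\<close> by \<open>o(|f y - f y0|)\<close>, which by absorption is
  \<open>o(|y - y0|)\<close>.\<close>

lemma differentiable_lift_immersion:
  fixes \<sigma> :: "'e::euclidean_space \<Rightarrow> 'f::euclidean_space" and f :: "'p::real_normed_vector \<Rightarrow> 'e"
  assumes cont: "isCont f y0"
    and \<sigma>: "(\<sigma> has_derivative \<sigma>') (at (f y0))" and inj: "\<And>w. \<sigma>' w = 0 \<Longrightarrow> w = 0"
    and S: "((\<lambda>y. \<sigma> (f y)) has_derivative S') (at y0)"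
  shows "f differentiable (at y0)"
proof -
  have lin: "linear \<sigma>'" using \<sigma> by (simp add: has_derivative_bounded_linear bounded_linear.linear)
  have "inj \<sigma>'" using inj linear_injective_0[OF lin] by blast
  then obtain L where L: "linear L" "L \<circ> \<sigma>' = id"
    using linear_injective_left_inverse[OF lin] by blast
  have L\<sigma>: "L (\<sigma>' w) = w" for w using L(2) by (metis comp_apply id_apply)
  have bL: "bounded_linear L" using L(1) by (simp add: linear_conv_bounded_linear)
  have q: "((\<lambda>y. L (\<sigma> (f y))) has_derivative (\<lambda>u. L (S' u))) (at y0)"
    by (rule bounded_linear.has_derivative[OF bL S])
  have r: "((\<lambda>z. L (\<sigma> z)) has_derivative (\<lambda>u. u)) (at (f y0))"
    using bounded_linear.has_derivative[OF bL \<sigma>] by (simp add: L\<sigma>)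
  obtain K where K: "K > 0" "\<And>u. norm (L (S' u)) \<le> norm u * K"
    using bounded_linear.pos_bounded[OF has_derivative_bounded_linear[OF q]] by blast
  have "(f has_derivative (\<lambda>u. L (S' u))) (at y0)"
    unfolding has_derivative_at_alt
  proof (intro conjI allI impI has_derivative_bounded_linear[OF q])
    fix e :: real assume e: "e > 0"
    \<comment> \<open>The bound \<open>1 / 2\<close> is for the absorption, the other one for the final estimate.\<close>
    define e1 where "e1 = min (1 / 2) (e / (4 * (K + 1)))"
    have e1: "e1 > 0" "e1 \<le> 1 / 2" "e1 \<le> e / (4 * (K + 1))"
      using e K(1) unfolding e1_def by (simp_all only: min.cobounded1 min.cobounded2) simp
    then have e1': "e1 * (4 * (K + 1)) \<le> e"
      using K(1) by (simp add: pos_le_divide_eq)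
    obtain d1 where d1: "d1 > 0" "\<And>z. norm (z - f y0) < d1 \<Longrightarrow>
        norm (L (\<sigma> z) - L (\<sigma> (f y0)) - (z - f y0)) \<le> e1 * norm (z - f y0)"
      using r e1(1) unfolding has_derivative_at_alt by meson
    obtain d2 where d2: "d2 > 0" "\<And>y. norm (y - y0) < d2 \<Longrightarrow> norm (f y - f y0) < d1"
      using cont d1(1) unfolding continuous_at_eps_delta dist_norm by meson
    define e2 where "e2 = min 1 (e / 2)"
    have e2: "e2 > 0" using e by (simp add: e2_def)
    have e2': "e2 \<le> 1" "e2 \<le> e / 2" unfolding e2_def by (rule min.cobounded1 min.cobounded2)+
    obtain d3 where d3: "d3 > 0" "\<And>y. norm (y - y0) < d3 \<Longrightarrow>
        norm (L (\<sigma> (f y)) - L (\<sigma> (f y0)) - L (S' (y - y0))) \<le> e2 * norm (y - y0)"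
      using q e2 unfolding has_derivative_at_alt by meson
    show "\<exists>d>0. \<forall>y. norm (y - y0) < d \<longrightarrow> norm (f y - f y0 - L (S' (y - y0))) \<le> e * norm (y - y0)"
    proof (intro exI[of _ "min d2 d3"] conjI allI impI)
      show "min d2 d3 > 0" using d2 d3 by simp
      fix y assume y: "norm (y - y0) < min d2 d3"
      let ?q = "L (\<sigma> (f y)) - L (\<sigma> (f y0))" and ?n = "norm (y - y0)"
      have a: "norm (?q - (f y - f y0)) \<le> e1 * norm (f y - f y0)"
        using d1(2) d2(2) y by simp
      have b: "norm (?q - L (S' (y - y0))) \<le> e2 * ?n"
        using d3(2) y by simp
      have "norm ?q \<le> norm (?q - L (S' (y - y0))) + norm (L (S' (y - y0)))"
        using norm_triangle_ineq[of "?q - L (S' (y - y0))" "L (S' (y - y0))"] by simp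
      also have "\<dots> \<le> 1 * ?n + ?n * K"
        using b K(2)[of "y - y0"] mult_right_mono[OF e2'(1), of ?n] by simp
      finally have c: "norm ?q \<le> (K + 1) * ?n" by (simp add: algebra_simps)
      have "norm (f y - f y0) \<le> norm ?q + norm (?q - (f y - f y0))"
        using norm_triangle_ineq4[of ?q "?q - (f y - f y0)"] by simp
      also have "\<dots> \<le> (K + 1) * ?n + (1 / 2) * norm (f y - f y0)"
        using a c e1(2) mult_right_mono[of e1 "1/2" "norm (f y - f y0)"] by simp
      finally have "norm (f y - f y0) \<le> 2 * ((K + 1) * ?n)" by linarith
      then have d: "norm (f y - f y0) \<le> 2 * (K + 1) * ?n" by (simp only: mult.assoc)
      have "e1 * norm (f y - f y0) \<le> e1 * (2 * (K + 1) * ?n)"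
        using d e1(1) by (intro mult_left_mono) auto
      also have "\<dots> = (e1 * (4 * (K + 1))) / 2 * ?n" by (simp add: algebra_simps)
      also have "\<dots> \<le> e / 2 * ?n" using e1' by (intro mult_right_mono) auto
      finally have a': "norm (?q - (f y - f y0)) \<le> e / 2 * ?n" using a by linarith
      have b': "norm (?q - L (S' (y - y0))) \<le> e / 2 * ?n"
        using b mult_right_mono[OF e2'(2), of ?n] by simp
      have "norm (f y - f y0 - L (S' (y - y0))) \<le> norm (?q - L (S' (y - y0))) + norm (?q - (f y - f y0))"
      proof -
        have "f y - f y0 - L (S' (y - y0)) = (?q - L (S' (y - y0))) - (?q - (f y - f y0))"
          by simp
        then show ?thesis by (simp only: norm_triangle_ineq4)
      qed
      then show "norm (f y - f y0 - L (S' (y - y0))) \<le> e * ?n"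
        using a' b' by simp
    qed
  qed
  then show ?thesis unfolding differentiable_def by blast
qed

text \<open>With a left inverse \<open>L\<close> of \<open>Q x0\<close> the equation becomes \<open>A x = L (P x) - R x (A x)\<close>, where
  \<open>R x = L \<circ> Q x - id\<close> is small near \<open>x0\<close>.  This bounds \<open>A\<close>, then shows that \<open>A\<close> is continuous at
  \<open>x0\<close>, and finally that the only term that is not obviously differentiable, \<open>R x (A x - A x0)\<close>,
  has derivative 0.\<close>

lemma linear_system_solution_differentiable:
  fixes Q :: "'p::real_normed_vector \<Rightarrow> 'e::euclidean_space \<Rightarrow> 'f::euclidean_space"
  assumes lin: "\<forall>\<^sub>F x in nhds x0. linear (Q x)"
    and Q: "\<And>w. ((\<lambda>x. Q x w) has_derivative Q' w) (at x0)"
    and P: "(P has_derivative P') (at x0)"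
    and eq: "\<forall>\<^sub>F x in nhds x0. Q x (A x) = P x"
    and inj: "\<And>w. Q x0 w = 0 \<Longrightarrow> w = 0"
  shows "A differentiable (at x0)"
proof -
  have lin0: "linear (Q x0)" using lin by (rule eventually_nhds_x_imp_x)
  have "inj (Q x0)" using inj linear_injective_0[OF lin0] by blast
  then obtain L where L: "linear L" "L \<circ> Q x0 = id"
    using linear_injective_left_inverse[OF lin0] by blast
  have LQ: "L (Q x0 w) = w" for w using L(2) by (metis comp_apply id_apply)
  have bL: "bounded_linear L" using L(1) by (simp add: linear_conv_bounded_linear)
  define R where "R x w = L (Q x w) - w" for x w
  define k where "k x = L (P x)" for x
  have R0: "R x0 w = 0" for w by (simp add: R_def LQ)
  have k': "(k has_derivative (\<lambda>u. L (P' u))) (at x0)"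
    unfolding k_def by (rule bounded_linear.has_derivative[OF bL P])
  have R': "((\<lambda>x. R x w) has_derivative (\<lambda>u. L (Q' w u))) (at x0)" for w
    unfolding R_def
    using has_derivative_diff[OF bounded_linear.has_derivative[OF bL Q[of w]] has_derivative_const[of w]]
    by simp
  have expand: "R x w = (\<Sum>b\<in>Basis. (w \<bullet> b) *\<^sub>R R x b)" if "linear (Q x)" for x w
  proof -
    have "linear (R x)"
      unfolding R_def by (intro linear_compose_sub linear_ident linear_compose[OF that L(1), unfolded o_def])
    then have "R x (\<Sum>b\<in>Basis. (w \<bullet> b) *\<^sub>R b) = (\<Sum>b\<in>Basis. (w \<bullet> b) *\<^sub>R R x b)"
      by (simp add: linear_sum linear_cmul)
    then show ?thesis by (simp add: euclidean_representation)
  qed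
  have fix_eq: "\<forall>\<^sub>F x in nhds x0. A x = k x - (\<Sum>b\<in>Basis. (A x \<bullet> b) *\<^sub>R R x b)"
    using lin eq
  proof eventually_elim
    case (elim x)
    have "k x = A x + R x (A x)" by (simp add: k_def R_def flip: elim(2))
    then show ?case using expand[OF elim(1), of "A x"] by (simp add: algebra_simps)
  qed
  have A0: "A x0 = k x0"
    using eventually_nhds_x_imp_x[OF fix_eq] by (simp add: R0)
  define \<rho> where "\<rho> x = (\<Sum>b\<in>Basis. norm (R x b))" for x
  have Rlim: "((\<lambda>x. R x b) \<longlongrightarrow> 0) (at x0)" for b
    using has_derivative_continuous[OF R'[of b]] by (simp add: isCont_def R0)
  have \<rho>lim: "(\<rho> \<longlongrightarrow> 0) (at x0)"
    unfolding \<rho>_def using tendsto_sum[of Basis "\<lambda>b x. norm (R x b)" "\<lambda>b. 0" "at x0"] tendsto_norm_zero[OF Rlim]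
    by simp
  have klim: "(k \<longlongrightarrow> k x0) (at x0)"
    using has_derivative_continuous[OF k'] by (simp add: isCont_def)
  have sum_le: "norm (\<Sum>b\<in>Basis. (A x \<bullet> b) *\<^sub>R R x b) \<le> norm (A x) * \<rho> x" for x
  proof -
    have "norm (\<Sum>b\<in>Basis. (A x \<bullet> b) *\<^sub>R R x b) \<le> (\<Sum>b\<in>Basis. norm (A x) * norm (R x b))"
      by (rule sum_norm_le) (simp add: mult_right_mono Basis_le_norm)
    then show ?thesis by (simp add: \<rho>_def sum_distrib_left)
  qed
  have "\<forall>\<^sub>F x in at x0. \<rho> x < 1 / 2"
    using order_tendstoD(2)[OF \<rho>lim, of "1/2"] by simp
  then have "\<forall>\<^sub>F x in at x0. norm (A x - k x) \<le> 2 * norm (k x) * \<rho> x"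
    using fix_eq[THEN eventually_nhds_conv_at[THEN iffD1], THEN conjunct1]
  proof eventually_elim
    case (elim x)
    have \<rho>0: "\<rho> x \<ge> 0" by (simp add: \<rho>_def sum_nonneg)
    have ak: "norm (A x - k x) \<le> norm (A x) * \<rho> x"
      using sum_le[of x] elim(2) by (metis add_diff_cancel_left' diff_add_cancel norm_minus_commute)
    have "norm (A x) * \<rho> x \<le> norm (A x) * (1 / 2)"
      using elim(1) by (intro mult_left_mono) auto
    then have "norm (A x) \<le> 2 * norm (k x)"
      using ak norm_triangle_ineq2[of "A x" "k x"] by linarith
    then show ?case using ak mult_right_mono[of "norm (A x)" "2 * norm (k x)" "\<rho> x"] \<rho>0 by linarith
  qed
  moreover have "((\<lambda>x. 2 * norm (k x) * \<rho> x) \<longlongrightarrow> 0) (at x0)"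
    using tendsto_mult[OF tendsto_mult[OF tendsto_const[of 2] tendsto_norm[OF klim]] \<rho>lim] by simp
  ultimately have "((\<lambda>x. A x - k x) \<longlongrightarrow> 0) (at x0)"
    by (rule Lim_null_comparison)
  then have Alim: "(A \<longlongrightarrow> A x0) (at x0)"
    using tendsto_add[OF _ klim, of "\<lambda>x. A x - k x" 0] A0 by simp
  have "((\<lambda>x. (A x \<bullet> b - A x0 \<bullet> b) *\<^sub>R R x b) has_derivative (\<lambda>u. 0)) (at x0)" for b
    by (rule has_derivative_null_product[OF _ R' R0])
      (use Alim in \<open>auto intro: tendsto_inner simp: LIM_zero_iff\<close>)
  then have S: "((\<lambda>x. \<Sum>b\<in>Basis. (A x \<bullet> b - A x0 \<bullet> b) *\<^sub>R R x b) has_derivative (\<lambda>u. 0)) (at x0)"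
    using has_derivative_sum[of Basis "\<lambda>b x. (A x \<bullet> b - A x0 \<bullet> b) *\<^sub>R R x b" "\<lambda>b u. 0" "at x0"] by simp
  have D: "((\<lambda>x. k x - (\<Sum>b\<in>Basis. (A x0 \<bullet> b) *\<^sub>R R x b) - (\<Sum>b\<in>Basis. (A x \<bullet> b - A x0 \<bullet> b) *\<^sub>R R x b))
      has_derivative (\<lambda>u. L (P' u) - (\<Sum>b\<in>Basis. (A x0 \<bullet> b) *\<^sub>R L (Q' b u)) - 0)) (at x0)"
    by (intro has_derivative_diff S) (intro has_derivative_sum has_derivative_scaleR_right k' R')+
  have "\<forall>\<^sub>F x in nhds x0. k x - (\<Sum>b\<in>Basis. (A x0 \<bullet> b) *\<^sub>R R x b) - (\<Sum>b\<in>Basis. (A x \<bullet> b - A x0 \<bullet> b) *\<^sub>R R x b) = A x"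
    using fix_eq
    by eventually_elim (simp add: scaleR_diff_left sum_subtractf algebra_simps)
  then have "\<forall>\<^sub>F x in at x0. k x - (\<Sum>b\<in>Basis. (A x0 \<bullet> b) *\<^sub>R R x b) - (\<Sum>b\<in>Basis. (A x \<bullet> b - A x0 \<bullet> b) *\<^sub>R R x b) = A x"
    "k x0 - (\<Sum>b\<in>Basis. (A x0 \<bullet> b) *\<^sub>R R x0 b) - (\<Sum>b\<in>Basis. (A x0 \<bullet> b - A x0 \<bullet> b) *\<^sub>R R x0 b) = A x0"
    using eventually_nhds_x_imp_x by (auto simp: eventually_nhds_conv_at)
  with D have "(A has_derivative
      (\<lambda>u. L (P' u) - (\<Sum>b\<in>Basis. (A x0 \<bullet> b) *\<^sub>R L (Q' b u)) - 0)) (at x0)"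
    by (rule has_derivative_transform_eventually) simp
  then show ?thesis unfolding differentiable_def by blast
qed

section \<open>Charts and tangent vectors\<close>

lemma chart_on_subset: "chart_on X c \<Longrightarrow> cdom c \<subseteq> topspace X"
  by (simp add: chart_on_def openin_subset)

lemma chart_inj_on: "chart_on X c \<Longrightarrow> inj_on (cmap c) (cdom c)"
  using chart_on_subset[of X c] homeomorphic_imp_injective_map[of "subtopology X (cdom c)" _ "cmap c"]
  by (force simp: chart_on_def topspace_subtopology inf_absorb2)

lemma cinv_cmap: "chart_on X c \<Longrightarrow> p \<in> cdom c \<Longrightarrow> cinv c (cmap c p) = p"
  by (simp add: cinv_def chart_inj_on inv_into_f_f)

lemma cmap_cinv: "x \<in> cimg c \<Longrightarrow> cmap c (cinv c x) = x"
  by (simp add: cimg_def cinv_def f_inv_into_f)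

lemma cinv_in: "x \<in> cimg c \<Longrightarrow> cinv c x \<in> cdom c"
  by (simp add: cimg_def cinv_def inv_into_into)

lemma cmap_in: "p \<in> cdom c \<Longrightarrow> cmap c p \<in> cimg c"
  by (simp add: cimg_def)

lemma open_chart_image:
  assumes c: "chart_on X c" and U: "openin X U"
  shows "open (cmap c ` (cdom c \<inter> U))"
proof -
  have "openin (subtopology X (cdom c)) (cdom c \<inter> U)"
    using U by (auto simp: openin_subtopology)
  then have "openin (top_of_set (cimg c)) (cmap c ` (cdom c \<inter> U))"
    using c homeomorphic_imp_open_map[of _ _ "cmap c"] by (auto simp: chart_on_def open_map_def)
  then show ?thesis
    using c openin_open_trans by (auto simp: chart_on_def)
qed

lemma openin_chart_preimage:
  assumes c: "chart_on X c" and W: "open W"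
  shows "openin X {q \<in> cdom c. cmap c q \<in> W}"
proof -
  have "continuous_map (subtopology X (cdom c)) (top_of_set (cimg c)) (cmap c)"
    using c homeomorphic_imp_continuous_map by (auto simp: chart_on_def)
  moreover have "openin (top_of_set (cimg c)) (cimg c \<inter> W)"
    using W by (simp add: openin_open_Int)
  ultimately have "openin (subtopology X (cdom c)) {q \<in> topspace (subtopology X (cdom c)). cmap c q \<in> cimg c \<inter> W}"
    by (rule openin_continuous_map_preimage)
  moreover have "{q \<in> topspace (subtopology X (cdom c)). cmap c q \<in> cimg c \<inter> W} = {q \<in> cdom c. cmap c q \<in> W}"
    using chart_on_subset[OF c] by (auto simp: cmap_in)
  ultimately show ?thesis
    using c openin_trans_full by (fastforce simp: chart_on_def)
qed

text \<open>Statements about points near \<open>p\<close> are transferred in this form to coordinates near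
  \<open>cmap c p\<close>.\<close>

lemma eventually_chart:
  assumes c: "chart_on X c" and p: "p \<in> cdom c" and U: "openin X U" "p \<in> U"
  shows "\<forall>\<^sub>F x in nhds (cmap c p). x \<in> cimg c \<and> cinv c x \<in> U"
proof -
  have "open (cmap c ` (cdom c \<inter> U))" "cmap c p \<in> cmap c ` (cdom c \<inter> U)"
    using open_chart_image[OF c U(1)] p U(2) by auto
  moreover have "x \<in> cimg c \<and> cinv c x \<in> U" if "x \<in> cmap c ` (cdom c \<inter> U)" for x
    using that cinv_cmap[OF c] by (auto simp: cmap_in)
  ultimately show ?thesis
    unfolding eventually_nhds by blast
qed

lemma eventually_chart_map:
  assumes c: "chart_on X c" and p: "p \<in> cdom c" and f: "continuous_map X Y f"
    and V: "openin Y V" "f p \<in> V"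
  shows "\<forall>\<^sub>F x in nhds (cmap c p). x \<in> cimg c \<and> f (cinv c x) \<in> V"
proof -
  have "\<forall>\<^sub>F x in nhds (cmap c p). x \<in> cimg c \<and> cinv c x \<in> {q \<in> topspace X. f q \<in> V}"
    using p V(2) chart_on_subset[OF c]
    by (intro eventually_chart[OF c p openin_continuous_map_preimage[OF f V(1)]]) auto
  then show ?thesis by (auto elim!: eventually_mono)
qed

lemma isCont_chart_map:
  assumes c: "chart_on X c" and p: "p \<in> cdom c" and f: "continuous_map X Y f"
    and d: "chart_on Y d" and fp: "f p \<in> cdom d"
  shows "isCont (cmap d \<circ> f \<circ> cinv c) (cmap c p)"
  unfolding isCont_def
proof (rule topological_tendstoI)
  fix W assume W: "open W" "(cmap d \<circ> f \<circ> cinv c) (cmap c p) \<in> W"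
  have "\<forall>\<^sub>F x in nhds (cmap c p). x \<in> cimg c \<and> f (cinv c x) \<in> {q \<in> cdom d. cmap d q \<in> W}"
    using W fp cinv_cmap[OF c p] by (intro eventually_chart_map[OF c p f openin_chart_preimage[OF d]]) auto
  then have "\<forall>\<^sub>F x in nhds (cmap c p). (cmap d \<circ> f \<circ> cinv c) x \<in> W"
    by (rule eventually_mono) auto
  then show "\<forall>\<^sub>F x in at (cmap c p). (cmap d \<circ> f \<circ> cinv c) x \<in> W"
    by (simp add: eventually_nhds_conv_at)
qed

lemma has_derivative_cong_nhds:
  assumes "\<forall>\<^sub>F x in nhds x0. f x = g x" "(g has_derivative D) (at x0)"
  shows "(f has_derivative D) (at x0)"
proof (rule has_derivative_transform_eventually[OF assms(2)])
  show "\<forall>\<^sub>F x in at x0. g x = f x"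
    using assms(1) by (auto simp: eventually_nhds_conv_at elim: eventually_mono)
  show "g x0 = f x0" using eventually_nhds_x_imp_x[OF assms(1)] by simp
qed simp

lemma frechet_derivative_eqI: "(f has_derivative D) (at x) \<Longrightarrow> frechet_derivative f (at x) = D"
  using frechet_derivative_at by metis

text \<open>The coordinate expression of a composition agrees only near the point with the composition
  of the coordinate expressions through the middle chart \<open>d\<close>.\<close>

lemma chart_chain_rule:
  assumes c: "chart_on X c" and p: "p \<in> cdom c" and f: "continuous_map X Y f"
    and d: "chart_on Y d" and fp: "f p \<in> cdom d"
    and A: "((cmap d \<circ> f \<circ> cinv c) has_derivative A) (at (cmap c p))"
    and B: "((cmap e \<circ> h \<circ> cinv d) has_derivative B) (at (cmap d (f p)))"
  shows "((cmap e \<circ> (h \<circ> f) \<circ> cinv c) has_derivative (\<lambda>u. B (A u))) (at (cmap c p))"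
proof (rule has_derivative_cong_nhds)
  have "((cmap e \<circ> h \<circ> cinv d) has_derivative B) (at ((cmap d \<circ> f \<circ> cinv c) (cmap c p)))"
    using B cinv_cmap[OF c p] by simp
  from has_derivative_compose[OF A this]
  show "((\<lambda>x. (cmap e \<circ> h \<circ> cinv d) ((cmap d \<circ> f \<circ> cinv c) x)) has_derivative (\<lambda>u. B (A u))) (at (cmap c p))" .
  have "openin Y (cdom d)" using d by (simp add: chart_on_def)
  then show "\<forall>\<^sub>F x in nhds (cmap c p). (cmap e \<circ> (h \<circ> f) \<circ> cinv c) x
      = (cmap e \<circ> h \<circ> cinv d) ((cmap d \<circ> f \<circ> cinv c) x)"
    using eventually_chart_map[OF c p f, of "cdom d"] fp
    by (auto elim!: eventually_mono simp: cinv_cmap[OF d])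
qed

lemma chart_id_derivative:
  assumes c: "chart_on X c" and p: "p \<in> cdom c"
  shows "((cmap c \<circ> cinv c) has_derivative (\<lambda>u. u)) (at (cmap c p))"
proof (rule has_derivative_cong_nhds)
  have "openin X (cdom c)" using c by (simp add: chart_on_def)
  then show "\<forall>\<^sub>F x in nhds (cmap c p). (cmap c \<circ> cinv c) x = x"
    using eventually_chart[OF c p, of "cdom c"] p by (auto elim!: eventually_mono simp: cmap_cinv)
qed (rule has_derivative_ident)

section \<open>Tangent vectors in coordinates\<close>

text \<open>The part of the manifold axioms that makes tangent vectors at \<open>p\<close> correspond to component
  vectors.  It holds everywhere in a smooth manifold, and at every point of an embedded group.\<close>

definition charts_differentiable_at :: "('a, 'e::euclidean_space) manifold \<Rightarrow> 'a \<Rightarrow> bool" where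
  "charts_differentiable_at M p \<longleftrightarrow> (\<forall>c\<in>charts_at M p. chart_on (mtop M) c \<and>
     (\<forall>d\<in>charts_at M p. (cmap d \<circ> cinv c) differentiable (at (cmap c p))))"

abbreviation transition :: "('a, 'e::euclidean_space) chart \<Rightarrow> ('a, 'e) chart \<Rightarrow> 'a \<Rightarrow> 'e \<Rightarrow> 'e" where
  "transition c d p \<equiv> frechet_derivative (cmap d \<circ> cinv c) (at (cmap c p))"

lemma charts_atD: "c \<in> charts_at M p \<Longrightarrow> p \<in> cdom c"
  by (simp add: charts_at_def)

lemma transition_derivative:
  assumes "charts_differentiable_at M p" "c \<in> charts_at M p" "d \<in> charts_at M p"
  shows "((cmap d \<circ> cinv c) has_derivative transition c d p) (at (cmap c p))"
  using assms by (metis charts_differentiable_at_def frechet_derivative_works)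

lemma chart_onI: "charts_differentiable_at M p \<Longrightarrow> c \<in> charts_at M p \<Longrightarrow> chart_on (mtop M) c"
  by (simp add: charts_differentiable_at_def)

lemma transition_self:
  assumes "charts_differentiable_at M p" "c \<in> charts_at M p"
  shows "transition c c p = (\<lambda>u. u)"
  using frechet_derivative_eqI[OF chart_id_derivative[OF chart_onI[OF assms] charts_atD[OF assms(2)]]] .

lemma transition_trans:
  assumes M: "charts_differentiable_at M p" and c: "c \<in> charts_at M p" and d: "d \<in> charts_at M p"
    and e: "e \<in> charts_at M p"
  shows "transition d e p (transition c d p u) = transition c e p u"
proof -
  note chart = chart_onI[OF M c] charts_atD[OF c]
  have "((cmap e \<circ> (id \<circ> id) \<circ> cinv c) has_derivative (\<lambda>u. transition d e p (transition c d p u))) (at (cmap c p))"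
    using chart_chain_rule[OF chart continuous_map_id chart_onI[OF M d], of "transition c d p" e id "transition d e p"]
      transition_derivative[OF M c d] transition_derivative[OF M d e] charts_atD[OF d] by simp
  then have "transition c e p = (\<lambda>u. transition d e p (transition c d p u))"
    using frechet_derivative_eqI by simp
  then show ?thesis by simp
qed

lemma linear_transition:
  assumes "charts_differentiable_at M p" "c \<in> charts_at M p" "d \<in> charts_at M p"
  shows "linear (transition c d p)"
  using transition_derivative[OF assms] by (simp add: has_derivative_bounded_linear bounded_linear.linear)

context
  fixes M :: "('a, 'e::euclidean_space) manifold" and p c
  assumes M: "charts_differentiable_at M p" and c: "c \<in> charts_at M p"
begin

lemma coord_vec_in: "coord_vec M c u p \<in> tangent_space M p"
  using transition_trans[OF M c] by (auto simp: tangent_space_def coord_vec_def)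

lemma coord_vec_component: "coord_vec M c u p c = u"
  using transition_self[OF M c] c by (simp add: coord_vec_def)

lemma coord_vec_eq: "v \<in> tangent_space M p \<Longrightarrow> coord_vec M c (v c) p = v"
proof
  fix d assume v: "v \<in> tangent_space M p"
  show "coord_vec M c (v c) p d = v d"
  proof (cases "d \<in> charts_at M p")
    case True
    then have "v d = transition c d p (v c)"
      using v c unfolding tangent_space_def by blast
    then show ?thesis using True by (simp only: coord_vec_def if_True)
  next
    case False
    then have "v d = 0" using v unfolding tangent_space_def by blast
    then show ?thesis using False by (simp only: coord_vec_def if_False)
  qed
qed

lemma tangent_eqI: "v \<in> tangent_space M p \<Longrightarrow> w \<in> tangent_space M p \<Longrightarrow> v c = w c \<Longrightarrow> v = w"
  by (metis coord_vec_eq)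

lemma coord_vec_add: "coord_vec M c (u + w) p = tv_add (coord_vec M c u p) (coord_vec M c w p)"
  using linear_transition[OF M c] by (auto simp: coord_vec_def tv_add_def fun_eq_iff linear_add)

lemma coord_vec_scale: "coord_vec M c (r *\<^sub>R u) p = tv_scale r (coord_vec M c u p)"
  using linear_transition[OF M c] by (auto simp: coord_vec_def tv_scale_def fun_eq_iff linear_cmul)

end

lemma tangent_map_coord:
  assumes M: "charts_differentiable_at M p" and N: "charts_differentiable_at N (f p)"
    and c: "c = (SOME c. c \<in> charts_at M p)" "c \<in> charts_at M p" and d: "d \<in> charts_at N (f p)"
    and f: "continuous_map (mtop M) (mtop N) f"
    and D: "((cmap d \<circ> f \<circ> cinv c) has_derivative D) (at (cmap c p))"
  shows "tangent_map M N f p v = coord_vec N d (D (v c)) (f p)"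
proof
  fix e
  show "tangent_map M N f p v e = coord_vec N d (D (v c)) (f p) e"
  proof (cases "e \<in> charts_at N (f p)")
    case True
    have "((cmap e \<circ> (id \<circ> f) \<circ> cinv c) has_derivative (\<lambda>u. transition d e (f p) (D u))) (at (cmap c p))"
      using chart_chain_rule[OF chart_onI[OF M c(2)] charts_atD[OF c(2)] f chart_onI[OF N d] charts_atD[OF d] D,
          of e id] transition_derivative[OF N d True] by simp
    then show ?thesis
      using True frechet_derivative_eqI[of "cmap e \<circ> f \<circ> cinv c"]
      by (simp add: tangent_map_def coord_vec_def c(1)[symmetric])
  next
    case False
    then show ?thesis by (simp add: tangent_map_def coord_vec_def Let_def)
  qed
qed

context smooth_manifold
begin

lemma atlas_chart: "p \<in> topspace (mtop M) \<Longrightarrow> \<exists>c. c \<in> charts_at M p"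
  unfolding charts_at_def using charts_cover by blast

lemma charts_differentiable: "charts_differentiable_at M p"
  unfolding charts_differentiable_at_def
proof (intro ballI conjI)
  fix c d assume c: "c \<in> charts_at M p" and d: "d \<in> charts_at M p"
  show cc: "chart_on (mtop M) c" using c charts by (simp add: charts_at_def)
  have "chart_on (mtop M) d" using d charts by (simp add: charts_at_def)
  then have "open (cmap c ` (cdom c \<inter> cdom d))"
    by (intro open_chart_image[OF cc]) (simp add: chart_on_def)
  moreover have "c \<in> atlas M" "d \<in> atlas M" "cmap c p \<in> cmap c ` (cdom c \<inter> cdom d)"
    using c d by (auto simp: charts_at_def)
  ultimately show "(cmap d \<circ> cinv c) differentiable (at (cmap c p))"
    unfolding differentiable_def using smooth_on_has_derivative[OF charts_compatible] by blast
qed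

end

section \<open>Lie groups in coordinates\<close>

lemma linear_has_derivative: "(f has_derivative f') F \<Longrightarrow> linear f'"
  by (simp add: has_derivative_bounded_linear bounded_linear.linear)

context lie_group
begin

lemma in_chart_carrier: "c \<in> atlas M \<Longrightarrow> p \<in> cdom c \<Longrightarrow> p \<in> carrier G"
  using charts chart_on_subset carrier_eq by blast

lemma continuous_mult: "continuous_map (prod_topology (mtop M) (mtop M)) (mtop M) (\<lambda>(a, b). a \<otimes> b)"
  using smooth_mult by (simp add: smooth_map_def prod_manifold_def)

lemma continuous_left_translation:
  assumes "a \<in> carrier G" shows "continuous_map (mtop M) (mtop M) (left_translation G a)"
proof -
  have "continuous_map (mtop M) (prod_topology (mtop M) (mtop M)) (\<lambda>x. (a, x))"
    using assms by (intro continuous_map_pairedI) (simp_all add: carrier_eq)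
  from continuous_map_compose[OF this continuous_mult] show ?thesis
    by (simp add: left_translation_def o_def)
qed

lemma continuous_right_translation:
  assumes "a \<in> carrier G" shows "continuous_map (mtop M) (mtop M) (right_translation G a)"
proof -
  have "continuous_map (mtop M) (prod_topology (mtop M) (mtop M)) (\<lambda>x. (x, a))"
    using assms by (intro continuous_map_pairedI) (simp_all add: carrier_eq)
  from continuous_map_compose[OF this continuous_mult] show ?thesis
    by (simp add: right_translation_def o_def)
qed

definition mult_dom :: "('a, 'e) chart \<Rightarrow> ('a, 'e) chart \<Rightarrow> ('a, 'e) chart \<Rightarrow> ('e \<times> 'e) set" where
  "mult_dom a b d = {z. fst z \<in> cimg a \<and> snd z \<in> cimg b \<and> cinv a (fst z) \<otimes> cinv b (snd z) \<in> cdom d}"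

text \<open>The multiplication in coordinates, in the shape in which the smoothness axiom speaks of it.\<close>

definition mult_chart :: "('a, 'e) chart \<Rightarrow> ('a, 'e) chart \<Rightarrow> ('a, 'e) chart \<Rightarrow> 'e \<times> 'e \<Rightarrow> 'e" where
  "mult_chart a b d = cmap d \<circ> (\<lambda>(x, y). x \<otimes> y) \<circ> cinv (cdom a \<times> cdom b, map_prod (cmap a) (cmap b))"

abbreviation mult_deriv :: "('a, 'e) chart \<Rightarrow> ('a, 'e) chart \<Rightarrow> ('a, 'e) chart \<Rightarrow> 'e \<times> 'e \<Rightarrow> 'e \<times> 'e \<Rightarrow> 'e" where
  "mult_deriv a b d z \<equiv> frechet_derivative (mult_chart a b d) (at z)"

lemma cinv_prod_chart:
  assumes "a \<in> atlas M" "b \<in> atlas M" "x \<in> cimg a" "y \<in> cimg b"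
  shows "cinv (cdom a \<times> cdom b, map_prod (cmap a) (cmap b)) (x, y) = (cinv a x, cinv b y)"
proof -
  have "inj_on (map_prod (cmap a) (cmap b)) (cdom a \<times> cdom b)"
    using assms chart_inj_on[OF charts] by (intro map_prod_inj_on) auto
  moreover have "(cinv a x, cinv b y) \<in> cdom a \<times> cdom b"
    "map_prod (cmap a) (cmap b) (cinv a x, cinv b y) = (x, y)"
    using assms by (simp_all add: cinv_in cmap_cinv)
  ultimately show ?thesis
    unfolding cinv_def[of "(cdom a \<times> cdom b, map_prod (cmap a) (cmap b))"]
    by (simp only: fst_conv snd_conv inv_into_f_eq)
qed

lemma mult_chart_eq:
  assumes "a \<in> atlas M" "b \<in> atlas M" "x \<in> cimg a" "y \<in> cimg b"
  shows "mult_chart a b d (x, y) = cmap d (cinv a x \<otimes> cinv b y)"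
  by (simp add: mult_chart_def cinv_prod_chart[OF assms])

lemma mult_dom_image:
  assumes "a \<in> atlas M" "b \<in> atlas M"
  shows "map_prod (cmap a) (cmap b) ` {p \<in> cdom a \<times> cdom b. (case p of (x, y) \<Rightarrow> x \<otimes> y) \<in> cdom d} = mult_dom a b d"
proof
  show "map_prod (cmap a) (cmap b) ` {p \<in> cdom a \<times> cdom b. (case p of (x, y) \<Rightarrow> x \<otimes> y) \<in> cdom d} \<subseteq> mult_dom a b d"
    using cinv_cmap[OF charts[OF assms(1)]] cinv_cmap[OF charts[OF assms(2)]]
    by (auto simp: mult_dom_def cmap_in)
  show "mult_dom a b d \<subseteq> map_prod (cmap a) (cmap b) ` {p \<in> cdom a \<times> cdom b. (case p of (x, y) \<Rightarrow> x \<otimes> y) \<in> cdom d}"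
  proof
    fix z assume z: "z \<in> mult_dom a b d"
    then have eq: "z = map_prod (cmap a) (cmap b) (cinv a (fst z), cinv b (snd z))"
      by (simp add: mult_dom_def cmap_cinv)
    show "z \<in> map_prod (cmap a) (cmap b) ` {p \<in> cdom a \<times> cdom b. (case p of (x, y) \<Rightarrow> x \<otimes> y) \<in> cdom d}"
      by (rule image_eqI[where f = "map_prod (cmap a) (cmap b)" and x = "(cinv a (fst z), cinv b (snd z))", OF eq])
        (use z in \<open>simp add: mult_dom_def cinv_in\<close>)
  qed
qed

lemma smooth_mult_chart:
  assumes "a \<in> atlas M" "b \<in> atlas M" "d \<in> atlas M"
  shows "smooth_on (mult_dom a b d) (mult_chart a b d)"
proof -
  let ?P = "(cdom a \<times> cdom b, map_prod (cmap a) (cmap b))"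
  have "?P \<in> atlas (prod_manifold M M)"
  proof -
    have "?P \<in> {(cdom c \<times> cdom d, map_prod (cmap c) (cmap d)) |c d. c \<in> atlas M \<and> d \<in> atlas M}"
      using assms by blast
    then show ?thesis by (simp only: prod_manifold_def manifold.simps)
  qed
  then have "smooth_on (cmap ?P ` {p \<in> cdom ?P. (case p of (x, y) \<Rightarrow> x \<otimes> y) \<in> cdom d}) (mult_chart a b d)"
    using smooth_mult assms(3) unfolding smooth_map_def mult_chart_def by blast
  then show ?thesis
    using mult_dom_image[OF assms(1,2)] by simp
qed

text \<open>Continuity of the multiplication provides a product neighbourhood, whose image under the
  charts is open.\<close>

lemma open_mult_dom:
  assumes "a \<in> atlas M" "b \<in> atlas M" "d \<in> atlas M"
  shows "open (mult_dom a b d)"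
  unfolding open_prod_def
proof
  fix z assume z: "z \<in> mult_dom a b d"
  have cs: "chart_on (mtop M) a" "chart_on (mtop M) b" "chart_on (mtop M) d"
    using assms charts by auto
  let ?p = "cinv a (fst z)" and ?q = "cinv b (snd z)"
  have pq: "?p \<in> cdom a" "?q \<in> cdom b" "?p \<otimes> ?q \<in> cdom d"
    using z by (auto simp: mult_dom_def cinv_in)
  define S where "S = {u \<in> topspace (prod_topology (mtop M) (mtop M)). (case u of (x, y) \<Rightarrow> x \<otimes> y) \<in> cdom d}"
  have S: "openin (prod_topology (mtop M) (mtop M)) S"
    unfolding S_def
    using cs(3) by (intro openin_continuous_map_preimage[OF continuous_mult]) (simp add: chart_on_def)
  have mem: "(?p, ?q) \<in> S"
    using pq chart_on_subset[OF cs(1)] chart_on_subset[OF cs(2)] by (auto simp: S_def)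
  obtain U V where UV: "openin (mtop M) U" "openin (mtop M) V" "?p \<in> U" "?q \<in> V" "U \<times> V \<subseteq> S"
    using S[unfolded openin_prod_topology_alt, rule_format, OF mem] by metis
  let ?A = "cmap a ` (cdom a \<inter> U)" and ?B = "cmap b ` (cdom b \<inter> V)"
  have "open ?A" "open ?B"
    using open_chart_image[OF cs(1) UV(1)] open_chart_image[OF cs(2) UV(2)] by simp_all
  moreover have "cmap a ?p \<in> ?A" "cmap b ?q \<in> ?B"
    using pq UV by blast+
  then have "fst z \<in> ?A" "snd z \<in> ?B"
    using z by (simp_all add: mult_dom_def cmap_cinv)
  then have "z \<in> ?A \<times> ?B" by (simp add: mem_Times_iff)
  moreover have "?A \<times> ?B \<subseteq> mult_dom a b d"
  proof clarify
    fix p q assume pq': "p \<in> cdom a" "p \<in> U" "q \<in> cdom b" "q \<in> V"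
    then have "(p, q) \<in> S" using UV(5) by blast
    then show "(cmap a p, cmap b q) \<in> mult_dom a b d"
      using pq' by (simp add: S_def mult_dom_def cmap_in cinv_cmap[OF cs(1)] cinv_cmap[OF cs(2)])
  qed
  ultimately show "\<exists>A B. open A \<and> open B \<and> z \<in> A \<times> B \<and> A \<times> B \<subseteq> mult_dom a b d" by blast
qed

lemma mult_chart_derivative:
  assumes "a \<in> atlas M" "b \<in> atlas M" "d \<in> atlas M" "z \<in> mult_dom a b d"
  shows "(mult_chart a b d has_derivative mult_deriv a b d z) (at z)"
  using smooth_on_has_derivative[OF smooth_mult_chart open_mult_dom] assms by blast

lemma left_translation_derivative:
  assumes a: "a \<in> charts_at M p" and b: "b \<in> charts_at M q" and d: "d \<in> charts_at M (p \<otimes> q)"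
  shows "((cmap d \<circ> left_translation G p \<circ> cinv b) has_derivative
    (\<lambda>w. mult_deriv a b d (cmap a p, cmap b q) (0, w))) (at (cmap b q))"
proof (rule has_derivative_cong_nhds)
  have A: "a \<in> atlas M" "b \<in> atlas M" "d \<in> atlas M" "p \<in> cdom a" "q \<in> cdom b" "p \<otimes> q \<in> cdom d"
    using assms by (auto simp: charts_at_def)
  note cc = cinv_cmap[OF charts[OF A(1)] A(4)] cinv_cmap[OF charts[OF A(2)] A(5)]
  have "(cmap a p, cmap b q) \<in> mult_dom a b d"
    using A cc by (simp add: mult_dom_def cmap_in)
  note D = mult_chart_derivative[OF A(1-3) this]
  have "((\<lambda>y. (cmap a p, y)) has_derivative (\<lambda>w. (0, w))) (at (cmap b q))"
    by (intro has_derivative_Pair has_derivative_const has_derivative_ident)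
  from has_derivative_compose[OF this D]
  show "((\<lambda>y. mult_chart a b d (cmap a p, y)) has_derivative
    (\<lambda>w. mult_deriv a b d (cmap a p, cmap b q) (0, w))) (at (cmap b q))" .
  have "\<forall>\<^sub>F y in nhds (cmap b q). y \<in> cimg b \<and> cinv b y \<in> cdom b"
    using charts[OF A(2)] A(5) by (intro eventually_chart) (auto simp: chart_on_def)
  then show "\<forall>\<^sub>F y in nhds (cmap b q). (cmap d \<circ> left_translation G p \<circ> cinv b) y = mult_chart a b d (cmap a p, y)"
    using A cc by (auto elim!: eventually_mono simp: mult_chart_eq cmap_in left_translation_def)
qed

lemma right_translation_derivative:
  assumes a: "a \<in> charts_at M p" and b: "b \<in> charts_at M q" and d: "d \<in> charts_at M (p \<otimes> q)"
  shows "((cmap d \<circ> right_translation G q \<circ> cinv a) has_derivative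
    (\<lambda>w. mult_deriv a b d (cmap a p, cmap b q) (w, 0))) (at (cmap a p))"
proof (rule has_derivative_cong_nhds)
  have A: "a \<in> atlas M" "b \<in> atlas M" "d \<in> atlas M" "p \<in> cdom a" "q \<in> cdom b" "p \<otimes> q \<in> cdom d"
    using assms by (auto simp: charts_at_def)
  note cc = cinv_cmap[OF charts[OF A(1)] A(4)] cinv_cmap[OF charts[OF A(2)] A(5)]
  have "(cmap a p, cmap b q) \<in> mult_dom a b d"
    using A cc by (simp add: mult_dom_def cmap_in)
  note D = mult_chart_derivative[OF A(1-3) this]
  have "((\<lambda>x. (x, cmap b q)) has_derivative (\<lambda>w. (w, 0))) (at (cmap a p))"
    by (intro has_derivative_Pair has_derivative_const has_derivative_ident)
  from has_derivative_compose[OF this D]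
  show "((\<lambda>x. mult_chart a b d (x, cmap b q)) has_derivative
    (\<lambda>w. mult_deriv a b d (cmap a p, cmap b q) (w, 0))) (at (cmap a p))" .
  have "\<forall>\<^sub>F x in nhds (cmap a p). x \<in> cimg a \<and> cinv a x \<in> cdom a"
    using charts[OF A(1)] A(4) by (intro eventually_chart) (auto simp: chart_on_def)
  then show "\<forall>\<^sub>F x in nhds (cmap a p). (cmap d \<circ> right_translation G q \<circ> cinv a) x = mult_chart a b d (x, cmap b q)"
    using A cc by (auto elim!: eventually_mono simp: mult_chart_eq cmap_in right_translation_def)
qed

end

text \<open>A chart around the identity, whose coordinates there are \<open>e0\<close>.\<close>

locale lie_group_chart = lie_group G M
  for G :: "'a monoid" (structure) and M :: "('a, 'e::euclidean_space) manifold" +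
  fixes c :: "('a, 'e) chart" and e0 :: 'e
  assumes c_at_one: "c \<in> charts_at M \<one>" and e0_def: "e0 = cmap c \<one>"
begin

lemma c_atlas: "c \<in> atlas M" and one_in_c: "\<one> \<in> cdom c"
  using c_at_one by (auto simp: charts_at_def)

lemma chart_c: "chart_on (mtop M) c"
  using c_atlas charts by blast

lemma e0_in: "e0 \<in> cimg c" and cinv_e0: "cinv c e0 = \<one>"
  using one_in_c by (simp_all add: e0_def cmap_in cinv_cmap[OF chart_c])

lemma cinv_carrier: "x \<in> cimg c \<Longrightarrow> cinv c x \<in> carrier G"
  by (rule in_chart_carrier[OF c_atlas cinv_in])

lemma c_at_cinv: "x \<in> cimg c \<Longrightarrow> c \<in> charts_at M (cinv c x)"
  by (simp add: charts_at_def c_atlas cinv_in)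

lemma eventually_cimg: "\<forall>\<^sub>F x in nhds e0. x \<in> cimg c"
  using chart_c e0_in by (auto simp: chart_on_def eventually_nhds)

definition left_diff :: "'e \<Rightarrow> 'e \<Rightarrow> 'e" where
  "left_diff x w = frechet_derivative (cmap c \<circ> left_translation G (cinv c x) \<circ> cinv c) (at e0) w"

definition right_diff :: "'e \<Rightarrow> 'e \<Rightarrow> 'e" where
  "right_diff x w = frechet_derivative (cmap c \<circ> right_translation G (cinv c x) \<circ> cinv c) (at e0) w"

lemma left_diff_derivative:
  assumes x: "x \<in> cimg c"
  shows "((cmap c \<circ> left_translation G (cinv c x) \<circ> cinv c) has_derivative left_diff x) (at e0)"
    and "left_diff x w = mult_deriv c c c (x, e0) (0, w)"
proof -
  have "c \<in> charts_at M (cinv c x \<otimes> \<one>)"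
    using c_at_cinv[OF x] cinv_carrier[OF x] by simp
  from left_translation_derivative[OF c_at_cinv[OF x] c_at_one this]
  have D: "((cmap c \<circ> left_translation G (cinv c x) \<circ> cinv c) has_derivative
    (\<lambda>w. mult_deriv c c c (x, e0) (0, w))) (at e0)"
    by (simp add: cmap_cinv[OF x] e0_def)
  then have "left_diff x = (\<lambda>w. mult_deriv c c c (x, e0) (0, w))"
    unfolding left_diff_def by (simp only: frechet_derivative_eqI)
  with D show "((cmap c \<circ> left_translation G (cinv c x) \<circ> cinv c) has_derivative left_diff x) (at e0)"
    and "left_diff x w = mult_deriv c c c (x, e0) (0, w)" by simp_all
qed

lemma right_diff_derivative:
  assumes x: "x \<in> cimg c"
  shows "((cmap c \<circ> right_translation G (cinv c x) \<circ> cinv c) has_derivative right_diff x) (at e0)"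
    and "right_diff x w = mult_deriv c c c (e0, x) (w, 0)"
proof -
  have "c \<in> charts_at M (\<one> \<otimes> cinv c x)"
    using c_at_cinv[OF x] cinv_carrier[OF x] by simp
  from right_translation_derivative[OF c_at_one c_at_cinv[OF x] this]
  have D: "((cmap c \<circ> right_translation G (cinv c x) \<circ> cinv c) has_derivative
    (\<lambda>w. mult_deriv c c c (e0, x) (w, 0))) (at e0)"
    by (simp add: cmap_cinv[OF x] e0_def)
  then have "right_diff x = (\<lambda>w. mult_deriv c c c (e0, x) (w, 0))"
    unfolding right_diff_def by (simp only: frechet_derivative_eqI)
  with D show "((cmap c \<circ> right_translation G (cinv c x) \<circ> cinv c) has_derivative right_diff x) (at e0)"
    and "right_diff x w = mult_deriv c c c (e0, x) (w, 0)" by simp_all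
qed

lemma linear_right_diff: "x \<in> cimg c \<Longrightarrow> linear (right_diff x)"
  by (rule linear_has_derivative[OF right_diff_derivative(1)])

lemma left_diff_e0: "left_diff e0 w = w"
proof -
  have "((cmap c \<circ> left_translation G (cinv c e0) \<circ> cinv c) has_derivative (\<lambda>u. u)) (at e0)"
  proof (rule has_derivative_cong_nhds)
    show "\<forall>\<^sub>F x in nhds e0. (cmap c \<circ> left_translation G (cinv c e0) \<circ> cinv c) x = x"
      using eventually_cimg
      by (rule eventually_mono) (simp add: left_translation_def cinv_e0 cinv_carrier cmap_cinv)
  qed (rule has_derivative_ident)
  then show ?thesis unfolding left_diff_def by (simp only: frechet_derivative_eqI)
qed

lemma right_diff_e0: "right_diff e0 w = w"
proof -
  have "((cmap c \<circ> right_translation G (cinv c e0) \<circ> cinv c) has_derivative (\<lambda>u. u)) (at e0)"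
  proof (rule has_derivative_cong_nhds)
    show "\<forall>\<^sub>F x in nhds e0. (cmap c \<circ> right_translation G (cinv c e0) \<circ> cinv c) x = x"
      using eventually_cimg
      by (rule eventually_mono) (simp add: right_translation_def cinv_e0 cinv_carrier cmap_cinv)
  qed (rule has_derivative_ident)
  then show ?thesis unfolding right_diff_def by (simp only: frechet_derivative_eqI)
qed

text \<open>The mixed second derivative of the multiplication at the identity, with \<open>u\<close> in the first
  factor and \<open>w\<close> in the second.\<close>

definition mult_second :: "'e \<Rightarrow> 'e \<Rightarrow> 'e" where
  "mult_second u w = frechet_derivative (\<lambda>x. left_diff x w) (at e0) u"

lemma e0_mult_dom: "(e0, e0) \<in> mult_dom c c c"
  using e0_in one_in_c by (simp add: mult_dom_def cinv_e0)

lemma mult_deriv_differentiable: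
  obtains H where "((\<lambda>z. mult_deriv c c c z v) has_derivative H) (at (e0, e0))"
  using smooth_on_derivative_differentiable[OF smooth_mult_chart open_mult_dom e0_mult_dom] c_atlas
  unfolding differentiable_def by blast

lemma left_diff_second:
  assumes H: "((\<lambda>z. mult_deriv c c c z (0, w)) has_derivative H) (at (e0, e0))"
  shows "((\<lambda>x. left_diff x w) has_derivative (\<lambda>u. H (u, 0))) (at e0)"
proof (rule has_derivative_cong_nhds)
  show "\<forall>\<^sub>F x in nhds e0. left_diff x w = mult_deriv c c c (x, e0) (0, w)"
    using eventually_cimg by (rule eventually_mono) (rule left_diff_derivative(2))
  have "((\<lambda>x. (x, e0)) has_derivative (\<lambda>w. (w, 0))) (at e0)"
    by (intro has_derivative_Pair has_derivative_const has_derivative_ident)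
  from has_derivative_compose[OF this H]
  show "((\<lambda>x. mult_deriv c c c (x, e0) (0, w)) has_derivative (\<lambda>u. H (u, 0))) (at e0)" .
qed

lemma mult_second_derivative: "((\<lambda>x. left_diff x w) has_derivative (\<lambda>u. mult_second u w)) (at e0)"
proof -
  obtain H where "((\<lambda>z. mult_deriv c c c z (0, w)) has_derivative H) (at (e0, e0))"
    using mult_deriv_differentiable .
  from left_diff_second[OF this] show ?thesis
    unfolding mult_second_def by (simp only: frechet_derivative_eqI)
qed

text \<open>Differentiating right translations gives the same mixed derivative with the arguments
  exchanged, as the order of differentiation is immaterial.\<close>

lemma right_diff_second: "((\<lambda>x. right_diff x w) has_derivative (\<lambda>u. mult_second w u)) (at e0)"
proof (rule has_derivative_cong_nhds)
  show "\<forall>\<^sub>F x in nhds e0. right_diff x w = mult_deriv c c c (e0, x) (w, 0)"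
    using eventually_cimg by (rule eventually_mono) (rule right_diff_derivative(2))
  obtain H where H: "((\<lambda>z. mult_deriv c c c z (w, 0)) has_derivative H) (at (e0, e0))"
    using mult_deriv_differentiable .
  have eq: "H (0, u) = mult_second w u" for u
  proof -
    obtain K where K: "((\<lambda>z. mult_deriv c c c z (0, u)) has_derivative K) (at (e0, e0))"
      using mult_deriv_differentiable .
    have "mult_second w u = K (w, 0)"
      unfolding mult_second_def by (simp only: frechet_derivative_eqI[OF left_diff_second[OF K]])
    also have "\<dots> = H (0, u)"
      by (rule mixed_derivatives_eq[OF open_mult_dom e0_mult_dom mult_chart_derivative K H])
        (simp_all add: c_atlas)
    finally show ?thesis ..
  qed
  have "((\<lambda>x. (e0, x)) has_derivative (\<lambda>w. (0, w))) (at e0)"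
    by (intro has_derivative_Pair has_derivative_const has_derivative_ident)
  from has_derivative_compose[OF this H]
  show "((\<lambda>x. mult_deriv c c c (e0, x) (w, 0)) has_derivative (\<lambda>u. mult_second w u)) (at e0)"
    by (simp only: eq)
qed

definition bracket :: "'e \<Rightarrow> 'e \<Rightarrow> 'e" where "bracket u w = mult_second u w - mult_second w u"

end

text \<open>The product rule for a varying bilinear form, which is a linear family in each argument.\<close>

lemma has_derivative_bilinear_family:
  fixes G :: "'p::real_normed_vector \<Rightarrow> 'e::euclidean_space \<Rightarrow> 'e \<Rightarrow> real"
  assumes lin1: "\<forall>\<^sub>F x in nhds x0. \<forall>w. linear (\<lambda>u. G x u w)"
    and lin2: "\<forall>\<^sub>F x in nhds x0. \<forall>u. linear (G x u)"
    and G: "\<And>u w. ((\<lambda>x. G x u w) has_derivative G' u w) (at x0)"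
    and f: "(f has_derivative f') (at x0)" and h: "(h has_derivative h') (at x0)"
  shows "((\<lambda>x. G x (f x) (h x)) has_derivative
    (\<lambda>d. G' (f x0) (h x0) d + G x0 (f' d) (h x0) + G x0 (f x0) (h' d))) (at x0)"
proof -
  have step: "((\<lambda>x. G x (f x) w) has_derivative (\<lambda>d. G' (f x0) w d + G x0 (f' d) w)) (at x0)" for w
    by (rule has_derivative_linear_family[where H = "\<lambda>x u. G x u w" and H' = "\<lambda>u. G' u w", OF _ G f])
      (use lin1 in \<open>auto elim: eventually_mono\<close>)
  have "\<forall>\<^sub>F x in nhds x0. linear (\<lambda>w. G x (f x) w)"
    using lin2 by (rule eventually_mono) auto
  from has_derivative_linear_family[OF this step h] show ?thesis .
qed

context lie_group_chart
begin

lemma bracket_anti: "bracket u w = - bracket w u"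
  by (simp add: bracket_def)

text \<open>Conjugation is written as a composition of translations, since these are the maps known to
  be differentiable.\<close>

definition conjugation :: "'a \<Rightarrow> 'a \<Rightarrow> 'a" where
  "conjugation a = right_translation G (inv a) \<circ> left_translation G a"

definition Ad :: "'a \<Rightarrow> 'e \<Rightarrow> 'e" where
  "Ad a w = frechet_derivative (cmap c \<circ> conjugation a \<circ> cinv c) (at e0) w"

lemma conjugation_one: "a \<in> carrier G \<Longrightarrow> conjugation a \<one> = \<one>"
  by (simp add: conjugation_def left_translation_def right_translation_def)

lemma continuous_conjugation: "a \<in> carrier G \<Longrightarrow> continuous_map (mtop M) (mtop M) (conjugation a)"
  unfolding conjugation_def
  by (intro continuous_map_compose[OF continuous_left_translation continuous_right_translation]) simp_all

lemma Ad_derivative: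
  assumes a: "a \<in> carrier G"
  shows "((cmap c \<circ> conjugation a \<circ> cinv c) has_derivative Ad a) (at e0)"
proof -
  obtain d where d: "d \<in> charts_at M (a \<otimes> \<one>)"
    using atlas_chart[of "a \<otimes> \<one>"] a carrier_eq by auto
  obtain b where b: "b \<in> charts_at M a"
    using atlas_chart[of a] a carrier_eq by auto
  obtain b' where b': "b' \<in> charts_at M (inv a)"
    using atlas_chart[of "inv a"] inv_closed[OF a] unfolding carrier_eq by blast
  have d': "d \<in> charts_at M a" using d a by simp
  have c': "c \<in> charts_at M (a \<otimes> inv a)" using c_at_one a by simp
  note L = left_translation_derivative[OF b c_at_one d]
  note R = right_translation_derivative[OF d' b' c']
  have la: "left_translation G a \<one> = a" using a by (simp add: left_translation_def)
  have dd: "chart_on (mtop M) d" using d charts by (simp add: charts_at_def)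
  have "\<exists>D. ((cmap c \<circ> conjugation a \<circ> cinv c) has_derivative D) (at e0)"
    unfolding conjugation_def e0_def
    using chart_chain_rule[OF chart_c one_in_c continuous_left_translation[OF a] dd _ L, of c "right_translation G (inv a)"]
      R charts_atD[OF d'] unfolding la by blast
  then show ?thesis
    using frechet_derivative_works unfolding Ad_def differentiable_def by blast
qed

lemma linear_Ad: "a \<in> carrier G \<Longrightarrow> linear (Ad a)"
  by (rule linear_has_derivative[OF Ad_derivative])

lemma Ad_one: "Ad \<one> w = w"
proof -
  have "((cmap c \<circ> conjugation \<one> \<circ> cinv c) has_derivative (\<lambda>u. u)) (at e0)"
  proof (rule has_derivative_cong_nhds)
    show "\<forall>\<^sub>F x in nhds e0. (cmap c \<circ> conjugation \<one> \<circ> cinv c) x = x"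
      using eventually_cimg
      by (rule eventually_mono)
        (simp add: conjugation_def left_translation_def right_translation_def cinv_carrier cmap_cinv)
  qed (rule has_derivative_ident)
  then show ?thesis unfolding Ad_def by (simp only: frechet_derivative_eqI)
qed

lemma Ad_mult:
  assumes a: "a \<in> carrier G" and b: "b \<in> carrier G"
  shows "Ad (a \<otimes> b) w = Ad a (Ad b w)"
proof -
  have "((cmap c \<circ> (conjugation a \<circ> conjugation b) \<circ> cinv c) has_derivative (\<lambda>u. Ad a (Ad b u))) (at e0)"
    using chart_chain_rule[OF chart_c one_in_c continuous_conjugation[OF b] chart_c, of "Ad b" c "conjugation a" "Ad a"]
      Ad_derivative[OF a] Ad_derivative[OF b] one_in_c conjugation_one[OF b] by (simp add: e0_def)
  moreover have "\<forall>\<^sub>F x in nhds e0. (cmap c \<circ> conjugation (a \<otimes> b) \<circ> cinv c) x = (cmap c \<circ> (conjugation a \<circ> conjugation b) \<circ> cinv c) x"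
    using eventually_cimg
  proof (rule eventually_mono)
    fix x assume "x \<in> cimg c"
    then have "cinv c x \<in> carrier G" by (rule cinv_carrier)
    then show "(cmap c \<circ> conjugation (a \<otimes> b) \<circ> cinv c) x = (cmap c \<circ> (conjugation a \<circ> conjugation b) \<circ> cinv c) x"
      using a b by (simp add: conjugation_def left_translation_def right_translation_def inv_mult_group m_assoc)
  qed
  ultimately have "((cmap c \<circ> conjugation (a \<otimes> b) \<circ> cinv c) has_derivative (\<lambda>u. Ad a (Ad b u))) (at e0)"
    by (rule has_derivative_cong_nhds[rotated])
  then show ?thesis unfolding Ad_def[of "a \<otimes> b"] by (simp only: frechet_derivative_eqI)
qed

text \<open>The identity \<open>a b = (a b a\<^sup>-\<^sup>1) a\<close>, differentiated in \<open>b\<close> at the identity.\<close>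

lemma left_diff_right_diff_Ad:
  assumes x: "x \<in> cimg c" shows "left_diff x w = right_diff x (Ad (cinv c x) w)"
proof -
  let ?a = "cinv c x"
  have a: "?a \<in> carrier G" using x by (rule cinv_carrier)
  have "((cmap c \<circ> (right_translation G ?a \<circ> conjugation ?a) \<circ> cinv c) has_derivative (\<lambda>u. right_diff x (Ad ?a u))) (at e0)"
    using chart_chain_rule[OF chart_c one_in_c continuous_conjugation[OF a] chart_c, of "Ad ?a" c "right_translation G ?a" "right_diff x"]
      Ad_derivative[OF a] right_diff_derivative(1)[OF x] one_in_c conjugation_one[OF a] by (simp add: e0_def)
  moreover have "\<forall>\<^sub>F y in nhds e0. (cmap c \<circ> left_translation G ?a \<circ> cinv c) y
      = (cmap c \<circ> (right_translation G ?a \<circ> conjugation ?a) \<circ> cinv c) y"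
    using eventually_cimg
  proof (rule eventually_mono)
    fix y assume "y \<in> cimg c"
    then have "cinv c y \<in> carrier G" by (rule cinv_carrier)
    then show "(cmap c \<circ> left_translation G ?a \<circ> cinv c) y
      = (cmap c \<circ> (right_translation G ?a \<circ> conjugation ?a) \<circ> cinv c) y"
      using a by (simp add: conjugation_def left_translation_def right_translation_def m_assoc)
  qed
  ultimately have "((cmap c \<circ> left_translation G ?a \<circ> cinv c) has_derivative (\<lambda>u. right_diff x (Ad ?a u))) (at e0)"
    by (rule has_derivative_cong_nhds[rotated])
  then show ?thesis unfolding left_diff_def by (simp only: frechet_derivative_eqI)
qed

text \<open>\<open>Ad\<close> solves the linear system \<open>right_diff x (Ad x w) = left_diff x w\<close>, so it is
  differentiable; the derivative of the system at the identity is
  \<open>mult_second w u + ad u w = mult_second u w\<close>.\<close>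

lemma Ad_second: "((\<lambda>x. Ad (cinv c x) w) has_derivative (\<lambda>u. bracket u w)) (at e0)"
proof -
  have lin: "\<forall>\<^sub>F x in nhds e0. linear (right_diff x)"
    using eventually_cimg by (rule eventually_mono) (rule linear_right_diff)
  have eq: "\<forall>\<^sub>F x in nhds e0. right_diff x (Ad (cinv c x) w) = left_diff x w"
    using eventually_cimg by (rule eventually_mono) (rule left_diff_right_diff_Ad[symmetric])
  have "(\<lambda>x. Ad (cinv c x) w) differentiable (at e0)"
    by (rule linear_system_solution_differentiable[OF lin right_diff_second mult_second_derivative eq]) (simp add: right_diff_e0)
  then obtain D where D: "((\<lambda>x. Ad (cinv c x) w) has_derivative D) (at e0)"
    unfolding differentiable_def by blast
  have "((\<lambda>x. right_diff x (Ad (cinv c x) w)) has_derivative (\<lambda>u. mult_second w u + D u)) (at e0)"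
    using has_derivative_linear_family[OF lin right_diff_second D] by (simp add: cinv_e0 Ad_one right_diff_e0)
  moreover have "((\<lambda>x. right_diff x (Ad (cinv c x) w)) has_derivative (\<lambda>u. mult_second u w)) (at e0)"
    by (rule has_derivative_cong_nhds[OF eq mult_second_derivative])
  ultimately have "(\<lambda>u. mult_second w u + D u) = (\<lambda>u. mult_second u w)"
    by (rule has_derivative_unique)
  then have "D = (\<lambda>u. bracket u w)"
    by (auto simp: fun_eq_iff bracket_def algebra_simps)
  with D show ?thesis by simp
qed

lemma bilinear_bracket: "bilinear bracket"
proof -
  have l: "linear (\<lambda>u. bracket u w)" for w
    by (rule linear_has_derivative[OF Ad_second])
  moreover have "linear (bracket u)" for u
  proof -
    have "linear (\<lambda>w. - bracket w u)" using l by (rule linear_compose_neg)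
    moreover have "bracket u = (\<lambda>w. - bracket w u)" by (simp add: fun_eq_iff bracket_def)
    ultimately show ?thesis by simp
  qed
  ultimately show ?thesis by (simp add: bilinear_def)
qed

text \<open>Conjugating by \<open>a\<close> the point at which \<open>Ad\<close> is differentiated, one finds
  \<open>Ad (a b a\<^sup>-\<^sup>1) (Ad a w) = Ad a (Ad b w)\<close>.  The derivative in \<open>b\<close> is the claim.\<close>

lemma Ad_bracket:
  assumes a: "a \<in> carrier G"
  shows "bracket (Ad a v) (Ad a w) = Ad a (bracket v w)"
proof -
  let ?k = "cmap c \<circ> conjugation a \<circ> cinv c"
  have k0: "?k e0 = e0" by (simp add: cinv_e0 conjugation_one[OF a] flip: e0_def)
  have "((\<lambda>y. Ad (cinv c (?k y)) (Ad a w)) has_derivative (\<lambda>v. bracket (Ad a v) (Ad a w))) (at e0)"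
    using has_derivative_compose[OF Ad_derivative[OF a], of "\<lambda>x. Ad (cinv c x) (Ad a w)"] Ad_second[of "Ad a w"]
    by (simp only: k0)
  moreover have "\<forall>\<^sub>F y in nhds e0. Ad a (Ad (cinv c y) w) = Ad (cinv c (?k y)) (Ad a w)"
  proof -
    have "\<forall>\<^sub>F y in nhds (cmap c \<one>). y \<in> cimg c \<and> conjugation a (cinv c y) \<in> cdom c"
      using chart_c one_in_c conjugation_one[OF a]
      by (intro eventually_chart_map[OF _ _ continuous_conjugation[OF a]]) (auto simp: chart_on_def)
    then show ?thesis
      unfolding e0_def[symmetric]
    proof (rule eventually_mono)
      fix y assume y: "y \<in> cimg c \<and> conjugation a (cinv c y) \<in> cdom c"
      let ?b = "cinv c y"
      have b: "?b \<in> carrier G" using y cinv_carrier by blast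
      have "cinv c (?k y) = conjugation a ?b" using y by (simp add: cinv_cmap[OF chart_c])
      moreover have "conjugation a ?b \<otimes> a = a \<otimes> ?b" "conjugation a ?b \<in> carrier G"
        using a b by (simp_all add: conjugation_def left_translation_def right_translation_def m_assoc)
      ultimately show "Ad a (Ad ?b w) = Ad (cinv c (?k y)) (Ad a w)"
        using a b by (metis Ad_mult)
    qed
  qed
  ultimately have "((\<lambda>y. Ad a (Ad (cinv c y) w)) has_derivative (\<lambda>v. bracket (Ad a v) (Ad a w))) (at e0)"
    by (rule has_derivative_cong_nhds[rotated])
  moreover have "((\<lambda>y. Ad a (Ad (cinv c y) w)) has_derivative (\<lambda>v. Ad a (bracket v w))) (at e0)"
    using linear_Ad[OF a] by (intro bounded_linear.has_derivative[OF _ Ad_second]) (simp add: linear_conv_bounded_linear)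
  ultimately have "(\<lambda>v. bracket (Ad a v) (Ad a w)) = (\<lambda>v. Ad a (bracket v w))"
    by (rule has_derivative_unique)
  then show ?thesis by (rule fun_cong)
qed

text \<open>The derivative in \<open>a\<close> of \<open>Ad a [v, w] = [Ad a v, Ad a w]\<close>.\<close>

lemma bracket_jacobi: "bracket u (bracket v w) = bracket (bracket u v) w + bracket v (bracket u w)"
proof -
  have bb: "bounded_bilinear bracket" using bilinear_bracket by (simp add: bilinear_conv_bounded_bilinear)
  have "((\<lambda>x. bracket (Ad (cinv c x) v) (Ad (cinv c x) w)) has_derivative
      (\<lambda>u. bracket v (bracket u w) + bracket (bracket u v) w)) (at e0)"
    using bounded_bilinear.FDERIV[OF bb Ad_second[of v] Ad_second[of w]] by (simp add: cinv_e0 Ad_one)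
  moreover have "\<forall>\<^sub>F x in nhds e0. Ad (cinv c x) (bracket v w) = bracket (Ad (cinv c x) v) (Ad (cinv c x) w)"
    using eventually_cimg by (rule eventually_mono) (simp add: Ad_bracket cinv_carrier)
  ultimately have "((\<lambda>x. Ad (cinv c x) (bracket v w)) has_derivative (\<lambda>u. bracket v (bracket u w) + bracket (bracket u v) w)) (at e0)"
    by (rule has_derivative_cong_nhds[rotated])
  then have "(\<lambda>u. bracket v (bracket u w) + bracket (bracket u v) w) = (\<lambda>u. bracket u (bracket v w))"
    using Ad_second by (rule has_derivative_unique)
  then show ?thesis by (metis add.commute)
qed

end

text \<open>The chart chosen by the definitions of tangent maps and exterior derivatives at the
  identity.\<close>

locale lie_group_canonical_chart = lie_group_chart G M c e0
  for G :: "'a monoid" (structure) and M :: "('a, 'e::euclidean_space) manifold"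
    and c :: "('a, 'e) chart" and e0 :: 'e +
  assumes c_some: "c = (SOME c. c \<in> charts_at M \<one>)"
begin

lemma left_translate_vector:
  assumes x: "x \<in> cimg c"
  shows "tangent_map M M (left_translation G (cinv c x)) \<one> v = coord_vec M c (left_diff x (v c)) (cinv c x)"
proof -
  have "left_translation G (cinv c x) \<one> = cinv c x"
    using cinv_carrier[OF x] by (simp add: left_translation_def)
  then show ?thesis
    using tangent_map_coord[OF charts_differentiable charts_differentiable c_some c_at_one _
        continuous_left_translation[OF cinv_carrier[OF x]], of c "left_diff x" v]
      left_diff_derivative(1)[OF x] c_at_cinv[OF x] by (simp add: e0_def)
qed

lemma right_translate_vector:
  assumes x: "x \<in> cimg c"
  shows "tangent_map M M (right_translation G (cinv c x)) \<one> v = coord_vec M c (right_diff x (v c)) (cinv c x)"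
proof -
  have "right_translation G (cinv c x) \<one> = cinv c x"
    using cinv_carrier[OF x] by (simp add: right_translation_def)
  then show ?thesis
    using tangent_map_coord[OF charts_differentiable charts_differentiable c_some c_at_one _
        continuous_right_translation[OF cinv_carrier[OF x]], of c "right_diff x" v]
      right_diff_derivative(1)[OF x] c_at_cinv[OF x] by (simp add: e0_def)
qed

lemma lie_bracket_component: "lie_bracket G M v w c = bracket (v c) (w c)"
proof -
  have field: "((\<lambda>x. left_invariant_field G M v (cinv c x) c) has_derivative (\<lambda>u. mult_second u (v c))) (at e0)" for v
  proof (rule has_derivative_cong_nhds[OF _ mult_second_derivative])
    show "\<forall>\<^sub>F x in nhds e0. left_invariant_field G M v (cinv c x) c = left_diff x (v c)"
      using eventually_cimg
      by (rule eventually_mono)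
        (simp add: left_invariant_field_def left_translate_vector coord_vec_component[OF charts_differentiable c_at_cinv])
  qed
  have one: "left_invariant_field G M v \<one> c = v c" for v
    using left_translate_vector[OF e0_in, of v] coord_vec_component[OF charts_differentiable c_at_one]
    by (simp add: left_invariant_field_def cinv_e0 left_diff_e0)
  show ?thesis
    unfolding lie_bracket_def vf_bracket_def
    using frechet_derivative_eqI[OF field[of w]] frechet_derivative_eqI[OF field[of v]] c_at_one
    by (simp add: one bracket_def flip: e0_def)
qed

text \<open>For a point \<open>x\<close> near the identity the values of the metric on left and on right translates
  of two vectors agree with the value at the identity.  Subtracting the derivatives of the two
  identities cancels the derivative of the metric itself and leaves
  \<open>b([d, u], w) + b(u, [d, w]) = 0\<close>.\<close>

lemma invariant_metric_on_lie_algebra: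
  assumes g: "semi_riemannian_metric M g" and inv: "bi_invariant_metric G M g"
  defines "b \<equiv> \<lambda>u w. g \<one> (coord_vec M c u \<one>) (coord_vec M c w \<one>)"
  shows "bilinear b" and "b u w = b w u" and "(\<And>y. b u y = 0) \<Longrightarrow> u = 0"
    and "b (bracket x y) z = b x (bracket y z)"
proof -
  define h where "h x u w = g (cinv c x) (coord_vec M c u (cinv c x)) (coord_vec M c w (cinv c x))" for x u w
  have h0: "h e0 u w = b u w" for u w by (simp add: h_def b_def cinv_e0)
  have lin1: "linear (\<lambda>u. h x u w)" and sym: "h x u w = h x w u" if x: "x \<in> cimg c" for x u w
  proof -
    have top: "cinv c x \<in> topspace (mtop M)" using cinv_carrier[OF x] carrier_eq by simp
    note cd = charts_differentiable c_at_cinv[OF x]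
    note alg = g[unfolded semi_riemannian_metric_def, THEN conjunct1, rule_format, OF top, THEN conjunct1, rule_format,
        OF coord_vec_in[OF cd] coord_vec_in[OF cd] coord_vec_in[OF cd]]
    show "linear (\<lambda>u. h x u w)"
      using alg by (intro linearI) (simp_all add: h_def coord_vec_add[OF cd] coord_vec_scale[OF cd])
    show "h x u w = h x w u" using alg by (simp add: h_def)
  qed
  have lin2: "linear (h x u)" if x: "x \<in> cimg c" for x u
  proof -
    have "h x u = (\<lambda>w. h x w u)" using sym[OF x] by (simp add: fun_eq_iff)
    then show ?thesis using lin1[OF x] by simp
  qed
  show "bilinear b" using lin1[OF e0_in] lin2[OF e0_in] by (simp add: bilinear_def h0[abs_def])
  show sym_b: "b u w = b w u" for u w using sym[OF e0_in] by (simp add: h0)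
  have top1: "\<one> \<in> topspace (mtop M)" using carrier_eq by auto
  show "u = 0" if "\<And>y. b u y = 0" for u
  proof -
    have "g \<one> (coord_vec M c u \<one>) w = 0" if "w \<in> tangent_space M \<one>" for w
      using \<open>\<And>y. b u y = 0\<close>[of "w c"] coord_vec_eq[OF charts_differentiable c_at_one that]
      by (simp add: b_def)
    then have "coord_vec M c u \<one> = tv_zero"
      using g[unfolded semi_riemannian_metric_def] top1 coord_vec_in[OF charts_differentiable c_at_one] by blast
    then show "u = 0"
      using coord_vec_component[OF charts_differentiable c_at_one, of u] by (simp add: tv_zero_def)
  qed
  have left: "h x (left_diff x u) (left_diff x w) = b u w" and right: "h x (right_diff x u) (right_diff x w) = b u w"
    if x: "x \<in> cimg c" for x u w
  proof -
    have a: "cinv c x \<in> carrier G" by (rule cinv_carrier[OF x])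
    note ci = coord_vec_in[OF charts_differentiable c_at_one]
    note cc = coord_vec_component[OF charts_differentiable c_at_one]
    have "g (left_translation G (cinv c x) \<one>) (tangent_map M M (left_translation G (cinv c x)) \<one> (coord_vec M c u \<one>))
        (tangent_map M M (left_translation G (cinv c x)) \<one> (coord_vec M c w \<one>)) = b u w"
      using inv a top1 ci unfolding bi_invariant_metric_def metric_invariant_under_def b_def by blast
    then show "h x (left_diff x u) (left_diff x w) = b u w"
      unfolding left_translate_vector[OF x] cc using a by (simp add: h_def left_translation_def)
    have "g (right_translation G (cinv c x) \<one>) (tangent_map M M (right_translation G (cinv c x)) \<one> (coord_vec M c u \<one>))
        (tangent_map M M (right_translation G (cinv c x)) \<one> (coord_vec M c w \<one>)) = b u w"
      using inv a top1 ci unfolding bi_invariant_metric_def metric_invariant_under_def b_def by blast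
    then show "h x (right_diff x u) (right_diff x w) = b u w"
      unfolding right_translate_vector[OF x] cc using a by (simp add: h_def right_translation_def)
  qed
  have op: "open (cimg c)" using chart_c by (simp add: chart_on_def)
  have h': "((\<lambda>x. h x u w) has_derivative frechet_derivative (\<lambda>x. h x u w) (at e0)) (at e0)" for u w
    using g c_atlas unfolding semi_riemannian_metric_def h_def
    by (intro smooth_on_has_derivative[OF _ op e0_in]) blast
  define h1 where "h1 u w = frechet_derivative (\<lambda>x. h x u w) (at e0)" for u w
  have ev1: "\<forall>\<^sub>F x in nhds e0. \<forall>w. linear (\<lambda>u. h x u w)" and ev2: "\<forall>\<^sub>F x in nhds e0. \<forall>u. linear (h x u)"
    using eventually_cimg by (rule eventually_mono, blast intro: lin1 lin2)+
  have inv_b: "b (bracket d u) w + b u (bracket d w) = 0" for d u w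
  proof -
    have "((\<lambda>x. h x (left_diff x u) (left_diff x w)) has_derivative
        (\<lambda>d. h1 u w d + b (mult_second d u) w + b u (mult_second d w))) (at e0)"
      using has_derivative_bilinear_family[OF ev1 ev2 h' mult_second_derivative[of u] mult_second_derivative[of w]]
      by (simp add: left_diff_e0 h0 h1_def)
    moreover have "((\<lambda>x. h x (left_diff x u) (left_diff x w)) has_derivative (\<lambda>d. 0)) (at e0)"
      by (rule has_derivative_cong_nhds[OF eventually_mono[OF eventually_cimg] has_derivative_const]) (rule left)
    ultimately have L: "(\<lambda>d. h1 u w d + b (mult_second d u) w + b u (mult_second d w)) = (\<lambda>d. 0)"
      by (rule has_derivative_unique)
    have "((\<lambda>x. h x (right_diff x u) (right_diff x w)) has_derivative
        (\<lambda>d. h1 u w d + b (mult_second u d) w + b u (mult_second w d))) (at e0)"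
      using has_derivative_bilinear_family[OF ev1 ev2 h' right_diff_second[of u] right_diff_second[of w]]
      by (simp add: right_diff_e0 h0 h1_def)
    moreover have "((\<lambda>x. h x (right_diff x u) (right_diff x w)) has_derivative (\<lambda>d. 0)) (at e0)"
      by (rule has_derivative_cong_nhds[OF eventually_mono[OF eventually_cimg] has_derivative_const]) (rule right)
    ultimately have R: "(\<lambda>d. h1 u w d + b (mult_second u d) w + b u (mult_second w d)) = (\<lambda>d. 0)"
      by (rule has_derivative_unique)
    show ?thesis
      using fun_cong[OF L, of d] fun_cong[OF R, of d]
      by (simp add: bracket_def bilinear_lsub[OF \<open>bilinear b\<close>] bilinear_rsub[OF \<open>bilinear b\<close>])
  qed
  show "b (bracket x y) z = b x (bracket y z)"
    using inv_b[of y x z] bracket_anti[of x y] by (simp add: bilinear_lneg[OF \<open>bilinear b\<close>])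
qed

text \<open>The function \<open>\<eta>\<close> of the left translate of \<open>u\<close> is constant.  Its derivative expresses the
  derivative of the coefficients of \<open>\<eta>\<close> by \<open>mult_second\<close>, and antisymmetrization turns this into
  the bracket.\<close>

lemma invariant_form_on_lie_algebra:
  assumes eta: "smooth_one_form M \<eta>" and inv: "left_invariant_form G M \<eta>"
  defines "k \<equiv> \<lambda>u. \<eta> \<one> (coord_vec M c u \<one>)"
  shows "linear k"
    and "ext_deriv M \<eta> \<one> v w = - k (bracket (v c) (w c))"
proof -
  define h where "h x u = \<eta> (cinv c x) (coord_vec M c u (cinv c x))" for x u
  have h0: "h e0 u = k u" for u by (simp add: h_def k_def cinv_e0)
  have lin: "linear (h x)" if x: "x \<in> cimg c" for x
  proof -
    have top: "cinv c x \<in> topspace (mtop M)" using cinv_carrier[OF x] carrier_eq by simp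
    note cd = charts_differentiable c_at_cinv[OF x]
    note alg = eta[unfolded smooth_one_form_def, THEN conjunct1, rule_format, OF top
        coord_vec_in[OF cd] coord_vec_in[OF cd]]
    show "linear (h x)"
      using alg by (intro linearI) (simp_all add: h_def coord_vec_add[OF cd] coord_vec_scale[OF cd])
  qed
  show lk: "linear k" using lin[OF e0_in] by (simp add: h0[abs_def])
  have top1: "\<one> \<in> topspace (mtop M)" using carrier_eq by auto
  have left: "h x (left_diff x u) = k u" if x: "x \<in> cimg c" for x u
  proof -
    have a: "cinv c x \<in> carrier G" by (rule cinv_carrier[OF x])
    note ci = coord_vec_in[OF charts_differentiable c_at_one]
    note cc = coord_vec_component[OF charts_differentiable c_at_one]
    have "\<eta> (cinv c x \<otimes> \<one>) (tangent_map M M (left_translation G (cinv c x)) \<one> (coord_vec M c u \<one>)) = k u"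
      using inv a top1 ci unfolding left_invariant_form_def k_def by blast
    then show ?thesis
      unfolding left_translate_vector[OF x] cc using a by (simp add: h_def)
  qed
  have op: "open (cimg c)" using chart_c by (simp add: chart_on_def)
  have h': "((\<lambda>x. h x u) has_derivative frechet_derivative (\<lambda>x. h x u) (at e0)) (at e0)" for u
    using eta c_atlas unfolding smooth_one_form_def h_def
    by (intro smooth_on_has_derivative[OF _ op e0_in]) blast
  have ev: "\<forall>\<^sub>F x in nhds e0. linear (h x)"
    using eventually_cimg by (rule eventually_mono) (rule lin)
  have der: "frechet_derivative (\<lambda>x. h x u) (at e0) d = - k (mult_second d u)" for u d
  proof -
    have "((\<lambda>x. h x (left_diff x u)) has_derivative
        (\<lambda>d. frechet_derivative (\<lambda>x. h x u) (at e0) d + k (mult_second d u))) (at e0)"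
      using has_derivative_linear_family[OF ev h' mult_second_derivative[of u]] by (simp add: left_diff_e0 h0)
    moreover have "((\<lambda>x. h x (left_diff x u)) has_derivative (\<lambda>d. 0)) (at e0)"
      by (rule has_derivative_cong_nhds[OF eventually_mono[OF eventually_cimg] has_derivative_const]) (rule left)
    ultimately have "(\<lambda>d. frechet_derivative (\<lambda>x. h x u) (at e0) d + k (mult_second d u)) = (\<lambda>d. 0)"
      by (rule has_derivative_unique)
    from fun_cong[OF this, of d] show ?thesis by simp
  qed
  show "ext_deriv M \<eta> \<one> v w = - k (bracket (v c) (w c))"
    using der[of "w c" "v c"] der[of "v c" "w c"] linear_diff[OF lk]
    by (simp add: ext_deriv_def bracket_def h_def flip: c_some e0_def)
qed

end

section \<open>Smooth parametrizations and graph charts\<close>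

lemma Ck_on_cong:
  assumes "open S" shows "(\<And>x. x \<in> S \<Longrightarrow> f x = g x) \<Longrightarrow> Ck_on k S f \<longleftrightarrow> Ck_on k S g"
proof (induction k arbitrary: f g)
  case 0
  then show ?case by (simp cong: continuous_on_cong)
next
  case (Suc k)
  have ev: "\<forall>\<^sub>F y in nhds x. f y = g y" "\<forall>\<^sub>F y in nhds x. g y = f y" if "x \<in> S" for x
    using that assms Suc.prems by (auto simp: eventually_nhds)
  have iff: "(f has_derivative D) (at x) \<longleftrightarrow> (g has_derivative D) (at x)" if "x \<in> S" for x D
    using has_derivative_cong_nhds[OF ev(1)[OF that]] has_derivative_cong_nhds[OF ev(2)[OF that]] by blast
  have "f differentiable_on S \<longleftrightarrow> g differentiable_on S"
    unfolding differentiable_on_eq_differentiable_at[OF assms] by (simp add: differentiable_def iff)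
  moreover have "frechet_derivative f (at x) = frechet_derivative g (at x)" if "x \<in> S" for x
    unfolding frechet_derivative_def by (simp add: iff[OF that])
  then have "Ck_on k S (\<lambda>x. frechet_derivative f (at x) v) \<longleftrightarrow> Ck_on k S (\<lambda>x. frechet_derivative g (at x) v)" for v
    by (intro Suc.IH) simp
  ultimately show ?case by simp
qed

lemma Ck_on_SucI:
  assumes S: "open S" and D: "\<And>x. x \<in> S \<Longrightarrow> (f has_derivative D x) (at x)" and k: "\<And>v. Ck_on k S (\<lambda>x. D x v)"
  shows "Ck_on (Suc k) S f"
proof -
  have "f differentiable_on S"
    unfolding differentiable_on_eq_differentiable_at[OF S] differentiable_def using D by blast
  moreover have "Ck_on k S (\<lambda>x. frechet_derivative f (at x) v)" for v
    using Ck_on_cong[OF S, of "\<lambda>x. frechet_derivative f (at x) v" "\<lambda>x. D x v"] k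
    by (simp add: frechet_derivative_eqI[OF D])
  ultimately show ?thesis by simp
qed

lemma Ck_on_SucD:
  assumes "open S" "Ck_on (Suc k) S f"
  shows "\<And>x. x \<in> S \<Longrightarrow> (f has_derivative frechet_derivative f (at x)) (at x)"
    and "Ck_on k S (\<lambda>x. frechet_derivative f (at x) v)"
  using assms by (auto simp: differentiable_on_eq_differentiable_at frechet_derivative_works)

lemma Ck_on_Suc_imp: "open S \<Longrightarrow> Ck_on (Suc k) S f \<Longrightarrow> Ck_on k S f"
proof (induction k arbitrary: f)
  case 0
  then show ?case by (simp add: differentiable_imp_continuous_on)
next
  case (Suc k)
  show ?case
    by (rule Ck_on_SucI[OF Suc.prems(1) Ck_on_SucD(1)[OF Suc.prems]])
      (auto intro: Suc.IH[OF Suc.prems(1)] Ck_on_SucD(2)[OF Suc.prems])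
qed

lemma Ck_on_const: "open S \<Longrightarrow> Ck_on k S (\<lambda>x. a)"
  by (induction k arbitrary: a) simp_all

lemma Ck_on_bounded_linear:
  assumes S: "open S" and f: "bounded_linear f" shows "Ck_on k S f"
proof (cases k)
  case 0
  then show ?thesis using f by (simp add: linear_continuous_on)
next
  case (Suc j)
  show ?thesis unfolding Suc
    by (rule Ck_on_SucI[OF S bounded_linear_imp_has_derivative[OF f] Ck_on_const[OF S]])
qed

lemma Ck_on_add: "open S \<Longrightarrow> Ck_on k S f \<Longrightarrow> Ck_on k S g \<Longrightarrow> Ck_on k S (\<lambda>x. f x + g x)"
proof (induction k arbitrary: f g)
  case 0
  then show ?case by (simp add: continuous_on_add)
next
  case (Suc k)
  show ?case
    by (rule Ck_on_SucI[OF Suc.prems(1) has_derivative_add[OF Ck_on_SucD(1)[OF Suc.prems(1,2)] Ck_on_SucD(1)[OF Suc.prems(1,3)]]])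
      (auto intro: Suc.IH[OF Suc.prems(1)] Ck_on_SucD(2)[OF Suc.prems(1,2)] Ck_on_SucD(2)[OF Suc.prems(1,3)])
qed

lemma Ck_on_bilinear:
  assumes "bounded_bilinear prd"
  shows "open S \<Longrightarrow> Ck_on k S f \<Longrightarrow> Ck_on k S g \<Longrightarrow> Ck_on k S (\<lambda>x. prd (f x) (g x))"
proof (induction k arbitrary: f g)
  case 0
  then show ?case by (simp add: bounded_bilinear.continuous_on[OF assms])
next
  case (Suc k)
  note S = Suc.prems(1)
  have D: "((\<lambda>x. prd (f x) (g x)) has_derivative
      (\<lambda>v. prd (f x) (frechet_derivative g (at x) v) + prd (frechet_derivative f (at x) v) (g x))) (at x)"
    if "x \<in> S" for x
    by (rule bounded_bilinear.FDERIV[OF assms Ck_on_SucD(1)[OF S Suc.prems(2) that]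
          Ck_on_SucD(1)[OF S Suc.prems(3) that]])
  show ?case
    by (rule Ck_on_SucI[OF S], erule D)
      (intro Ck_on_add[OF S] Suc.IH[OF S] Ck_on_Suc_imp[OF S Suc.prems(2)] Ck_on_Suc_imp[OF S Suc.prems(3)]
        Ck_on_SucD(2)[OF S Suc.prems(2)] Ck_on_SucD(2)[OF S Suc.prems(3)])
qed

lemmas Ck_on_mult = Ck_on_bilinear[OF bounded_bilinear_mult]
lemmas Ck_on_scaleR = Ck_on_bilinear[OF bounded_bilinear_scaleR]

lemma Ck_on_inverse:
  fixes f :: "'e::euclidean_space \<Rightarrow> real"
  assumes S: "open S"
  shows "Ck_on k S f \<Longrightarrow> (\<And>x. x \<in> S \<Longrightarrow> f x \<noteq> 0) \<Longrightarrow> Ck_on k S (\<lambda>x. inverse (f x))"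
proof (induction k arbitrary: f)
  case 0
  then show ?case by (simp add: continuous_on_inverse)
next
  case (Suc k)
  have D: "((\<lambda>x. inverse (f x)) has_derivative
      (\<lambda>v. (-1) * (inverse (f x) * (frechet_derivative f (at x) v * inverse (f x))))) (at x)" if "x \<in> S" for x
    using Deriv.has_derivative_inverse[OF Suc.prems(2)[OF that] Ck_on_SucD(1)[OF S Suc.prems(1) that]]
    by (simp add: mult.assoc)
  have I: "Ck_on k S (\<lambda>x. inverse (f x))"
    by (rule Suc.IH[OF Ck_on_Suc_imp[OF S Suc.prems(1)] Suc.prems(2)])
  show ?case
    by (rule Ck_on_SucI[OF S], erule D)
      (intro Ck_on_mult[OF S] Ck_on_const[OF S] Ck_on_SucD(2)[OF S Suc.prems(1)] I)
qed

lemma Ck_on_sqrt: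
  fixes f :: "'e::euclidean_space \<Rightarrow> real"
  assumes S: "open S"
  shows "Ck_on k S f \<Longrightarrow> (\<And>x. x \<in> S \<Longrightarrow> f x > 0) \<Longrightarrow> Ck_on k S (\<lambda>x. sqrt (f x))"
proof (induction k arbitrary: f)
  case 0
  then show ?case by (simp add: continuous_on_real_sqrt)
next
  case (Suc k)
  have D: "((\<lambda>x. sqrt (f x)) has_derivative
      (\<lambda>v. (1 / 2) * (frechet_derivative f (at x) v * inverse (sqrt (f x))))) (at x)" if "x \<in> S" for x
    using has_derivative_real_sqrt[OF Suc.prems(2)[OF that] Ck_on_SucD(1)[OF S Suc.prems(1) that]]
    by (simp add: field_simps)
  have I: "Ck_on k S (\<lambda>x. inverse (sqrt (f x)))"
    using Suc.prems(2)
    by (intro Ck_on_inverse[OF S] Suc.IH[OF Ck_on_Suc_imp[OF S Suc.prems(1)]]) (auto simp: less_imp_neq[symmetric] dest: Suc.prems(2))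
  show ?case
    by (rule Ck_on_SucI[OF S], erule D)
      (intro Ck_on_mult[OF S] Ck_on_const[OF S] Ck_on_SucD(2)[OF S Suc.prems(1)] I)
qed

text \<open>A linear coordinate map \<open>\<pi>\<close> is a chart of the submanifold as soon as it has a smooth inverse
  \<open>\<sigma>\<close>; the parametrization is then an immersion because \<open>\<pi> \<circ> \<sigma>\<close> is the identity.\<close>

lemma graph_chart:
  fixes S :: "'v::euclidean_space set" and U :: "'e::euclidean_space set"
  assumes U: "open U" and \<sigma>: "smooth_on U \<sigma>" and \<pi>: "bounded_linear \<pi>"
    and inv1: "\<And>x. x \<in> U \<Longrightarrow> \<pi> (\<sigma> x) = x" and inv2: "\<And>A. A \<in> V \<Longrightarrow> \<pi> A \<in> U \<and> \<sigma> (\<pi> A) = A"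
    and \<sigma>V: "\<And>x. x \<in> U \<Longrightarrow> \<sigma> x \<in> V" and V: "openin (top_of_set S) V"
  shows "(V, \<pi>) \<in> atlas (submanifold S)" and "cimg (V, \<pi>) = U" and "x \<in> U \<Longrightarrow> cinv (V, \<pi>) x = \<sigma> x"
proof -
  show img: "cimg (V, \<pi>) = U"
    using inv1 inv2 \<sigma>V by (force simp: cimg_def)
  have inj: "inj_on \<pi> V" using inv2 by (metis inj_onI)
  show cinv: "cinv (V, \<pi>) x = \<sigma> x" if "x \<in> U" for x
    using inv_into_f_f[OF inj \<sigma>V[OF that]] by (simp add: cinv_def inv1[OF that])
  have smooth: "smooth_on U (cinv (V, \<pi>))"
    using \<sigma> Ck_on_cong[OF U, of "cinv (V, \<pi>)" \<sigma>] cinv unfolding smooth_on_def by simp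
  have cont\<sigma>: "continuous_on U \<sigma>"
    using \<sigma> unfolding smooth_on_def using Ck_on.simps(1) by blast
  have VS: "V \<subseteq> S" using V openin_imp_subset by blast
  have "homeomorphic_maps (top_of_set V) (top_of_set U) \<pi> \<sigma>"
    unfolding homeomorphic_maps_def
    using cont\<sigma> linear_continuous_on[OF \<pi>, of V] inv1 inv2 \<sigma>V
    by (auto simp: Pi_iff)
  then have "homeomorphic_map (top_of_set V) (top_of_set U) \<pi>"
    using homeomorphic_maps_map by blast
  then have "chart_on (top_of_set S) (V, \<pi>)"
    using V U VS img by (simp add: chart_on_def subtopology_subtopology inf_absorb2)
  moreover have "inj (frechet_derivative (cinv (V, \<pi>)) (at x))" if x: "x \<in> U" for x
  proof (rule inj_on_inverseI)
    let ?D = "frechet_derivative (cinv (V, \<pi>)) (at x)"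
    have "((\<lambda>y. \<pi> (cinv (V, \<pi>) y)) has_derivative (\<lambda>u. \<pi> (?D u))) (at x)"
      using bounded_linear.has_derivative[OF \<pi> smooth_on_has_derivative[OF smooth U x]] .
    moreover have "((\<lambda>y. \<pi> (cinv (V, \<pi>) y)) has_derivative (\<lambda>u. u)) (at x)"
    proof (rule has_derivative_cong_nhds)
      show "\<forall>\<^sub>F y in nhds x. \<pi> (cinv (V, \<pi>) y) = y"
        unfolding eventually_nhds using U x cinv inv1 by auto
    qed (rule has_derivative_ident)
    ultimately have "(\<lambda>u. \<pi> (?D u)) = (\<lambda>u. u)" by (rule has_derivative_unique)
    then show "\<pi> (?D u) = u" for u by (rule fun_cong)
  qed
  ultimately show "(V, \<pi>) \<in> atlas (submanifold S)"
    using smooth img by (simp add: submanifold_def)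
qed

section \<open>Lie algebras of embedded groups\<close>

text \<open>A group structure on a subset of a Euclidean space whose product is the restriction of a
  bilinear map.  The Lie algebra is read off in a chart around the identity.\<close>

locale embedded_group =
  fixes S :: "'v::euclidean_space set" and prd :: "'v \<Rightarrow> 'v \<Rightarrow> 'v" and i :: 'v
    and H :: "'v monoid" and N :: "('v, 'e::euclidean_space) manifold"
  assumes H_def: "H = \<lparr>carrier = S, mult = prd, one = i\<rparr>" and N_def: "N = submanifold S"
    and prd: "bounded_bilinear prd"
    and closed: "a \<in> S \<Longrightarrow> b \<in> S \<Longrightarrow> prd a b \<in> S"
    and one_left: "prd i x = x" and one_right: "prd x i = x"
    and chart_exists: "charts_at N i \<noteq> {}"
begin

lemma mtop_N: "mtop N = top_of_set S"
  by (simp add: N_def submanifold_def)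

text \<open>The differential of the parametrization inverse to the chart \<open>d\<close>.  It identifies component
  vectors with vectors of the ambient space.\<close>

definition d\<sigma> :: "('v, 'e) chart \<Rightarrow> 'e \<Rightarrow> 'e \<Rightarrow> 'v" where
  "d\<sigma> d x = frechet_derivative (cinv d) (at x)"

lemma atlas_N:
  assumes "d \<in> atlas N"
  shows "chart_on (top_of_set S) d" "smooth_on (cimg d) (cinv d)" "open (cimg d)"
  using assms by (auto simp: N_def submanifold_def chart_on_def)

lemma d\<sigma>:
  assumes "d \<in> atlas N" "x \<in> cimg d"
  shows "(cinv d has_derivative d\<sigma> d x) (at x)"
  unfolding d\<sigma>_def using smooth_on_has_derivative[OF atlas_N(2,3)] assms by blast

lemma linear_d\<sigma>: "d \<in> atlas N \<Longrightarrow> x \<in> cimg d \<Longrightarrow> linear (d\<sigma> d x)"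
  by (rule linear_has_derivative[OF d\<sigma>])

lemma inj_d\<sigma>:
  assumes "d \<in> atlas N" "x \<in> cimg d" "d\<sigma> d x u = d\<sigma> d x w" shows "u = w"
proof -
  have "inj (d\<sigma> d x)" using assms by (simp add: N_def submanifold_def d\<sigma>_def)
  then show ?thesis using assms(3) by (rule injD)
qed

lemma inj_d\<sigma>0:
  assumes "d \<in> atlas N" "x \<in> cimg d" "d\<sigma> d x u = 0" shows "u = 0"
  using inj_d\<sigma>[OF assms(1,2), of u 0] assms(3) linear_0[OF linear_d\<sigma>[OF assms(1,2)]] by simp

text \<open>Differentiability of the coordinate expression follows from differentiability in the ambient
  space, because the parametrization is an immersion.\<close>

lemma lift_derivative:
  assumes c: "c \<in> charts_at N p" and d: "d \<in> charts_at N (h p)"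
    and h: "continuous_map (top_of_set S) (top_of_set S) h"
    and D: "((\<lambda>x. h (cinv c x)) has_derivative A) (at (cmap c p))"
  obtains B where "((cmap d \<circ> h \<circ> cinv c) has_derivative B) (at (cmap c p))"
    "\<And>u. d\<sigma> d (cmap d (h p)) (B u) = A u"
proof -
  have cd: "c \<in> atlas N" "p \<in> cdom c" "d \<in> atlas N" "h p \<in> cdom d"
    using c d by (auto simp: charts_at_def)
  note cc = atlas_N(1)[OF cd(1)] and dd = atlas_N(1)[OF cd(3)]
  let ?f = "cmap d \<circ> h \<circ> cinv c"
  have f0: "?f (cmap c p) = cmap d (h p)" by (simp add: cinv_cmap[OF cc cd(2)])
  have x: "cmap d (h p) \<in> cimg d" by (rule cmap_in[OF cd(4)])
  note \<sigma> = d\<sigma>[OF cd(3) x]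
  have ev: "\<forall>\<^sub>F x in nhds (cmap c p). cinv d (?f x) = h (cinv c x)"
    using eventually_chart_map[OF cc cd(2) h, of "cdom d"] dd cd(4)
    by (auto elim!: eventually_mono simp: cinv_cmap[OF dd] chart_on_def)
  note D' = has_derivative_cong_nhds[OF ev D]
  have "?f differentiable (at (cmap c p))"
    by (rule differentiable_lift_immersion[OF isCont_chart_map[OF cc cd(2) h dd cd(4)] _ _ D', of "d\<sigma> d (cmap d (h p))"])
      (use \<sigma> inj_d\<sigma>0[OF cd(3) x] in \<open>simp_all only: f0\<close>)
  then obtain B where B: "(?f has_derivative B) (at (cmap c p))"
    unfolding differentiable_def by blast
  have "((\<lambda>x. cinv d (?f x)) has_derivative (\<lambda>u. d\<sigma> d (cmap d (h p)) (B u))) (at (cmap c p))"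
    using has_derivative_compose[OF B, of "cinv d"] \<sigma> by (simp only: f0)
  then have "(\<lambda>u. d\<sigma> d (cmap d (h p)) (B u)) = A"
    using D' by (rule has_derivative_unique)
  then show ?thesis using that B by (metis (no_types))
qed

lemma transition_N:
  assumes c: "c \<in> charts_at N p" and d: "d \<in> charts_at N p"
  shows "(cmap d \<circ> cinv c) differentiable (at (cmap c p))"
    and "d\<sigma> d (cmap d p) (transition c d p u) = d\<sigma> c (cmap c p) u"
proof -
  have c': "c \<in> atlas N" "p \<in> cdom c" using c by (auto simp: charts_at_def)
  have D: "((\<lambda>x. id (cinv c x)) has_derivative d\<sigma> c (cmap c p)) (at (cmap c p))"
    unfolding id_apply by (rule d\<sigma>[OF c'(1) cmap_in[OF c'(2)]])
  have d': "d \<in> charts_at N (id p)" using d by simp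
  obtain B where "((cmap d \<circ> id \<circ> cinv c) has_derivative B) (at (cmap c p))"
    "\<And>u. d\<sigma> d (cmap d (id p)) (B u) = d\<sigma> c (cmap c p) u"
    by (rule lift_derivative[OF c d' continuous_map_id D]) blast
  then have B: "((cmap d \<circ> cinv c) has_derivative B) (at (cmap c p))"
    "\<And>u. d\<sigma> d (cmap d p) (B u) = d\<sigma> c (cmap c p) u" by (simp_all only: comp_id id_apply)
  show "(cmap d \<circ> cinv c) differentiable (at (cmap c p))"
    using B(1) unfolding differentiable_def by blast
  show "d\<sigma> d (cmap d p) (transition c d p u) = d\<sigma> c (cmap c p) u"
    by (simp only: frechet_derivative_eqI[OF B(1)] B(2))
qed

lemma charts_differentiable_N: "charts_differentiable_at N p"
  unfolding charts_differentiable_at_def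
  using transition_N(1) atlas_N(1) by (auto simp: mtop_N charts_at_def)

definition c0 :: "('v, 'e) chart" where "c0 = (SOME c. c \<in> charts_at N i)"

lemma c0_at: "c0 \<in> charts_at N i"
  unfolding c0_def using chart_exists some_in_eq by blast

lemma c0_atlas: "c0 \<in> atlas N" and one_in_c0: "i \<in> cdom c0"
  using c0_at by (auto simp: charts_at_def)

text \<open>The tangent vector at the identity as a vector of the ambient space.\<close>

definition \<Psi> :: "('v, 'e) tvec \<Rightarrow> 'v" where "\<Psi> v = d\<sigma> c0 (cmap c0 i) (v c0)"

lemma range_d\<sigma>:
  assumes "c \<in> charts_at N i" "d \<in> charts_at N i"
  shows "range (d\<sigma> c (cmap c i)) \<subseteq> range (d\<sigma> d (cmap d i))"
  using transition_N(2)[OF assms] by (metis image_subsetI rangeI)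

text \<open>The left invariant field with value \<open>V\<close> at the identity has the value \<open>a V\<close> at \<open>a\<close>.\<close>

lemma left_field:
  assumes a: "a \<in> S" and d: "d \<in> charts_at N a"
  shows "d\<sigma> d (cmap d a) (left_invariant_field H N v a d) = prd a (\<Psi> v)"
proof -
  have lt: "left_translation H a = prd a" by (simp add: H_def left_translation_def fun_eq_iff)
  have one: "\<one>\<^bsub>H\<^esub> = i" by (simp add: H_def)
  have cont: "continuous_map (top_of_set S) (top_of_set S) (prd a)"
    using closed[OF a] linear_continuous_on[OF bounded_bilinear.bounded_linear_right[OF prd]]
    by (auto simp: Pi_iff)
  have D: "((\<lambda>x. prd a (cinv c0 x)) has_derivative (\<lambda>u. prd a (d\<sigma> c0 (cmap c0 i) u))) (at (cmap c0 i))"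
    by (rule bounded_linear.has_derivative[OF bounded_bilinear.bounded_linear_right[OF prd]])
      (rule d\<sigma>[OF c0_atlas cmap_in[OF one_in_c0]])
  have d': "d \<in> charts_at N (prd a i)" using d by (simp add: one_right)
  obtain B where B: "((cmap d \<circ> prd a \<circ> cinv c0) has_derivative B) (at (cmap c0 i))"
    "\<And>u. d\<sigma> d (cmap d a) (B u) = prd a (d\<sigma> c0 (cmap c0 i) u)"
    using lift_derivative[OF c0_at d' cont D] unfolding one_right by metis
  have "left_invariant_field H N v a d = B (v c0)"
    using d' frechet_derivative_eqI[OF B(1)]
    by (simp add: left_invariant_field_def tangent_map_def Let_def lt one flip: c0_def)
  then show ?thesis by (simp add: B(2) \<Psi>_def)
qed

text \<open>Let \<open>\<sigma>\<close> be the parametrization and \<open>\<zeta> v\<close> the component vector of the left invariant field of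
  \<open>v\<close>, so that \<open>\<sigma>' (\<zeta> v) = \<sigma> V\<close> with \<open>V = \<Psi> v\<close>.  Differentiating this relation for \<open>v\<close> along \<open>w\<close>
  and vice versa, and subtracting, the second derivative of \<open>\<sigma>\<close> drops out by symmetry, and the
  commutator remains.\<close>

lemma lie_bracket_N:
  assumes d: "d \<in> charts_at N i"
  shows "d\<sigma> d (cmap d i) (lie_bracket H N v w d) = prd (\<Psi> v) (\<Psi> w) - prd (\<Psi> w) (\<Psi> v)"
proof -
  let ?x = "cmap d i"
  have dN: "d \<in> atlas N" "i \<in> cdom d" using d by (auto simp: charts_at_def)
  note cd = atlas_N(1)[OF dN(1)]
  have x: "?x \<in> cimg d" by (rule cmap_in[OF dN(2)])
  have ci: "cinv d ?x = i" by (rule cinv_cmap[OF cd dN(2)])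
  define \<zeta> where "\<zeta> v x = left_invariant_field H N v (cinv d x) d" for v x
  have ev: "\<forall>\<^sub>F y in nhds ?x. y \<in> cimg d"
    unfolding eventually_nhds using atlas_N(3)[OF dN(1)] x by blast
  have eq: "d\<sigma> d y (\<zeta> v y) = prd (cinv d y) (\<Psi> v)" if y: "y \<in> cimg d" for v y
  proof -
    have "cinv d y \<in> S" using cinv_in[OF y] chart_on_subset[OF cd] by auto
    moreover have "d \<in> charts_at N (cinv d y)" using dN(1) cinv_in[OF y] by (simp add: charts_at_def)
    ultimately show ?thesis using left_field[of "cinv d y" d v] by (simp add: \<zeta>_def cmap_cinv[OF y])
  qed
  define Q where "Q w u = frechet_derivative (\<lambda>y. d\<sigma> d y w) (at ?x) u" for w u
  have Q: "((\<lambda>y. d\<sigma> d y w) has_derivative Q w) (at ?x)" for w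
    using smooth_on_derivative_differentiable[OF atlas_N(2,3)[OF dN(1)] x, of w]
    unfolding Q_def d\<sigma>_def frechet_derivative_works by simp
  have Qsym: "Q w u = Q u w" for u w
    by (rule mixed_derivatives_eq[OF atlas_N(3)[OF dN(1)] x d\<sigma>[OF dN(1)] Q Q])
  have lin: "\<forall>\<^sub>F y in nhds ?x. linear (d\<sigma> d y)"
    using ev by (rule eventually_mono) (rule linear_d\<sigma>[OF dN(1)])
  have P: "((\<lambda>y. prd (cinv d y) (\<Psi> v)) has_derivative (\<lambda>u. prd (d\<sigma> d ?x u) (\<Psi> v))) (at ?x)" for v
    by (rule bounded_linear.has_derivative[OF bounded_bilinear.bounded_linear_left[OF prd] d\<sigma>[OF dN(1) x]])
  have evq: "\<forall>\<^sub>F y in nhds ?x. d\<sigma> d y (\<zeta> v y) = prd (cinv d y) (\<Psi> v)" for v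
    using ev by (rule eventually_mono) (rule eq)
  define \<zeta>' where "\<zeta>' v = frechet_derivative (\<zeta> v) (at ?x)" for v
  have "\<zeta> v differentiable (at ?x)" for v
    by (rule linear_system_solution_differentiable[OF lin Q P evq]) (rule inj_d\<sigma>0[OF dN(1) x])
  then have \<zeta>': "(\<zeta> v has_derivative \<zeta>' v) (at ?x)" for v
    by (simp add: \<zeta>'_def frechet_derivative_works)
  have main: "Q (\<zeta> v ?x) u + d\<sigma> d ?x (\<zeta>' v u) = prd (d\<sigma> d ?x u) (\<Psi> v)" for v u
  proof -
    have "((\<lambda>y. d\<sigma> d y (\<zeta> v y)) has_derivative (\<lambda>u. Q (\<zeta> v ?x) u + d\<sigma> d ?x (\<zeta>' v u))) (at ?x)"
      by (rule has_derivative_linear_family[OF lin Q \<zeta>'])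
    moreover have "((\<lambda>y. d\<sigma> d y (\<zeta> v y)) has_derivative (\<lambda>u. prd (d\<sigma> d ?x u) (\<Psi> v))) (at ?x)"
      by (rule has_derivative_cong_nhds[OF evq P])
    ultimately have "(\<lambda>u. Q (\<zeta> v ?x) u + d\<sigma> d ?x (\<zeta>' v u)) = (\<lambda>u. prd (d\<sigma> d ?x u) (\<Psi> v))"
      by (rule has_derivative_unique)
    then show ?thesis by (rule fun_cong)
  qed
  have at_one: "d\<sigma> d ?x (\<zeta> v ?x) = \<Psi> v" for v
    using eq[OF x, of v] by (simp add: ci one_left)
  have one: "\<one>\<^bsub>H\<^esub> = i" by (simp add: H_def)
  have "lie_bracket H N v w d = \<zeta>' w (\<zeta> v ?x) - \<zeta>' v (\<zeta> w ?x)"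
    using d by (simp add: lie_bracket_def vf_bracket_def one \<zeta>'_def \<zeta>_def[abs_def] ci)
  then have "d\<sigma> d ?x (lie_bracket H N v w d) = d\<sigma> d ?x (\<zeta>' w (\<zeta> v ?x)) - d\<sigma> d ?x (\<zeta>' v (\<zeta> w ?x))"
    using linear_diff[OF linear_d\<sigma>[OF dN(1) x]] by simp
  moreover have "d\<sigma> d ?x (\<zeta>' v (\<zeta> w ?x)) = prd (\<Psi> w) (\<Psi> v) - Q (\<zeta> v ?x) (\<zeta> w ?x)" for v w
    using main[of v "\<zeta> w ?x"] by (simp add: at_one eq_diff_eq add.commute)
  ultimately show ?thesis
    using Qsym[of "\<zeta> w ?x" "\<zeta> v ?x"] by simp
qed

lemma lie_bracket_tangent: "lie_bracket H N v w \<in> tangent_space N i"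
proof -
  have "lie_bracket H N v w d = transition c d i (lie_bracket H N v w c)"
    if c: "c \<in> charts_at N i" and d: "d \<in> charts_at N i" for c d
  proof (rule inj_d\<sigma>[of d "cmap d i"])
    show "d \<in> atlas N" "cmap d i \<in> cimg d" using d by (auto simp: charts_at_def cmap_in)
    show "d\<sigma> d (cmap d i) (lie_bracket H N v w d) = d\<sigma> d (cmap d i) (transition c d i (lie_bracket H N v w c))"
      by (simp only: transition_N(2)[OF c d] lie_bracket_N[OF c] lie_bracket_N[OF d])
  qed
  moreover have "lie_bracket H N v w c = 0" if "c \<notin> charts_at N i" for c
    using that by (simp add: lie_bracket_def vf_bracket_def H_def)
  ultimately show ?thesis unfolding tangent_space_def by blast
qed

text \<open>A linear map \<open>L\<close> into the matrices that respects the brackets yields the required map of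
  tangent vectors, by transport to the components in the chosen charts.  It is bijective for
  reasons of dimension.\<close>

theorem locally_isomorphic_embedded_group:
  fixes L :: "'f::euclidean_space \<Rightarrow> 'v"
  assumes G: "lie_group_canonical_chart G M c e0" and dim: "DIM('f) = DIM('e)"
    and d: "d \<in> charts_at N i"
    and L: "linear L" "\<And>u. L u = 0 \<Longrightarrow> u = 0" "range L \<subseteq> range (d\<sigma> d (cmap d i))"
    and br: "\<And>u w. L (lie_group_chart.bracket G c e0 u w) = prd (L u) (L w) - prd (L w) (L u)"
  shows "locally_isomorphic G (M :: ('a, 'f) manifold) H N"
proof -
  interpret G: lie_group_canonical_chart G M c e0 by (rule G)
  note cM = G.charts_differentiable G.c_at_one
  note cN = charts_differentiable_N c0_at
  let ?s = "d\<sigma> c0 (cmap c0 i)"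
  have s: "linear ?s" "inj ?s"
    using linear_d\<sigma>[OF c0_atlas cmap_in[OF one_in_c0]] inj_d\<sigma>[OF c0_atlas cmap_in[OF one_in_c0]]
    by (auto intro: injI)
  obtain R where R: "linear R" "R \<circ> ?s = id"
    using linear_injective_left_inverse[OF s] by blast
  define \<theta> where "\<theta> u = R (L u)" for u
  have s\<theta>: "?s (\<theta> u) = L u" for u
  proof -
    have "L u \<in> range ?s" using L(3) range_d\<sigma>[OF d c0_at] by blast
    then obtain y where "L u = ?s y" by blast
    then show ?thesis using R(2) by (simp add: \<theta>_def fun_eq_iff)
  qed
  have l\<theta>: "linear \<theta>"
    unfolding \<theta>_def using linear_compose[OF L(1) R(1)] by (simp add: o_def)
  have inj\<theta>: "inj \<theta>"
    unfolding linear_injective_0[OF l\<theta>] using s\<theta> L(2) linear_0[OF s(1)] by metis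
  have "dim (range \<theta>) = DIM('e)"
    using dim_image_eq[OF l\<theta>, of UNIV] inj\<theta> dim by simp
  then have "range \<theta> = UNIV"
    using subspace_dim_equal[OF linear_subspace_image[OF l\<theta> subspace_UNIV] subspace_UNIV] by simp
  then have surj\<theta>: "surj \<theta>" .
  define \<phi> where "\<phi> v = coord_vec N c0 (\<theta> (v c)) i" for v :: "('a, 'f) tvec"
  have \<phi>c: "\<phi> v c0 = \<theta> (v c)" for v
    by (simp add: \<phi>_def coord_vec_component[OF cN])
  have \<phi>_in: "\<phi> v \<in> tangent_space N i" for v
    by (simp add: \<phi>_def coord_vec_in[OF cN])
  have \<Psi>\<phi>: "\<Psi> (\<phi> v) = L (v c)" for v
    by (simp add: \<Psi>_def \<phi>c s\<theta>)
  have alg: "lie_algebra G M = tangent_space M \<one>\<^bsub>G\<^esub>" "lie_algebra H N = tangent_space N i"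
    by (simp_all add: lie_algebra_def H_def)
  have "bij_betw \<phi> (lie_algebra G M) (lie_algebra H N)"
    unfolding alg bij_betw_def
  proof
    show "inj_on \<phi> (tangent_space M \<one>\<^bsub>G\<^esub>)"
    proof (rule inj_onI)
      fix v w assume vw: "v \<in> tangent_space M \<one>\<^bsub>G\<^esub>" "w \<in> tangent_space M \<one>\<^bsub>G\<^esub>" "\<phi> v = \<phi> w"
      then have "\<theta> (v c) = \<theta> (w c)" using \<phi>c by metis
      then have "v c = w c" using inj\<theta> by (simp add: inj_eq)
      then show "v = w" using tangent_eqI[OF cM vw(1,2)] by simp
    qed
    show "\<phi> ` tangent_space M \<one>\<^bsub>G\<^esub> = tangent_space N i"
    proof
      show "\<phi> ` tangent_space M \<one>\<^bsub>G\<^esub> \<subseteq> tangent_space N i" using \<phi>_in by blast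
      show "tangent_space N i \<subseteq> \<phi> ` tangent_space M \<one>\<^bsub>G\<^esub>"
      proof
        fix y assume y: "y \<in> tangent_space N i"
        obtain u where u: "y c0 = \<theta> u" using surj\<theta> by (metis surjD)
        have "y = \<phi> (coord_vec M c u \<one>\<^bsub>G\<^esub>)"
          using coord_vec_eq[OF cN y] by (simp add: \<phi>_def coord_vec_component[OF cM] u)
        then show "y \<in> \<phi> ` tangent_space M \<one>\<^bsub>G\<^esub>" using coord_vec_in[OF cM] by blast
      qed
    qed
  qed
  moreover have "\<phi> (tv_add v w) = tv_add (\<phi> v) (\<phi> w)" "\<phi> (tv_scale r v) = tv_scale r (\<phi> v)"
    for v w r
    by (simp_all add: \<phi>_def tv_add_def[of v] tv_scale_def[of r v] linear_add[OF l\<theta>] linear_cmul[OF l\<theta>]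
        coord_vec_add[OF cN] coord_vec_scale[OF cN])
  moreover have "\<phi> (lie_bracket G M v w) = lie_bracket H N (\<phi> v) (\<phi> w)" for v w
  proof (rule tangent_eqI[OF cN \<phi>_in lie_bracket_tangent])
    have "?s (\<phi> (lie_bracket G M v w) c0) = ?s (lie_bracket H N (\<phi> v) (\<phi> w) c0)"
      by (simp add: lie_bracket_N[OF c0_at] \<phi>c s\<theta> G.lie_bracket_component br \<Psi>\<phi>)
    then show "\<phi> (lie_bracket G M v w) c0 = lie_bracket H N (\<phi> v) (\<phi> w) c0"
      using s(2) by (simp add: inj_eq)
  qed
  ultimately show ?thesis unfolding locally_isomorphic_def by blast
qed

end

context embedded_group
begin

text \<open>Brackets are bilinear, so it suffices to compare them on a basis.\<close>

lemma locally_isomorphic_by_basis: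
  fixes \<xi> u w :: "'f::euclidean_space" and M :: "('a, 'f) manifold"
  assumes G: "lie_group_canonical_chart G M c e0" and dim: "DIM('f) = DIM('e)"
    and ind: "independent {\<xi>, u, w}" "\<xi> \<noteq> u" "\<xi> \<noteq> w" "u \<noteq> w"
    and span: "\<And>x. \<exists>a b c. x = a *\<^sub>R \<xi> + b *\<^sub>R u + c *\<^sub>R w"
    and B: "lie_group_chart.bracket G c e0 \<xi> u = w" "lie_group_chart.bracket G c e0 \<xi> w = p *\<^sub>R u"
      "lie_group_chart.bracket G c e0 u w = q *\<^sub>R \<xi>"
    and d: "d \<in> charts_at N i"
    and E: "prd E1 E2 - prd E2 E1 = E3" "prd E1 E3 - prd E3 E1 = p *\<^sub>R E2"
      "prd E2 E3 - prd E3 E2 = q *\<^sub>R E1"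
    and range: "{E1, E2, E3} \<subseteq> range (frechet_derivative (cinv d) (at (cmap d i)))"
    and E_ind: "\<And>a b c. a *\<^sub>R E1 + b *\<^sub>R E2 + c *\<^sub>R E3 = 0 \<Longrightarrow> a = 0 \<and> b = 0 \<and> c = 0"
  shows "locally_isomorphic G M H N"
proof -
  interpret G: lie_group_canonical_chart G M c e0 by (rule G)
  define f where "f x = (if x = \<xi> then E1 else if x = u then E2 else E3)" for x
  obtain L where L: "linear L" "\<And>x. x \<in> {\<xi>, u, w} \<Longrightarrow> L x = f x"
    using linear_independent_extend[OF ind(1), of f] by blast
  have Lv: "L \<xi> = E1" "L u = E2" "L w = E3"
    using L(2) ind(2-4) by (auto simp: f_def)
  have L_eq: "L (a *\<^sub>R \<xi> + b *\<^sub>R u + c *\<^sub>R w) = a *\<^sub>R E1 + b *\<^sub>R E2 + c *\<^sub>R E3" for a b c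
    by (simp add: linear_add[OF L(1)] linear_cmul[OF L(1)] Lv)
  have dN: "d \<in> atlas N" "i \<in> cdom d" using d by (auto simp: charts_at_def)
  have ls: "linear (d\<sigma> d (cmap d i))" by (rule linear_d\<sigma>[OF dN(1) cmap_in[OF dN(2)]])
  have L_range: "L x \<in> range (d\<sigma> d (cmap d i))" for x
  proof -
    obtain a b c where x: "x = a *\<^sub>R \<xi> + b *\<^sub>R u + c *\<^sub>R w" using span by blast
    have "subspace (range (d\<sigma> d (cmap d i)))"
      by (rule linear_subspace_image[OF ls subspace_UNIV])
    then show ?thesis
      unfolding x L_eq using range unfolding d\<sigma>_def[symmetric]
      by (intro subspace_add subspace_scale) auto
  qed
  have L0: "x = 0" if "L x = 0" for x
  proof -
    obtain a b c where x: "x = a *\<^sub>R \<xi> + b *\<^sub>R u + c *\<^sub>R w" using span by blast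
    then show ?thesis using that E_ind[of a b c] L_eq by simp
  qed
  define K where "K X Y = prd X Y - prd Y X" for X Y
  have K: "bilinear K"
    unfolding bilinear_def K_def
    by (auto intro!: bounded_linear_sub bounded_bilinear.bounded_linear_left[OF prd]
        bounded_bilinear.bounded_linear_right[OF prd] simp: linear_conv_bounded_linear)
  have K_anti: "K X Y = - K Y X" for X Y by (simp add: K_def)
  have K0: "K X X = 0" for X by (simp add: K_def)
  have G0: "G.bracket x x = 0" for x by (simp add: G.bracket_def)
  have KE: "K E1 E2 = E3" "K E1 E3 = p *\<^sub>R E2" "K E2 E3 = q *\<^sub>R E1"
    using E by (simp_all add: K_def)
  have BL: "linear (G.bracket x)" "linear (\<lambda>x. G.bracket x y)" for x y
    using G.bilinear_bracket by (simp_all add: bilinear_def)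
  have KL: "linear (K x)" "linear (\<lambda>x. K x y)" for x y
    using K by (simp_all add: bilinear_def)
  have br: "L (G.bracket x y) = K (L x) (L y)" for x y
  proof (rule bilinear_eq[where f = "\<lambda>x y. L (G.bracket x y)" and g = "\<lambda>x y. K (L x) (L y)"])
    show "bilinear (\<lambda>x y. L (G.bracket x y))" "bilinear (\<lambda>x y. K (L x) (L y))"
      by (simp_all add: bilinear_def linear_compose[OF BL(1) L(1), unfolded o_def]
          linear_compose[OF BL(2) L(1), unfolded o_def] linear_compose[OF L(1) KL(1), unfolded o_def]
          linear_compose[OF L(1) KL(2), unfolded o_def])
    have "x \<in> span {\<xi>, u, w}" for x
    proof -
      obtain a b c where x: "x = a *\<^sub>R \<xi> + b *\<^sub>R u + c *\<^sub>R w" using span by blast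
      show ?thesis unfolding x by (intro span_add span_scale span_base) auto
    qed
    then show "UNIV \<subseteq> span {\<xi>, u, w}" "UNIV \<subseteq> span {\<xi>, u, w}" by auto
    show "L (G.bracket y z) = K (L y) (L z)" if "y \<in> {\<xi>, u, w}" "z \<in> {\<xi>, u, w}" for y z
      using that G.bracket_anti[of u \<xi>] G.bracket_anti[of w \<xi>] G.bracket_anti[of w u]
        K_anti[of E2 E1] K_anti[of E3 E1] K_anti[of E3 E2]
      by (elim insertE emptyE; hypsubst)
        (simp_all only: Lv B KE G0 K0 linear_0[OF L(1)] linear_neg[OF L(1)] linear_cmul[OF L(1)])
  qed simp_all
  show ?thesis
    by (rule locally_isomorphic_embedded_group[OF G dim d L(1) L0])
      (use L_range br in \<open>auto simp: K_def\<close>)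
qed

end

section \<open>The Lie algebras of SL(2,R) and SU(2)\<close>

definition mat2 :: "'a \<Rightarrow> 'a \<Rightarrow> 'a \<Rightarrow> 'a \<Rightarrow> 'a::zero^2^2" where
  "mat2 a b c d = vector [vector [a, b], vector [c, d]]"

lemma mat2_nth [simp]:
  "mat2 a b c d $ 1 $ 1 = a" "mat2 a b c d $ 1 $ 2 = b"
  "mat2 a b c d $ 2 $ 1 = c" "mat2 a b c d $ 2 $ 2 = d"
  by (simp_all add: mat2_def)

lemma mat2_eqI:
  "A $ 1 $ 1 = B $ 1 $ 1 \<Longrightarrow> A $ 1 $ 2 = B $ 1 $ 2 \<Longrightarrow> A $ 2 $ 1 = B $ 2 $ 1 \<Longrightarrow> A $ 2 $ 2 = B $ 2 $ 2 \<Longrightarrow> A = (B :: 'a^2^2)"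
  by (simp add: vec_eq_iff forall_2)

lemma mat2_eq_iff: "mat2 a b c d = mat2 a' b' c' d' \<longleftrightarrow> a = a' \<and> b = b' \<and> c = c' \<and> d = d'"
  by (auto simp: vec_eq_iff forall_2)

lemma mat2_eta: "A = mat2 (A $ 1 $ 1) (A $ 1 $ 2) (A $ 2 $ 1) (A $ 2 $ 2)"
  by (rule mat2_eqI) simp_all

lemma mat2_mult: "mat2 a b c d ** mat2 a' b' c' d' =
    mat2 (a * a' + b * c') (a * b' + b * d') (c * a' + d * c') (c * b' + d * (d'::'a::semiring_1))"
  by (rule mat2_eqI) (simp_all add: matrix_matrix_mult_def sum_2)

lemma mat2_add: "mat2 a b c d + mat2 a' b' c' d' = mat2 (a + a') (b + b') (c + c') (d + (d'::'a::monoid_add))"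
  by (rule mat2_eqI) simp_all

lemma mat2_diff: "mat2 a b c d - mat2 a' b' c' d' = mat2 (a - a') (b - b') (c - c') (d - (d'::'a::ab_group_add))"
  by (rule mat2_eqI) simp_all

lemma mat2_scaleR: "r *\<^sub>R mat2 a b c d = mat2 (r *\<^sub>R a) (r *\<^sub>R b) (r *\<^sub>R c) (r *\<^sub>R (d::'a::real_vector))"
  by (rule mat2_eqI) simp_all

lemma mat2_one: "mat 1 = mat2 1 0 0 (1::'a::semiring_1)"
  by (rule mat2_eqI) (simp_all add: mat_def)

lemma mat2_zero: "0 = mat2 0 0 0 (0::'a::zero)"
  by (rule mat2_eqI) simp_all

lemma mat2_det: "det (mat2 a b c d) = a * d - b * (c::'a::comm_ring_1)"
  by (simp add: det_2)

lemma mat2_adjoint: "transpose (map_matrix cnj (mat2 a b c d)) = mat2 (cnj a) (cnj c) (cnj b) (cnj d)"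
  by (rule mat2_eqI) (simp_all add: transpose_def)

lemma bounded_bilinear_matrix_mult:
  "bounded_bilinear ((**) :: 'a::{euclidean_space,real_algebra_1}^2^2 \<Rightarrow> 'a^2^2 \<Rightarrow> 'a^2^2)"
proof -
  have "bilinear ((**) :: 'a^2^2 \<Rightarrow> 'a^2^2 \<Rightarrow> 'a^2^2)"
    unfolding bilinear_def
    by (auto intro!: linearI mat2_eqI simp: matrix_matrix_mult_def sum_2 algebra_simps)
  then show ?thesis by (simp add: bilinear_conv_bounded_bilinear)
qed

lemma openin_entry_pos:
  fixes f :: "'v::euclidean_space \<Rightarrow> real"
  assumes "bounded_linear f" shows "openin (top_of_set S) {A \<in> S. f A > 0}"
proof -
  have "open {A. 0 < f A}"
    by (intro open_Collect_less continuous_intros linear_continuous_on assms)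
  moreover have "{A \<in> S. f A > 0} = S \<inter> {A. 0 < f A}" by auto
  ultimately show ?thesis by (simp add: openin_open_Int)
qed

lemma has_derivative_vec_nth: "((\<lambda>x. x $ k) has_derivative (\<lambda>u. u $ k)) (at (x :: real^'n))"
  by (rule bounded_linear_imp_has_derivative[OF bounded_linear_vec_nth])

lemma Ck_on_nth: "open S \<Longrightarrow> Ck_on k S (\<lambda>x :: real^'n. x $ i)"
  by (rule Ck_on_bounded_linear[OF _ bounded_linear_vec_nth])

lemma vec3_eqI: "x $ 1 = y $ 1 \<Longrightarrow> x $ 2 = y $ 2 \<Longrightarrow> x $ 3 = y $ 3 \<Longrightarrow> x = (y :: 'a^3)"
  by (simp add: vec_eq_iff forall_3)

text \<open>The lower right entry is determined by the others wherever the upper left one is not 0.\<close>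

definition sl_param :: "real^3 \<Rightarrow> real^2^2" where
  "sl_param x = mat2 (x $ 1) (x $ 2) (x $ 3) ((1 + x $ 2 * x $ 3) * inverse (x $ 1))"

definition sl_coords :: "real^2^2 \<Rightarrow> real^3" where
  "sl_coords A = vector [A $ 1 $ 1, A $ 1 $ 2, A $ 2 $ 1]"

lemma sl_param_alt:
  "sl_param = (\<lambda>x. x $ 1 *\<^sub>R mat2 1 0 0 0 + (x $ 2 *\<^sub>R mat2 0 1 0 0 + (x $ 3 *\<^sub>R mat2 0 0 1 0
    + ((1 + x $ 2 * x $ 3) * inverse (x $ 1)) *\<^sub>R mat2 0 0 0 1)))"
  by (auto simp: fun_eq_iff sl_param_def mat2_scaleR mat2_add)

lemma sl2_chart:
  obtains d where "d \<in> charts_at SL2R_manifold (mat 1)"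
    "\<And>u. frechet_derivative (cinv d) (at (cmap d (mat 1))) u = mat2 (u $ 1) (u $ 2) (u $ 3) (- (u $ 1))"
proof -
  let ?U = "{x :: real^3. 0 < x $ 1}" and ?V = "{A \<in> carrier SL2R. 0 < A $ 1 $ 1}"
  have U: "open ?U"
    by (intro open_Collect_less continuous_intros)
  have smooth: "smooth_on ?U sl_param"
    unfolding smooth_on_def sl_param_alt
    by (intro allI Ck_on_add[OF U] Ck_on_scaleR[OF U] Ck_on_mult[OF U] Ck_on_inverse[OF U] Ck_on_const[OF U] Ck_on_nth[OF U])
      auto
  have lin: "bounded_linear sl_coords"
    unfolding linear_conv_bounded_linear[symmetric]
    by (intro linearI vec3_eqI) (simp_all add: sl_coords_def)
  have i1: "sl_coords (sl_param x) = x" for x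
    by (rule vec3_eqI) (simp_all add: sl_coords_def sl_param_def)
  have i2: "sl_coords A \<in> ?U \<and> sl_param (sl_coords A) = A" if "A \<in> ?V" for A
  proof -
    have "A $ 1 $ 1 * A $ 2 $ 2 - A $ 1 $ 2 * A $ 2 $ 1 = 1" "A $ 1 $ 1 > 0"
      using that by (auto simp: SL2R_def det_2)
    then show ?thesis
      by (intro conjI mat2_eqI) (simp_all add: sl_coords_def sl_param_def field_simps)
  qed
  have i3: "sl_param x \<in> ?V" if "x \<in> ?U" for x
    using that by (simp add: sl_param_def SL2R_def mat2_det) (simp add: field_simps)
  have V: "openin (top_of_set (carrier SL2R)) ?V"
    by (rule openin_entry_pos) (intro bounded_linear_compose[OF bounded_linear_vec_nth bounded_linear_vec_nth])
  note chart = graph_chart[OF U smooth lin i1 i2 i3 V]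
  let ?d = "(?V, sl_coords)" and ?x = "vector [1, 0, 0] :: real^3"
  have one: "(mat 1 :: real^2^2) \<in> ?V" by (simp add: SL2R_def mat2_one mat2_det)
  have x: "sl_coords (mat 1) = ?x" "?x \<in> ?U"
    by (auto simp: sl_coords_def mat_def)
  have "(sl_param has_derivative (\<lambda>u. mat2 (u $ 1) (u $ 2) (u $ 3) (- (u $ 1)))) (at ?x)"
    unfolding sl_param_alt
    by (rule has_derivative_eq_rhs, (rule derivative_eq_intros has_derivative_vec_nth refl | simp)+)
      (simp add: fun_eq_iff mat2_scaleR mat2_add mat2_diff)
  then have "(cinv ?d has_derivative (\<lambda>u. mat2 (u $ 1) (u $ 2) (u $ 3) (- (u $ 1)))) (at ?x)"
    by (rule has_derivative_cong_nhds[rotated]) (use U x(2) chart(3) in \<open>auto simp: eventually_nhds\<close>)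
  then show ?thesis
    using that[of ?d] chart(1) one x(1) by (simp add: charts_at_def SL2R_manifold_def frechet_derivative_eqI)
qed

lemma embedded_group_SL2R: "embedded_group (carrier SL2R) (**) (mat 1) SL2R SL2R_manifold"
proof (rule embedded_group.intro)
  show "SL2R = \<lparr>carrier = carrier SL2R, mult = (**), one = mat 1\<rparr>" by (simp add: SL2R_def)
  show "SL2R_manifold = submanifold (carrier SL2R)" by (rule SL2R_manifold_def)
  show "bounded_bilinear ((**) :: real^2^2 \<Rightarrow> real^2^2 \<Rightarrow> real^2^2)" by (rule bounded_bilinear_matrix_mult)
  show "charts_at SL2R_manifold (mat 1) \<noteq> {}" using sl2_chart by blast
qed (simp_all add: SL2R_def det_mul)

text \<open>The real part of the upper left entry of a special unitary matrix near the identity, in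
  terms of the three remaining real parameters.\<close>

definition su_re :: "real^3 \<Rightarrow> real" where
  "su_re x = sqrt (1 - (x $ 1 * x $ 1 + x $ 2 * x $ 2 + x $ 3 * x $ 3))"

definition su_param :: "real^3 \<Rightarrow> complex^2^2" where
  "su_param x = mat2 (Complex (su_re x) (x $ 1)) (Complex (x $ 2) (x $ 3))
     (Complex (- (x $ 2)) (x $ 3)) (Complex (su_re x) (- (x $ 1)))"

definition su_coords :: "complex^2^2 \<Rightarrow> real^3" where
  "su_coords A = vector [Im (A $ 1 $ 1), Re (A $ 1 $ 2), Im (A $ 1 $ 2)]"

lemma su_param_alt:
  "su_param = (\<lambda>x. su_re x *\<^sub>R mat2 1 0 0 1 + (x $ 1 *\<^sub>R mat2 \<i> 0 0 (- \<i>)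
    + (x $ 2 *\<^sub>R mat2 0 1 (- 1) 0 + x $ 3 *\<^sub>R mat2 0 \<i> \<i> 0)))"
  by (auto simp: fun_eq_iff su_param_def mat2_scaleR mat2_add mat2_eq_iff complex_eq_iff)

text \<open>Multiply an entry of the second row by \<open>|z|\<^sup>2 + |w|\<^sup>2 = 1\<close>, the squared length of the first
  row, and regroup: what appears is the determinant, which is 1, and the inner product of the
  rows, which is 0.\<close>

lemma SU2_iff:
  "A \<in> carrier SU2 \<longleftrightarrow> (\<exists>z w. A = mat2 z w (- cnj w) (cnj z) \<and> z * cnj z + w * cnj w = 1)"
proof
  assume A: "A \<in> carrier SU2"
  obtain z w u v where A2: "A = mat2 z w u v" using mat2_eta by blast
  have eqs: "z * cnj z + w * cnj w = 1" "z * cnj u + w * cnj v = 0" "z * v - w * u = 1"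
    using A unfolding A2 SU2_def by (auto simp: mat2_adjoint mat2_mult mat2_one mat2_eq_iff mat2_det)
  have c: "cnj z * u + cnj w * v = 0"
    using arg_cong[OF eqs(2), of cnj] by simp
  have "v = v * (z * cnj z + w * cnj w)" using eqs(1) by simp
  also have "\<dots> = cnj z * (z * v - w * u) + w * (cnj z * u + cnj w * v)" by (simp add: algebra_simps)
  finally have v: "v = cnj z" using eqs c by simp
  have "u = u * (z * cnj z + w * cnj w)" using eqs(1) by simp
  also have "\<dots> = z * (cnj z * u + cnj w * v) - cnj w * (z * v - w * u)" by (simp add: algebra_simps)
  finally have u: "u = - cnj w" using eqs c by simp
  show "\<exists>z w. A = mat2 z w (- cnj w) (cnj z) \<and> z * cnj z + w * cnj w = 1"
    using A2 u v eqs(1) by blast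
next
  assume "\<exists>z w. A = mat2 z w (- cnj w) (cnj z) \<and> z * cnj z + w * cnj w = 1"
  then show "A \<in> carrier SU2"
    by (auto simp: SU2_def mat2_adjoint mat2_mult mat2_one mat2_eq_iff mat2_det algebra_simps)
qed

lemma su2_chart:
  obtains d where "d \<in> charts_at SU2_manifold (mat 1)"
    "\<And>u. frechet_derivative (cinv d) (at (cmap d (mat 1))) u
      = mat2 (Complex 0 (u $ 1)) (Complex (u $ 2) (u $ 3)) (Complex (- (u $ 2)) (u $ 3)) (Complex 0 (- (u $ 1)))"
proof -
  \<comment> \<open>The subtraction is written as an addition to match the closure rules for smooth functions.\<close>
  let ?r = "\<lambda>x :: real^3. 1 + (-1) * (x $ 1 * x $ 1 + x $ 2 * x $ 2 + x $ 3 * x $ 3)"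
  let ?U = "{x :: real^3. 0 < ?r x}" and ?V = "{A \<in> carrier SU2. 0 < Re (A $ 1 $ 1)}"
  have re: "su_re x = sqrt (?r x)" for x by (simp add: su_re_def)
  have U: "open ?U"
    by (intro open_Collect_less continuous_intros)
  have smooth: "smooth_on ?U su_param"
    unfolding smooth_on_def su_param_alt re
    by (intro allI Ck_on_add[OF U] Ck_on_scaleR[OF U] Ck_on_sqrt[OF U] Ck_on_mult[OF U] Ck_on_const[OF U] Ck_on_nth[OF U])
      auto
  have lin: "bounded_linear su_coords"
    unfolding linear_conv_bounded_linear[symmetric]
    by (intro linearI vec3_eqI) (simp_all add: su_coords_def)
  have i1: "su_coords (su_param x) = x" for x
    by (rule vec3_eqI) (simp_all add: su_coords_def su_param_def)
  have i2: "su_coords A \<in> ?U \<and> su_param (su_coords A) = A" if A: "A \<in> ?V" for A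
  proof -
    obtain z w where zw: "A = mat2 z w (- cnj w) (cnj z)" "z * cnj z + w * cnj w = 1"
      using A SU2_iff by blast
    have n: "Re z * Re z + Im z * Im z + (Re w * Re w + Im w * Im w) = 1"
      using arg_cong[OF zw(2), of Re] by simp
    have pos: "Re z > 0" using A zw(1) by simp
    have r: "?r (su_coords A) = Re z * Re z"
      using n by (simp add: su_coords_def zw(1))
    then have "su_re (su_coords A) = Re z" using pos by (simp only: re real_sqrt_abs2 abs_of_pos)
    moreover have "su_coords A \<in> ?U" using r pos by (simp only: mem_Collect_eq mult_pos_pos)
    ultimately show ?thesis
      by (simp add: su_param_def) (simp add: su_coords_def zw(1) mat2_eq_iff complex_eq_iff)
  qed
  have i3: "su_param x \<in> ?V" if "x \<in> ?U" for x
  proof -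
    have r: "su_re x > 0" "su_re x * su_re x = ?r x" using that by (simp_all add: re)
    have "su_param x \<in> carrier SU2"
      unfolding SU2_iff su_param_def
      by (intro exI[of _ "Complex (su_re x) (x $ 1)"] exI[of _ "Complex (x $ 2) (x $ 3)"])
        (use r(2) in \<open>simp add: mat2_eq_iff complex_eq_iff\<close>)
    then show ?thesis using r(1) by (simp add: su_param_def)
  qed
  have V: "openin (top_of_set (carrier SU2)) ?V"
    by (rule openin_entry_pos)
      (intro bounded_linear_compose[OF bounded_linear_Re]
        bounded_linear_compose[OF bounded_linear_vec_nth bounded_linear_vec_nth])
  note chart = graph_chart[OF U smooth lin i1 i2 i3 V]
  let ?d = "(?V, su_coords)" and ?x = "0 :: real^3"
  have one: "(mat 1 :: complex^2^2) \<in> ?V"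
    by (auto simp: SU2_iff mat2_one mat2_eq_iff)
  have x: "su_coords (mat 1) = ?x" "?x \<in> ?U"
    by (auto simp: su_coords_def mat_def intro: vec3_eqI)
  have "(su_re has_derivative (\<lambda>u. 0)) (at ?x)"
    unfolding su_re_def
    by (rule has_derivative_eq_rhs, (rule derivative_eq_intros has_derivative_vec_nth refl | simp)+)
  then have "(su_param has_derivative (\<lambda>u. 0 *\<^sub>R mat2 1 0 0 1 + (u $ 1 *\<^sub>R mat2 \<i> 0 0 (- \<i>)
    + (u $ 2 *\<^sub>R mat2 0 1 (- 1) 0 + u $ 3 *\<^sub>R mat2 0 \<i> \<i> 0)))) (at ?x)"
    unfolding su_param_alt
    by (intro has_derivative_add has_derivative_scaleR_left has_derivative_vec_nth)
  then have "(su_param has_derivative (\<lambda>u. mat2 (Complex 0 (u $ 1)) (Complex (u $ 2) (u $ 3))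
      (Complex (- (u $ 2)) (u $ 3)) (Complex 0 (- (u $ 1))))) (at ?x)"
    by (rule has_derivative_eq_rhs) (simp add: fun_eq_iff mat2_scaleR mat2_add mat2_eq_iff complex_eq_iff)
  then have "(cinv ?d has_derivative (\<lambda>u. mat2 (Complex 0 (u $ 1)) (Complex (u $ 2) (u $ 3))
      (Complex (- (u $ 2)) (u $ 3)) (Complex 0 (- (u $ 1))))) (at ?x)"
    by (rule has_derivative_cong_nhds[rotated]) (use U x(2) chart(3) in \<open>auto simp: eventually_nhds\<close>)
  then show ?thesis
    using that[of ?d] chart(1) one x(1) by (simp add: charts_at_def SU2_manifold_def frechet_derivative_eqI)
qed

lemma embedded_group_SU2: "embedded_group (carrier SU2) (**) (mat 1) SU2 SU2_manifold"
proof (rule embedded_group.intro)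
  show "SU2 = \<lparr>carrier = carrier SU2, mult = (**), one = mat 1\<rparr>" by (simp add: SU2_def)
  show "SU2_manifold = submanifold (carrier SU2)" by (rule SU2_manifold_def)
  show "bounded_bilinear ((**) :: complex^2^2 \<Rightarrow> complex^2^2 \<Rightarrow> complex^2^2)" by (rule bounded_bilinear_matrix_mult)
  show "charts_at SU2_manifold (mat 1) \<noteq> {}" using su2_chart by blast
  show "A ** B \<in> carrier SU2" if AB: "A \<in> carrier SU2" "B \<in> carrier SU2" for A B
  proof -
    obtain z w where A: "A = mat2 z w (- cnj w) (cnj z)" "z * cnj z + w * cnj w = 1"
      using AB SU2_iff by blast
    obtain z' w' where B: "B = mat2 z' w' (- cnj w') (cnj z')" "z' * cnj z' + w' * cnj w' = 1"
      using AB SU2_iff by blast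
    let ?z = "z * z' - w * cnj w'" and ?w = "z * w' + w * cnj z'"
    have "?z * cnj ?z + ?w * cnj ?w = (z * cnj z + w * cnj w) * (z' * cnj z' + w' * cnj w')"
      by (simp add: algebra_simps)
    then have "?z * cnj ?z + ?w * cnj ?w = 1" using A(2) B(2) by simp
    moreover have "A ** B = mat2 ?z ?w (- cnj ?w) (cnj ?z)"
      by (simp add: A(1) B(1) mat2_mult mat2_eq_iff algebra_simps)
    ultimately show ?thesis unfolding SU2_iff by blast
  qed
qed simp_all

section \<open>Left invariant contact forms on groups with a bi-invariant metric\<close>

lemma wedge_compose:
  "wedge k l \<alpha> \<beta> (\<lambda>j. f (v j)) = wedge k l (\<lambda>v. \<alpha> (\<lambda>j. f (v j))) (\<lambda>v. \<beta> (\<lambda>j. f (v j))) v"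
  by (simp add: wedge_def)

lemma wedge_power_compose:
  "wedge_power k \<alpha> n (\<lambda>j. f (v j)) = wedge_power k (\<lambda>v. \<alpha> (\<lambda>j. f (v j))) n v"
  by (induction n arbitrary: v) (simp_all add: wedge_compose)

context lie_group_canonical_chart
begin

text \<open>The vector \<open>\<xi>\<close> that represents \<open>\<eta>\<close> has \<open>[\<xi>, x] = 0\<close> exactly if \<open>x\<close> is in the kernel of \<open>d\<eta>\<close>.
  If \<open>\<eta> \<xi>\<close> were 0, then \<open>\<xi>\<close> would be a common kernel vector of \<open>d\<eta>\<close> and \<open>\<eta>\<close>, hence 0, and both
  forms would vanish.\<close>

lemma contact_quadratic_lie_algebra:
  assumes g: "semi_riemannian_metric M g" "bi_invariant_metric G M g"
    and eta: "left_invariant_contact_form G M n \<eta>"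
  obtains b \<xi> where "quadratic_lie_algebra bracket b \<xi>"
proof -
  define b where "b u w = g \<one> (coord_vec M c u \<one>) (coord_vec M c w \<one>)" for u w
  note metric = invariant_metric_on_lie_algebra[OF g, folded b_def]
  have n: "n \<ge> 1" "DIM('e) = 2 * n + 1" and "smooth_one_form M \<eta>" "left_invariant_form G M \<eta>"
    and contact: "\<forall>p\<in>topspace (mtop M). \<exists>v. (\<forall>i. v i \<in> tangent_space M p) \<and>
        wedge (2 * n) 1 (wedge_power 2 (\<lambda>u. ext_deriv M \<eta> p (u 0) (u 1)) n) (\<lambda>u. \<eta> p (u 0)) v \<noteq> 0"
    using eta by (auto simp: left_invariant_contact_form_def)
  define k where "k u = \<eta> \<one> (coord_vec M c u \<one>)" for u
  note form = invariant_form_on_lie_algebra[OF \<open>smooth_one_form M \<eta>\<close> \<open>left_invariant_form G M \<eta>\<close>, folded k_def]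
  define \<omega> where "\<omega> u w = - k (bracket u w)" for u w
  have "\<one> \<in> topspace (mtop M)" using carrier_eq by auto
  then obtain v where v: "\<And>i. v i \<in> tangent_space M \<one>"
    "wedge (2 * n) 1 (wedge_power 2 (\<lambda>u. ext_deriv M \<eta> \<one> (u 0) (u 1)) n) (\<lambda>u. \<eta> \<one> (u 0)) v \<noteq> 0"
    using contact by blast
  define f where "f u = coord_vec M c u \<one>" for u
  have fv: "v = (\<lambda>i. f (v i c))"
    using coord_vec_eq[OF charts_differentiable c_at_one v(1)] by (simp add: f_def)
  have ext: "ext_deriv M \<eta> \<one> (f u) (f w) = \<omega> u w" for u w
    unfolding form(2) by (simp add: \<omega>_def f_def coord_vec_component[OF charts_differentiable c_at_one])
  have eta_f: "\<eta> \<one> (f u) = k u" for u by (simp add: k_def f_def)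
  have nz: "wedge (2 * n) 1 (wedge_power 2 (\<lambda>u. \<omega> (u 0) (u 1)) n) (\<lambda>u. k (u 0)) (\<lambda>i. v i c) \<noteq> 0"
    using v(2) by (subst (asm) fv) (simp only: wedge_compose[where f = f and v = "\<lambda>i. v i c"] wedge_power_compose[where f = f] ext eta_f not_False_eq_True)
  have "bilinear \<omega>"
    using bilinear_bracket form(1) unfolding bilinear_def \<omega>_def
    by (auto intro!: linear_compose_neg linear_compose[of _ k, unfolded o_def])
  moreover have "\<omega> x y = - \<omega> y x" for x y
    using bracket_anti[of x y] linear_neg[OF form(1)] by (simp add: \<omega>_def)
  ultimately have kernel: "x = 0" if "\<And>y. \<omega> x y = 0" "k x = 0" for x
    using contact_form_nondegenerate[OF n(2) _ form(1) _ nz, of x] that by blast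
  obtain \<xi> where \<xi>: "\<And>y. b \<xi> y = k y"
    using nondegenerate_form_represents[OF metric(1,3) form(1)] by blast
  have kernel': "x = 0" if x: "bracket \<xi> x = 0" "k x = 0" for x
  proof (rule kernel)
    show "\<omega> x y = 0" for y
      using metric(4)[of \<xi> x y] x(1) bilinear_lzero[OF metric(1)] by (simp add: \<omega>_def \<xi>)
  qed (rule x(2))
  have bracket_self: "bracket u u = 0" for u by (simp add: bracket_def)
  have k\<xi>: "k \<xi> \<noteq> 0"
  proof
    assume "k \<xi> = 0"
    then have "\<xi> = 0" by (rule kernel'[OF bracket_self])
    then have k0: "k y = 0" for y
      using \<xi>[of y] bilinear_lzero[OF metric(1)] by simp
    have "x = 0" for x :: 'e
      by (rule kernel) (simp_all add: \<omega>_def k0)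
    then show False by (metis nonempty_Basis nonzero_Basis ex_in_conv)
  qed
  have "quadratic_lie_algebra bracket b \<xi>"
  proof
    show "bilinear bracket" by (rule bilinear_bracket)
    show "bracket x y = - bracket y x" for x y by (rule bracket_anti)
    show "bracket x (bracket y z) = bracket (bracket x y) z + bracket y (bracket x z)" for x y z by (rule bracket_jacobi)
    show "bilinear b" by (rule metric(1))
    show "b x y = b y x" for x y by (rule metric(2))
    show "x = 0" if "\<And>y. b x y = 0" for x using that by (rule metric(3))
    show "b (bracket x y) z = b x (bracket y z)" for x y z by (rule metric(4))
    show "b \<xi> \<xi> \<noteq> 0" using k\<xi> by (simp add: \<xi>)
    show "\<exists>a. x = a *\<^sub>R \<xi>" if x: "bracket \<xi> x = 0" for x
    proof -
      let ?y = "x - (k x / k \<xi>) *\<^sub>R \<xi>"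
      have "bracket \<xi> ?y = 0"
        using x bracket_self by (simp add: bilinear_rsub[OF bilinear_bracket] bilinear_rmul[OF bilinear_bracket])
      moreover have "k ?y = 0"
        using k\<xi> by (simp add: linear_diff[OF form(1)] linear_cmul[OF form(1)])
      ultimately have "?y = 0" by (rule kernel')
      then show ?thesis by auto
    qed
  qed
  then show ?thesis by (rule that)
qed

end

theorem theorem3:
  fixes G :: "'a monoid" and M :: "('a, 'e::euclidean_space) manifold"
  assumes "lie_group G M"
    and "\<exists>g. (riemannian_metric M g \<or> semi_riemannian_metric M g) \<and> bi_invariant_metric G M g"
    and "\<exists>n \<eta>. left_invariant_contact_form G M n \<eta>"
  shows "locally_isomorphic G M SL2R SL2R_manifold \<or> locally_isomorphic G M SU2 SU2_manifold"
proof -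
  obtain g where g: "semi_riemannian_metric M g" "bi_invariant_metric G M g"
    using assms(2) unfolding riemannian_metric_def by blast
  obtain n \<eta> where eta: "left_invariant_contact_form G M n \<eta>"
    using assms(3) by blast
  interpret lie_group G M by (rule assms(1))
  define c where "c = (SOME c. c \<in> charts_at M \<one>\<^bsub>G\<^esub>)"
  define e0 where "e0 = cmap c \<one>\<^bsub>G\<^esub>"
  have "\<one>\<^bsub>G\<^esub> \<in> topspace (mtop M)" using carrier_eq one_closed by blast
  then have "c \<in> charts_at M \<one>\<^bsub>G\<^esub>"
    unfolding c_def using atlas_chart some_in_eq by blast
  then have C: "lie_group_canonical_chart G M c e0"
    by unfold_locales (simp_all add: e0_def c_def)
  interpret C: lie_group_canonical_chart G M c e0 by (rule C)
  obtain b \<xi> where "quadratic_lie_algebra C.bracket b \<xi>"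
    using C.contact_quadratic_lie_algebra[OF g eta] .
  then interpret Q: quadratic_lie_algebra C.bracket b \<xi> .
  have "DIM('e) \<ge> 3"
    using eta by (simp add: left_invariant_contact_form_def)
  then obtain u w p q where pq: "p \<noteq> 0" "q \<noteq> 0"
    and B: "C.bracket \<xi> u = w" "C.bracket \<xi> w = p *\<^sub>R u" "C.bracket u w = q *\<^sub>R \<xi>"
    and span: "\<And>x. \<exists>a b c. x = a *\<^sub>R \<xi> + b *\<^sub>R u + c *\<^sub>R w"
    and ind: "independent {\<xi>, u, w}" "\<xi> \<noteq> u" "\<xi> \<noteq> w" "u \<noteq> w" and dim: "DIM('e) = 3"
    by (rule Q.adapted_basis) blast
  have dim': "DIM('e) = DIM(real^3)" using dim by simp
  define s t where "s = sqrt \<bar>p\<bar>" and "t = sqrt \<bar>q\<bar>"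
  have st: "s * s = \<bar>p\<bar>" "t * t = \<bar>q\<bar>" "s \<noteq> 0" "t \<noteq> 0" using pq by (simp_all add: s_def t_def)
  have sst: "s * (s * t) = \<bar>p\<bar> * t" by (simp only: st(1) flip: mult.assoc)
  obtain d where d: "d \<in> charts_at SL2R_manifold (mat 1)"
    "\<And>u. frechet_derivative (cinv d) (at (cmap d (mat 1))) u = mat2 (u $ 1) (u $ 2) (u $ 3) (- (u $ 1))"
    by (rule sl2_chart) blast
  have sl_range: "mat2 x y z (- x) \<in> range (frechet_derivative (cinv d) (at (cmap d (mat 1))))" for x y z
    by (rule range_eqI[of _ _ "vector [x, y, z]"]) (simp add: d(2))
  note SL = embedded_group.locally_isomorphic_by_basis[OF embedded_group_SL2R C dim' ind span B d(1)]
  \<comment> \<open>The scalars \<open>s\<close> and \<open>t\<close> adjust the absolute values of \<open>p\<close> and \<open>q\<close>.  On the span of \<open>u\<close> and \<open>w\<close> the square of \<open>ad \<xi>\<close> is \<open>p\<close>; so \<open>\<xi>\<close> is sent to a real diagonal matrix if \<open>p > 0\<close>, and to the generator of a rotation group if \<open>p < 0\<close>.\<close>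
  show ?thesis
  proof (cases "p > 0")
    case p: True
    show ?thesis
    proof (cases "q > 0")
      case True
      have "locally_isomorphic G M SL2R SL2R_manifold"
        by (rule SL[where ?E1.0 = "mat2 (s / 2) 0 0 (- (s / 2))" and ?E2.0 = "mat2 0 (t / 2) (- (t / 2)) 0"
              and ?E3.0 = "mat2 0 (s * t / 2) (s * t / 2) 0"])
          (use p True st sst sl_range[of "s / 2" 0 0] sl_range[of 0 "t / 2" "- (t / 2)"]
            sl_range[of 0 "s * t / 2" "s * t / 2"] in
            \<open>auto simp: mat2_mult mat2_diff mat2_scaleR mat2_add mat2_eq_iff mat2_zero field_simps\<close>)
      then show ?thesis ..
    next
      case False
      have "locally_isomorphic G M SL2R SL2R_manifold"
        by (rule SL[where ?E1.0 = "mat2 (s / 2) 0 0 (- (s / 2))" and ?E2.0 = "mat2 0 (t / 2) (t / 2) 0"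
              and ?E3.0 = "mat2 0 (s * t / 2) (- (s * t / 2)) 0"])
          (use p False st sst sl_range[of "s / 2" 0 0] sl_range[of 0 "t / 2" "t / 2"]
            sl_range[of 0 "s * t / 2" "- (s * t / 2)"] in
            \<open>auto simp: mat2_mult mat2_diff mat2_scaleR mat2_add mat2_eq_iff mat2_zero field_simps\<close>)
      then show ?thesis ..
    qed
  next
    case p: False
    show ?thesis
    proof (cases "q > 0")
      case True
      obtain d where d: "d \<in> charts_at SU2_manifold (mat 1)"
        "\<And>u. frechet_derivative (cinv d) (at (cmap d (mat 1))) u
          = mat2 (Complex 0 (u $ 1)) (Complex (u $ 2) (u $ 3)) (Complex (- (u $ 2)) (u $ 3)) (Complex 0 (- (u $ 1)))"
        by (rule su2_chart) blast
      have su_range: "mat2 (Complex 0 x) (Complex y z) (Complex (- y) z) (Complex 0 (- x))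
          \<in> range (frechet_derivative (cinv d) (at (cmap d (mat 1))))" for x y z
        by (rule range_eqI[of _ _ "vector [x, y, z]"]) (simp add: d(2))
      have "locally_isomorphic G M SU2 SU2_manifold"
        by (rule embedded_group.locally_isomorphic_by_basis[OF embedded_group_SU2 C dim' ind span B d(1),
              where ?E1.0 = "mat2 (Complex 0 (s / 2)) (Complex 0 0) (Complex (- 0) 0) (Complex 0 (- (s / 2)))"
              and ?E2.0 = "mat2 (Complex 0 0) (Complex (t / 2) 0) (Complex (- (t / 2)) 0) (Complex 0 (- 0))"
              and ?E3.0 = "mat2 (Complex 0 0) (Complex 0 (s * t / 2)) (Complex (- 0) (s * t / 2)) (Complex 0 (- 0))"])
          (use p True st sst su_range[of "s / 2" 0 0] su_range[of 0 "t / 2" 0] su_range[of 0 0 "s * t / 2"] in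
            \<open>auto simp: mat2_mult mat2_diff mat2_scaleR mat2_add mat2_eq_iff mat2_zero complex_eq_iff field_simps\<close>)
      then show ?thesis ..
    next
      case False
      have "locally_isomorphic G M SL2R SL2R_manifold"
        by (rule SL[where ?E1.0 = "mat2 0 (s / 2) (- (s / 2)) 0" and ?E2.0 = "mat2 (t / 2) 0 0 (- (t / 2))"
              and ?E3.0 = "mat2 0 (- (s * t / 2)) (- (s * t / 2)) 0"])
          (use p False st sst sl_range[of 0 "s / 2" "- (s / 2)"] sl_range[of "t / 2" 0 0]
            sl_range[of 0 "- (s * t / 2)" "- (s * t / 2)"] in
            \<open>auto simp: mat2_mult mat2_diff mat2_scaleR mat2_add mat2_eq_iff mat2_zero field_simps\<close>)
      then show ?thesis ..
    qed
  qed
qed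

end
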